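(* Let $n$ be a positive integer, let $r$ be an integer with $0 \leq r < n-r$, and let $\lambda = (n-r,1^r) \vdash n$. Then the Specht module $S^\lambda_2$ in characteristic $2$ is uniserial if and only if one of the following occurs: \begin{itemize} \item $r=0$; \item $r=1$; \item $r=2$ and $n \equiv 1 \text{ or } 2 \pmod 4$; \item $r=3$ and $n \equiv 3 \pmod 4$. \end{itemize}
   Context: $S_n$ is the symmetric group on $n$ letters and $\mathbb{F}$ is an arbitrary field of characteristic $2$. For a partition $\lambda$ of $n$, $M^\lambda$ is the $\mathbb{F}S_n$-permutation module with basis the $\lambda$-tabloids (row-equivalence classes $\{t\}$ of bijective $\lambda$-tableaux $t$), and the Specht module $S^\lambda_2\subseteq M^\lambda$ is the submodule spanned by the polytabloids $e_t=\sum_{\sigma\in C_t}\mathrm{sgn}(\sigma)\,\sigma\{t\}$, where $C_t$ is the group of permutations preserving each column of $t$ (James's convention). The partition $(n-r,1^r)$ has first part $n-r$ followed by $r$ parts equal to $1$. A module is uniserial if its submodules are totally ordered by inclusion. *)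

theory Defs
  imports
    "HOL-Library.FuncSet"
    "HOL-Library.Function_Algebras"
    "HOL-Combinatorics.Permutations"
    "HOL-Computational_Algebra.Computational_Algebra"
begin

section \<open>Tableaux and tabloids\<close>

text \<open>
  A partition is the list of its parts. Cells are pairs (row, column), counted from \<open>0\<close>;
  the symmetric group acts on the letters \<open>1, \<dots>, n\<close>, where \<open>n\<close> is the sum of the parts.
\<close>

definition diagram :: "nat list \<Rightarrow> (nat \<times> nat) set" where
  "diagram \<mu> = {(i, j). i < length \<mu> \<and> j < \<mu> ! i}"

definition letters :: "nat list \<Rightarrow> nat set" where
  "letters \<mu> = {1..sum_list \<mu>}"

definition symgroup :: "nat list \<Rightarrow> (nat \<Rightarrow> nat) set" where
  "symgroup \<mu> = {\<sigma>. \<sigma> permutes letters \<mu>}"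

type_synonym tableau = "nat \<times> nat \<Rightarrow> nat"
type_synonym tabloid = "tableau set"

text \<open>
  Extensionality makes a tableau determined by its entries on the diagram.
\<close>

definition tableaux :: "nat list \<Rightarrow> tableau set" where
  "tableaux \<mu> = {t \<in> extensional (diagram \<mu>). bij_betw t (diagram \<mu>) (letters \<mu>)}"

definition row_of :: "nat list \<Rightarrow> tableau \<Rightarrow> nat \<Rightarrow> nat set" where
  "row_of \<mu> t i = {t (i, j) | j. (i, j) \<in> diagram \<mu>}"

definition column_of :: "nat list \<Rightarrow> tableau \<Rightarrow> nat \<Rightarrow> nat set" where
  "column_of \<mu> t j = {t (i, j) | i. (i, j) \<in> diagram \<mu>}"

definition act_tableau :: "nat list \<Rightarrow> (nat \<Rightarrow> nat) \<Rightarrow> tableau \<Rightarrow> tableau" where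
  "act_tableau \<mu> \<sigma> t = compose (diagram \<mu>) \<sigma> t"

definition row_stabilizer :: "nat list \<Rightarrow> tableau \<Rightarrow> (nat \<Rightarrow> nat) set" where
  "row_stabilizer \<mu> t = {\<sigma> \<in> symgroup \<mu>. \<forall>i. \<sigma> ` row_of \<mu> t i = row_of \<mu> t i}"

definition column_stabilizer :: "nat list \<Rightarrow> tableau \<Rightarrow> (nat \<Rightarrow> nat) set" where
  "column_stabilizer \<mu> t = {\<sigma> \<in> symgroup \<mu>. \<forall>j. \<sigma> ` column_of \<mu> t j = column_of \<mu> t j}"

definition row_equiv :: "nat list \<Rightarrow> (tableau \<times> tableau) set" where
  "row_equiv \<mu> =
     {(s, t). s \<in> tableaux \<mu> \<and> t \<in> tableaux \<mu> \<and>
              (\<exists>\<sigma>\<in>row_stabilizer \<mu> s. t = act_tableau \<mu> \<sigma> s)}"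

definition tabloid_of :: "nat list \<Rightarrow> tableau \<Rightarrow> tabloid" where
  "tabloid_of \<mu> t = row_equiv \<mu> `` {t}"

definition tabloids :: "nat list \<Rightarrow> tabloid set" where
  "tabloids \<mu> = tableaux \<mu> // row_equiv \<mu>"

definition act_tabloid :: "nat list \<Rightarrow> (nat \<Rightarrow> nat) \<Rightarrow> tabloid \<Rightarrow> tabloid" where
  "act_tabloid \<mu> \<sigma> T = act_tableau \<mu> \<sigma> ` T"

section \<open>The permutation module and the Specht module\<close>

definition fscale :: "'a::field \<Rightarrow> ('b \<Rightarrow> 'a) \<Rightarrow> 'b \<Rightarrow> 'a" where
  "fscale c f = (\<lambda>x. c * f x)"

global_interpretation fun_vs: vector_space fscale
  by standard (simp_all add: fscale_def fun_eq_iff algebra_simps)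

text \<open>
  The free vector space on the (finitely many) tabloids is the space of functions supported
  on them.
\<close>

definition perm_module :: "nat list \<Rightarrow> (tabloid \<Rightarrow> 'a::field) set" where
  "perm_module \<mu> = {f. \<forall>T. T \<notin> tabloids \<mu> \<longrightarrow> f T = 0}"

definition basis_vec :: "tabloid \<Rightarrow> tabloid \<Rightarrow> 'a::field" where
  "basis_vec T = (\<lambda>U. if U = T then 1 else 0)"

definition act :: "nat list \<Rightarrow> (nat \<Rightarrow> nat) \<Rightarrow> (tabloid \<Rightarrow> 'a::field) \<Rightarrow> tabloid \<Rightarrow> 'a" where
  "act \<mu> \<sigma> f = (\<Sum>T\<in>tabloids \<mu>. fscale (f T) (basis_vec (act_tabloid \<mu> \<sigma> T)))"

definition polytabloid :: "nat list \<Rightarrow> tableau \<Rightarrow> tabloid \<Rightarrow> 'a::field" where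
  "polytabloid \<mu> t =
     (\<Sum>\<sigma>\<in>column_stabilizer \<mu> t.
        fscale (of_int (sign \<sigma>)) (basis_vec (act_tabloid \<mu> \<sigma> (tabloid_of \<mu> t))))"

definition specht :: "nat list \<Rightarrow> (tabloid \<Rightarrow> 'a::field) set" where
  "specht \<mu> = fun_vs.span (polytabloid \<mu> ` tableaux \<mu>)"

text \<open>
  Submodules over the group algebra are the subspaces invariant under the group.
\<close>

definition submodule :: "nat list \<Rightarrow> (tabloid \<Rightarrow> 'a::field) set \<Rightarrow> bool" where
  "submodule \<mu> U \<longleftrightarrow>
     U \<subseteq> perm_module \<mu> \<and> fun_vs.subspace U \<and>
     (\<forall>\<sigma>\<in>symgroup \<mu>. \<forall>f\<in>U. act \<mu> \<sigma> f \<in> U)"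

definition uniserial :: "nat list \<Rightarrow> (tabloid \<Rightarrow> 'a::field) set \<Rightarrow> bool" where
  "uniserial \<mu> S \<longleftrightarrow>
     (\<forall>U V. submodule \<mu> U \<and> U \<subseteq> S \<and> submodule \<mu> V \<and> V \<subseteq> S \<longrightarrow> U \<subseteq> V \<or> V \<subseteq> U)"

lemma diagram_Sigma: "diagram \<mu> = Sigma {..<length \<mu>} (\<lambda>i. {..<\<mu> ! i})"
  by (auto simp: diagram_def)

lemma finite_diagram: "finite (diagram \<mu>)"
  by (simp add: diagram_Sigma)

lemma finite_tableaux: "finite (tableaux \<mu>)"
proof (rule finite_subset)
  show "tableaux \<mu> \<subseteq> diagram \<mu> \<rightarrow>\<^sub>E letters \<mu>"
    by (auto simp: tableaux_def PiE_def Pi_def bij_betw_def)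
  show "finite (diagram \<mu> \<rightarrow>\<^sub>E letters \<mu>)"
    by (intro finite_PiE finite_diagram) (simp add: letters_def)
qed

lemma finite_tabloids: "finite (tabloids \<mu>)"
proof -
  have "tabloids \<mu> = tabloid_of \<mu> ` tableaux \<mu>"
    by (auto simp: tabloids_def tabloid_of_def quotient_def)
  then show ?thesis using finite_tableaux by simp
qed

lemma act_tableau_in: "\<sigma> \<in> symgroup \<mu> \<Longrightarrow> t \<in> tableaux \<mu> \<Longrightarrow> act_tableau \<mu> \<sigma> t \<in> tableaux \<mu>"
proof -
  assume a: "\<sigma> \<in> symgroup \<mu>" "t \<in> tableaux \<mu>"
  then have "bij_betw (\<sigma> \<circ> t) (diagram \<mu>) (letters \<mu>)"
    by (auto simp: symgroup_def tableaux_def intro: bij_betw_trans permutes_imp_bij)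
  then have "bij_betw (compose (diagram \<mu>) \<sigma> t) (diagram \<mu>) (letters \<mu>)"
    by (subst bij_betw_cong[of _ _ "\<sigma> \<circ> t"]) (auto simp: compose_def)
  then show ?thesis by (simp add: act_tableau_def tableaux_def)
qed

lemma act_tableau_comp: "act_tableau \<mu> \<sigma> (act_tableau \<mu> \<tau> t) = act_tableau \<mu> (\<sigma> \<circ> \<tau>) t"
  by (auto simp: act_tableau_def compose_def restrict_def fun_eq_iff)

lemma act_tableau_id: "t \<in> tableaux \<mu> \<Longrightarrow> act_tableau \<mu> id t = t"
  by (auto simp: act_tableau_def compose_def restrict_def fun_eq_iff tableaux_def extensional_def)

lemma row_of_act: "row_of \<mu> (act_tableau \<mu> \<sigma> t) i = \<sigma> ` row_of \<mu> t i"
  by (auto simp: row_of_def act_tableau_def compose_def)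

lemma column_of_act: "column_of \<mu> (act_tableau \<mu> \<sigma> t) j = \<sigma> ` column_of \<mu> t j"
  by (auto simp: column_of_def act_tableau_def compose_def)

lemma symgroup_comp: "\<sigma> \<in> symgroup \<mu> \<Longrightarrow> \<tau> \<in> symgroup \<mu> \<Longrightarrow> \<sigma> \<circ> \<tau> \<in> symgroup \<mu>"
  by (simp add: symgroup_def permutes_compose)

lemma symgroup_inv: "\<sigma> \<in> symgroup \<mu> \<Longrightarrow> inv \<sigma> \<in> symgroup \<mu>"
  by (simp add: symgroup_def permutes_inv)

lemma symgroup_invs:
  assumes "\<sigma> \<in> symgroup \<mu>" shows "\<sigma> \<circ> inv \<sigma> = id" "inv \<sigma> \<circ> \<sigma> = id"
  using assms by (auto simp: symgroup_def permutes_inv_o)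

lemma row_stabilizer_act:
  assumes "\<sigma> \<in> symgroup \<mu>" "\<pi> \<in> row_stabilizer \<mu> t"
  shows "\<sigma> \<circ> \<pi> \<circ> inv \<sigma> \<in> row_stabilizer \<mu> (act_tableau \<mu> \<sigma> t)"
proof -
  have "(\<sigma> \<circ> \<pi> \<circ> inv \<sigma>) ` \<sigma> ` X = \<sigma> ` \<pi> ` X" for X
    using symgroup_invs(2)[OF assms(1)] by (simp add: image_image pointfree_idE)
  with assms show ?thesis
    by (simp add: row_stabilizer_def row_of_act symgroup_comp symgroup_inv)
qed

lemma column_stabilizer_act:
  assumes "\<sigma> \<in> symgroup \<mu>" "\<pi> \<in> column_stabilizer \<mu> t"
  shows "\<sigma> \<circ> \<pi> \<circ> inv \<sigma> \<in> column_stabilizer \<mu> (act_tableau \<mu> \<sigma> t)"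
proof -
  have "(\<sigma> \<circ> \<pi> \<circ> inv \<sigma>) ` \<sigma> ` X = \<sigma> ` \<pi> ` X" for X
    using symgroup_invs(2)[OF assms(1)] by (simp add: image_image pointfree_idE)
  with assms show ?thesis
    by (simp add: column_stabilizer_def column_of_act symgroup_comp symgroup_inv)
qed

lemma equiv_row_equiv: "equiv (tableaux \<mu>) (row_equiv \<mu>)"
proof (rule equivI)
  show "row_equiv \<mu> \<subseteq> tableaux \<mu> \<times> tableaux \<mu>" by (auto simp: row_equiv_def)
  have "id \<in> row_stabilizer \<mu> t" for t
    by (simp add: row_stabilizer_def symgroup_def permutes_id)
  then show "refl_on (tableaux \<mu>) (row_equiv \<mu>)"
    by (force simp: refl_on_def row_equiv_def act_tableau_id)
  show "sym (row_equiv \<mu>)"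
  proof (rule symI)
    fix s t assume "(s, t) \<in> row_equiv \<mu>"
    then obtain \<pi> where p: "s \<in> tableaux \<mu>" "t \<in> tableaux \<mu>" "\<pi> \<in> row_stabilizer \<mu> s"
      "t = act_tableau \<mu> \<pi> s" by (auto simp: row_equiv_def)
    have P: "\<pi> \<in> symgroup \<mu>" using p by (simp add: row_stabilizer_def)
    have "inv \<pi> ` row_of \<mu> s i = row_of \<mu> s i" for i
    proof -
      have "row_of \<mu> s i = \<pi> ` row_of \<mu> s i" using p by (simp add: row_stabilizer_def)
      then have "inv \<pi> ` row_of \<mu> s i = (inv \<pi> \<circ> \<pi>) ` row_of \<mu> s i" by (metis image_comp)
      then show ?thesis using symgroup_invs[OF P] by simp
    qed
    then have "inv \<pi> \<in> row_stabilizer \<mu> t"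
      using P p by (simp add: row_stabilizer_def row_of_act symgroup_inv)
    moreover have "act_tableau \<mu> (inv \<pi>) t = s"
      using p symgroup_invs[OF P] by (simp add: act_tableau_comp act_tableau_id)
    ultimately show "(t, s) \<in> row_equiv \<mu>" using p by (force simp: row_equiv_def)
  qed
  show "trans (row_equiv \<mu>)"
  proof (rule transI)
    fix s t u assume "(s, t) \<in> row_equiv \<mu>" "(t, u) \<in> row_equiv \<mu>"
    then obtain \<pi> \<rho> where p: "s \<in> tableaux \<mu>" "t \<in> tableaux \<mu>" "u \<in> tableaux \<mu>"
      "\<pi> \<in> row_stabilizer \<mu> s" "t = act_tableau \<mu> \<pi> s"
      "\<rho> \<in> row_stabilizer \<mu> t" "u = act_tableau \<mu> \<rho> t" by (auto simp: row_equiv_def)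
    then have "\<rho> \<circ> \<pi> \<in> row_stabilizer \<mu> s"
      by (simp add: row_stabilizer_def symgroup_comp row_of_act image_comp[symmetric] del: o_apply)
    with p show "(s, u) \<in> row_equiv \<mu>" by (auto simp: row_equiv_def act_tableau_comp)
  qed
qed

lemma row_equiv_act:
  assumes "\<sigma> \<in> symgroup \<mu>" "(s, t) \<in> row_equiv \<mu>"
  shows "(act_tableau \<mu> \<sigma> s, act_tableau \<mu> \<sigma> t) \<in> row_equiv \<mu>"
proof -
  from assms obtain \<pi> where p: "s \<in> tableaux \<mu>" "t \<in> tableaux \<mu>" "\<pi> \<in> row_stabilizer \<mu> s"
    "t = act_tableau \<mu> \<pi> s" by (auto simp: row_equiv_def)
  have "act_tableau \<mu> \<sigma> t = act_tableau \<mu> (\<sigma> \<circ> \<pi> \<circ> inv \<sigma>) (act_tableau \<mu> \<sigma> s)"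
    using p symgroup_invs(2)[OF assms(1)] by (simp add: act_tableau_comp o_assoc[symmetric])
  with row_stabilizer_act[OF assms(1) p(3)] show ?thesis
    using p(1,2) assms(1) act_tableau_in unfolding row_equiv_def by blast
qed

lemma act_tabloid_of:
  assumes "\<sigma> \<in> symgroup \<mu>" "t \<in> tableaux \<mu>"
  shows "act_tabloid \<mu> \<sigma> (tabloid_of \<mu> t) = tabloid_of \<mu> (act_tableau \<mu> \<sigma> t)"
proof
  show "act_tabloid \<mu> \<sigma> (tabloid_of \<mu> t) \<subseteq> tabloid_of \<mu> (act_tableau \<mu> \<sigma> t)"
    using assms row_equiv_act by (auto simp: act_tabloid_def tabloid_of_def)
  show "tabloid_of \<mu> (act_tableau \<mu> \<sigma> t) \<subseteq> act_tabloid \<mu> \<sigma> (tabloid_of \<mu> t)"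
  proof
    fix u assume "u \<in> tabloid_of \<mu> (act_tableau \<mu> \<sigma> t)"
    then have u: "(act_tableau \<mu> \<sigma> t, u) \<in> row_equiv \<mu>" by (simp add: tabloid_of_def)
    then have "u \<in> tableaux \<mu>" by (simp add: row_equiv_def)
    from row_equiv_act[OF symgroup_inv[OF assms(1)] u]
    have "(t, act_tableau \<mu> (inv \<sigma>) u) \<in> row_equiv \<mu>"
      using assms symgroup_invs[OF assms(1)] by (simp add: act_tableau_comp act_tableau_id)
    moreover have "u = act_tableau \<mu> \<sigma> (act_tableau \<mu> (inv \<sigma>) u)"
      using \<open>u \<in> tableaux \<mu>\<close> symgroup_invs[OF assms(1)] by (simp add: act_tableau_comp act_tableau_id)
    ultimately show "u \<in> act_tabloid \<mu> \<sigma> (tabloid_of \<mu> t)"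
      by (auto simp: act_tabloid_def tabloid_of_def)
  qed
qed

lemma tabloid_of_in: "t \<in> tableaux \<mu> \<Longrightarrow> tabloid_of \<mu> t \<in> tabloids \<mu>"
  by (simp add: tabloid_of_def tabloids_def quotientI)

lemma tabloidsE:
  assumes "T \<in> tabloids \<mu>" obtains t where "t \<in> tableaux \<mu>" "T = tabloid_of \<mu> t"
  using assms by (auto simp: tabloids_def tabloid_of_def elim: quotientE)

lemma act_tabloid_in: "\<sigma> \<in> symgroup \<mu> \<Longrightarrow> T \<in> tabloids \<mu> \<Longrightarrow> act_tabloid \<mu> \<sigma> T \<in> tabloids \<mu>"
  by (metis act_tabloid_of act_tableau_in tabloid_of_in tabloidsE)

lemma act_basis_vec:
  assumes "T \<in> tabloids \<mu>"
  shows "act \<mu> \<sigma> (basis_vec T) = basis_vec (act_tabloid \<mu> \<sigma> T)"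
proof -
  have "act \<mu> \<sigma> (basis_vec T) =
      (\<Sum>U\<in>tabloids \<mu>. if U = T then basis_vec (act_tabloid \<mu> \<sigma> U) else (0 :: tabloid \<Rightarrow> 'a))"
    unfolding act_def by (intro sum.cong) (auto simp: basis_vec_def fscale_def fun_eq_iff)
  then show ?thesis using assms finite_tabloids by simp
qed

lemma act_linear: "Vector_Spaces.linear fscale fscale (act \<mu> \<sigma>)"
proof (unfold_locales)
  fix f g :: "tabloid \<Rightarrow> 'a" and c
  show "act \<mu> \<sigma> (f + g) = act \<mu> \<sigma> f + act \<mu> \<sigma> g"
    by (simp add: act_def fun_vs.scale_left_distrib sum.distrib)
  show "act \<mu> \<sigma> (fscale c f) = fscale c (act \<mu> \<sigma> f)"
    unfolding act_def fun_vs.scale_sum_right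
    by (intro sum.cong) (auto simp: fscale_def mult.assoc)
qed

lemma subspace_perm_module: "fun_vs.subspace (perm_module \<mu>)"
  by (auto simp: fun_vs.subspace_def perm_module_def fscale_def)

lemma basis_vec_in: "T \<in> tabloids \<mu> \<Longrightarrow> basis_vec T \<in> perm_module \<mu>"
  by (auto simp: perm_module_def basis_vec_def)

lemma polytabloid_in: "t \<in> tableaux \<mu> \<Longrightarrow> polytabloid \<mu> t \<in> perm_module \<mu>"
  unfolding polytabloid_def
  by (intro fun_vs.subspace_sum fun_vs.subspace_scale subspace_perm_module basis_vec_in
      act_tabloid_in tabloid_of_in) (auto simp: column_stabilizer_def)

lemma act_polytabloid:
  assumes s: "\<sigma> \<in> symgroup \<mu>" and t: "t \<in> tableaux \<mu>"
  shows "act \<mu> \<sigma> (polytabloid \<mu> t) = (polytabloid \<mu> (act_tableau \<mu> \<sigma> t) :: tabloid \<Rightarrow> 'a::field)"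
proof -
  interpret a: Vector_Spaces.linear "fscale :: 'a \<Rightarrow> _" fscale "act \<mu> \<sigma>" by (rule act_linear)
  let ?C = "column_stabilizer \<mu> t" and ?u = "act_tableau \<mu> \<sigma> t"
  have inv_s: "inv (inv \<sigma>) = \<sigma>"
    using s by (simp add: symgroup_def permutes_inv_inv)
  have C: "\<pi> \<in> symgroup \<mu>" if "\<pi> \<in> column_stabilizer \<mu> v" for \<pi> v
    using that by (simp add: column_stabilizer_def)
  have perm: "permutation \<pi>" if "\<pi> \<in> symgroup \<mu>" for \<pi>
    using that by (auto simp: symgroup_def letters_def permutation_permutes)
  have "act \<mu> \<sigma> (polytabloid \<mu> t) =
      (\<Sum>\<pi>\<in>?C. fscale (of_int (sign \<pi>)) (basis_vec (tabloid_of \<mu> (act_tableau \<mu> (\<sigma> \<circ> \<pi>) t))) :: tabloid \<Rightarrow> 'a)"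
    unfolding polytabloid_def a.sum a.scale
    by (intro sum.cong)
      (simp_all add: act_basis_vec act_tabloid_of act_tableau_in tabloid_of_in act_tableau_comp C s t)
  also have "\<dots> = polytabloid \<mu> ?u"
    unfolding polytabloid_def
  proof (rule sum.reindex_bij_witness[where i = "\<lambda>\<rho>. inv \<sigma> \<circ> \<rho> \<circ> \<sigma>" and j = "\<lambda>\<pi>. \<sigma> \<circ> \<pi> \<circ> inv \<sigma>"])
    note i = symgroup_invs[OF s]
    fix \<pi> assume p: "\<pi> \<in> ?C"
    show "inv \<sigma> \<circ> (\<sigma> \<circ> \<pi> \<circ> inv \<sigma>) \<circ> \<sigma> = \<pi>"
      using i by (metis comp_assoc comp_id id_comp)
    show "\<sigma> \<circ> \<pi> \<circ> inv \<sigma> \<in> column_stabilizer \<mu> ?u"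
      by (rule column_stabilizer_act[OF s p])
    have "(\<sigma> \<circ> \<pi> \<circ> inv \<sigma>) \<circ> \<sigma> = \<sigma> \<circ> \<pi>" using i by (metis comp_assoc comp_id)
    moreover have "sign (\<sigma> \<circ> \<pi> \<circ> inv \<sigma>) = sign \<pi>"
      using s C[OF p] perm symgroup_inv[OF s]
      by (simp add: sign_compose permutation_compose sign_inverse)
    moreover have "act_tabloid \<mu> (\<sigma> \<circ> \<pi> \<circ> inv \<sigma>) (tabloid_of \<mu> ?u)
        = tabloid_of \<mu> (act_tableau \<mu> ((\<sigma> \<circ> \<pi> \<circ> inv \<sigma>) \<circ> \<sigma>) t)"
      by (subst act_tabloid_of)
        (simp_all only: act_tableau_in act_tableau_comp symgroup_comp symgroup_inv s t C[OF p])
    ultimately show "fscale (of_int (sign (\<sigma> \<circ> \<pi> \<circ> inv \<sigma>)))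
        (basis_vec (act_tabloid \<mu> (\<sigma> \<circ> \<pi> \<circ> inv \<sigma>) (tabloid_of \<mu> ?u))) =
        (fscale (of_int (sign \<pi>)) (basis_vec (tabloid_of \<mu> (act_tableau \<mu> (\<sigma> \<circ> \<pi>) t))) :: tabloid \<Rightarrow> 'a)"
      by simp
  next
    note i = symgroup_invs[OF s]
    fix \<rho> assume p: "\<rho> \<in> column_stabilizer \<mu> ?u"
    show "\<sigma> \<circ> (inv \<sigma> \<circ> \<rho> \<circ> \<sigma>) \<circ> inv \<sigma> = \<rho>"
      using i by (metis comp_assoc comp_id id_comp)
    show "inv \<sigma> \<circ> \<rho> \<circ> \<sigma> \<in> ?C"
      using column_stabilizer_act[OF symgroup_inv[OF s] p] i t
      by (simp add: inv_s act_tableau_comp act_tableau_id)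
  qed
  finally show ?thesis .
qed

text \<open>
  The linear span of the polytabloids is already invariant, so it is the submodule they generate.
\<close>

lemma submodule_specht: "submodule \<mu> (specht \<mu> :: (tabloid \<Rightarrow> 'a::field) set)"
proof -
  have "specht \<mu> \<subseteq> (perm_module \<mu> :: (tabloid \<Rightarrow> 'a) set)"
    unfolding specht_def
    by (intro fun_vs.span_minimal subspace_perm_module) (auto intro: polytabloid_in)
  moreover have "act \<mu> \<sigma> f \<in> specht \<mu>" if s: "\<sigma> \<in> symgroup \<mu>" and f: "f \<in> specht \<mu>"
    for \<sigma> and f :: "tabloid \<Rightarrow> 'a"
  proof -
    interpret a: Vector_Spaces.linear "fscale :: 'a \<Rightarrow> _" fscale "act \<mu> \<sigma>" by (rule act_linear)
    have "act \<mu> \<sigma> f \<in> fun_vs.span (act \<mu> \<sigma> ` polytabloid \<mu> ` tableaux \<mu>)"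
      using f unfolding specht_def a.span_image by simp
    moreover have "act \<mu> \<sigma> ` polytabloid \<mu> ` tableaux \<mu> \<subseteq> (polytabloid \<mu> ` tableaux \<mu> :: (tabloid \<Rightarrow> 'a) set)"
      using s by (auto simp: act_polytabloid act_tableau_in)
    ultimately show ?thesis unfolding specht_def using fun_vs.span_mono by blast
  qed
  ultimately show ?thesis by (simp add: submodule_def specht_def fun_vs.subspace_span)
qed

definition hook :: "nat \<Rightarrow> nat \<Rightarrow> nat list" where
  "hook n r = (n - r) # replicate r 1"

lemma sum_list_hook: "r \<le> n \<Longrightarrow> sum_list (hook n r) = n"
  by (simp add: hook_def sum_list_replicate)

end

theory Submission
  imports Defs
begin

text \<open>
  In characteristic \<open>2\<close> the Specht module of the hook \<open>(n - r, 1\<^sup>r)\<close> is the module of those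
  functions \<open>f\<close> on the \<open>r\<close>-subsets of \<open>{1..n}\<close> that satisfy \<open>d\<^sub>1 f = 0\<close>, where \<open>d\<^sub>k f B\<close> is the
  sum of \<open>f\<close> over the supersets of \<open>B\<close> with \<open>k\<close> additional elements: a tabloid only matters
  through the set of letters below its first row. The maps \<open>d\<^sub>k\<close> and their adjoints are
  homomorphisms. If the module is not uniserial, two kernels of such maps are incomparable on it:
  those of \<open>d\<^sub>2\<close> and \<open>d\<^sub>4\<close> for \<open>r \<ge> 4\<close>, and those of \<open>d\<^sub>2\<close> and of an adjoint for \<open>r = 2, 3\<close>.

  Conversely, let \<open>U\<close> be a submodule. If some operator \<open>(1 + (a\<^sub>1 b\<^sub>1)) \<dots> (1 + (a\<^sub>r b\<^sub>r))\<close> does not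
  annihilate \<open>U\<close>, then \<open>U\<close> contains a polytabloid of shape \<open>(n - r, r)\<close>, hence all functions
  annihilated by every \<open>d\<^sub>k\<close>, \<open>k > 0\<close> (James's kernel intersection theorem). Otherwise, for
  \<open>r \<le> 3\<close> and the relevant parity of \<open>n\<close>, \<open>U\<close> consists of functions \<open>A \<mapsto> (\<Sum>i\<in>A. b i) + c\<close>. In each
  of the uniserial cases this produces a chain \<open>X\<^sub>0 \<subseteq> X\<^sub>1 \<subseteq> \<dots>\<close> such that a submodule not contained
  in \<open>X\<^sub>i\<close> contains \<open>X\<^sub>i\<^sub>+\<^sub>1\<close>.
\<close>

section \<open>Functions on subsets\<close>

text \<open>Identify sets with squarefree monomials, or with simplices. Then
  \<open>layer X m\<close> is the elementary symmetric polynomial e_m in the variables of X, and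
  \<open>down V k\<close> takes the coefficient of t^k after substituting x_i + t for x_i;
  \<open>down V 1\<close> is the mod 2 boundary of the full simplex. A hook polytabloid becomes the
  boundary of the simplex on its first column, and acyclicity of the simplex makes these boundaries
  span the kernel of d_1. The thresholds come from two formulas. The composite of d_i and d_j is
  (i+j choose i) times d_(i+j): once d_1 f = 0, also d_3 f = 0, so for r \<le> 3 only d_2 separates
  cycles from primitive functions, whereas d_4 is independent of d_2 as soon as r \<ge> 4. And d_k
  e_(m+k) = (card X - m choose k) e_m on X, whose parity produces the residues mod 4. The operators
  of the overview amount to the inner products of f with the two-row polytabloids, so U either
  contains the two-row Specht module or is orthogonal to it. The orthogonal part is the obstacle; it
  is determined by splitting off one pair of letters at a time.\<close>

definition uniform :: "'b set \<Rightarrow> nat \<Rightarrow> ('b set \<Rightarrow> 'a::zero) set" where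
  "uniform V r = {f. \<forall>A. f A \<noteq> 0 \<longrightarrow> A \<subseteq> V \<and> card A = r}"

definition down :: "'b set \<Rightarrow> nat \<Rightarrow> ('b set \<Rightarrow> 'a::comm_monoid_add) \<Rightarrow> 'b set \<Rightarrow> 'a" where
  "down V k f B = (\<Sum>C | C \<subseteq> V - B \<and> card C = k. f (B \<union> C))"

definition up :: "nat \<Rightarrow> ('b set \<Rightarrow> 'a::comm_monoid_add) \<Rightarrow> 'b set \<Rightarrow> 'a" where
  "up k f B = (\<Sum>C | C \<subseteq> B \<and> card C = k. f (B - C))"

definition cycles :: "'b set \<Rightarrow> nat \<Rightarrow> ('b set \<Rightarrow> 'a::comm_monoid_add) set" where
  "cycles V r = {f \<in> uniform V r. \<forall>B. down V 1 f B = 0}"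

definition layer :: "'b set \<Rightarrow> nat \<Rightarrow> 'b set \<Rightarrow> 'a::zero_neq_one" where
  "layer X m A = (if A \<subseteq> X \<and> card A = m then 1 else 0)"

text \<open>Precomposition is a right action; since all permutations of V are quantified, closure
  under it is the same as closure under the usual left action.\<close>

definition invariant :: "'b set \<Rightarrow> ('b set \<Rightarrow> 'a::field) set \<Rightarrow> bool" where
  "invariant V U \<longleftrightarrow> fun_vs.subspace U \<and>
     (\<forall>\<sigma>. \<sigma> permutes V \<longrightarrow> (\<forall>f\<in>U. (\<lambda>A. f (\<sigma> ` A)) \<in> U))"

text \<open>
  Identifying a set with the product of its variables in \<open>\<bbbF>[x]/(x\<^sub>i\<^sup>2)\<close>, \<open>spread a b\<close> is the
  multiplication by \<open>x\<^sub>a + x\<^sub>b\<close> and \<open>link a b\<close> extracts the cofactor from \<open>f + (a b) f\<close>.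
\<close>

definition spread :: "'b \<Rightarrow> 'b \<Rightarrow> ('b set \<Rightarrow> 'a::zero) \<Rightarrow> 'b set \<Rightarrow> 'a" where
  "spread a b f A = (if (a \<in> A) = (b \<in> A) then 0 else f (A - {a, b}))"

definition link :: "'b \<Rightarrow> 'b \<Rightarrow> ('b set \<Rightarrow> 'a::comm_monoid_add) \<Rightarrow> 'b set \<Rightarrow> 'a" where
  "link a b f A = (if a \<in> A \<or> b \<in> A then 0 else f (insert a A) + f (insert b A))"

text \<open>The letters are read in consecutive pairs, and a single letter left at the end is
  ignored. With 2 * r distinct letters, \<open>spreads xs (layer {} 0)\<close> is a product of r
  factors x_a + x_b, that is, a polytabloid of shape (n - r, r) mod 2.\<close>

fun spreads :: "'b list \<Rightarrow> ('b set \<Rightarrow> 'a::zero) \<Rightarrow> 'b set \<Rightarrow> 'a" where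
  "spreads (a # b # xs) f = spread a b (spreads xs f)"
| "spreads _ f = f"

fun links :: "'b list \<Rightarrow> ('b set \<Rightarrow> 'a::comm_monoid_add) \<Rightarrow> 'b set \<Rightarrow> 'a" where
  "links (a # b # xs) f = link a b (links xs f)"
| "links _ f = f"

section \<open>Support, linearity and equivariance of the operators\<close>

lemma uniform_zero: "f \<in> uniform V r \<Longrightarrow> \<not> (A \<subseteq> V \<and> card A = r) \<Longrightarrow> f A = 0"
  by (auto simp: uniform_def)

lemma uniform_eqI:
  assumes "f \<in> uniform V r" "g \<in> uniform V r" "\<And>A. A \<subseteq> V \<Longrightarrow> card A = r \<Longrightarrow> f A = g A"
  shows "f = g"
proof
  fix A show "f A = g A"
    using assms(3)[of A] uniform_zero[OF assms(1), of A] uniform_zero[OF assms(2), of A]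
    by (cases "A \<subseteq> V \<and> card A = r") auto
qed

lemma subspace_uniform: "fun_vs.subspace (uniform V r :: ('b set \<Rightarrow> 'a::field) set)"
proof (rule fun_vs.subspaceI)
  show "0 \<in> uniform V r" by (simp add: uniform_def)
next
  fix f g :: "'b set \<Rightarrow> 'a" assume "f \<in> uniform V r" "g \<in> uniform V r"
  then have "\<not> (A \<subseteq> V \<and> card A = r) \<Longrightarrow> (f + g) A = 0" for A
    by (simp add: uniform_zero)
  then show "f + g \<in> uniform V r" unfolding uniform_def by blast
next
  fix c and f :: "'b set \<Rightarrow> 'a" assume "f \<in> uniform V r"
  then show "fscale c f \<in> uniform V r" by (simp add: uniform_def fscale_def)
qed

lemma down_add: "down V k (f + g) B = down V k f B + down V k g B"
  by (simp add: down_def sum.distrib)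

lemma down_scale: "down V k (fscale c f) B = c * down V k f B"
  by (simp add: down_def fscale_def sum_distrib_left)

lemma down_zero [simp]: "down V k 0 B = 0" "down V k (\<lambda>A. 0) B = 0"
  by (simp_all add: down_def)

lemma up_add: "up k (f + g) B = up k f B + up k g B"
  by (simp add: up_def sum.distrib)

lemma up_scale: "up k (fscale c f) B = c * up k f B"
  by (simp add: up_def fscale_def sum_distrib_left)

lemma up_zero [simp]: "up k 0 B = 0"
  by (simp add: up_def)

lemma down_image:
  assumes "\<sigma> permutes V"
  shows "down V k (\<lambda>A. f (\<sigma> ` A)) B = down V k f (\<sigma> ` B)"
  unfolding down_def
proof (rule sum.reindex_bij_witness[where i = "\<lambda>C. inv \<sigma> ` C" and j = "\<lambda>C. \<sigma> ` C"])
  have inj: "inj \<sigma>" using assms by (rule permutes_inj)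
  note V = permutes_image[OF assms]
  fix C assume C: "C \<in> {C. C \<subseteq> V - B \<and> card C = k}"
  show "inv \<sigma> ` \<sigma> ` C = C" using inj by (simp add: image_inv_f_f)
  have "\<sigma> ` C \<subseteq> \<sigma> ` (V - B)" using C by auto
  then show "\<sigma> ` C \<in> {C. C \<subseteq> V - \<sigma> ` B \<and> card C = k}"
    using C inj V by (simp add: image_set_diff card_image inj_on_subset)
  show "f (\<sigma> ` B \<union> \<sigma> ` C) = f (\<sigma> ` (B \<union> C))" by (simp add: image_Un)
next
  have inj': "inj \<sigma>" and surj: "surj \<sigma>"
    using permutes_inj[OF assms] permutes_surj[OF assms] .
  have inj: "inj (inv \<sigma>)" using surj by (rule surj_imp_inj_inv)
  note V = permutes_image[OF permutes_inv[OF assms]]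
  fix C assume C: "C \<in> {C. C \<subseteq> V - \<sigma> ` B \<and> card C = k}"
  show "\<sigma> ` inv \<sigma> ` C = C" using surj by (simp add: image_f_inv_f)
  have "inv \<sigma> ` C \<subseteq> inv \<sigma> ` (V - \<sigma> ` B)" using C by auto
  then show "inv \<sigma> ` C \<in> {C. C \<subseteq> V - B \<and> card C = k}"
    using C inj inj' V by (simp add: image_set_diff card_image inj_on_subset image_inv_f_f)
qed

lemma up_image:
  assumes "\<sigma> permutes V"
  shows "up k (\<lambda>A. f (\<sigma> ` A)) B = up k f (\<sigma> ` B)"
  unfolding up_def
proof (rule sum.reindex_bij_witness[where i = "\<lambda>C. inv \<sigma> ` C" and j = "\<lambda>C. \<sigma> ` C"])
  have inj: "inj \<sigma>" using assms by (rule permutes_inj)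
  fix C assume C: "C \<in> {C. C \<subseteq> B \<and> card C = k}"
  show "inv \<sigma> ` \<sigma> ` C = C" using inj by (simp add: image_inv_f_f)
  show "\<sigma> ` C \<in> {C. C \<subseteq> \<sigma> ` B \<and> card C = k}"
    using C inj by (auto simp add: card_image inj_on_subset)
  show "f (\<sigma> ` B - \<sigma> ` C) = f (\<sigma> ` (B - C))" using inj by (simp add: image_set_diff)
next
  have inj': "inj \<sigma>" and surj: "surj \<sigma>"
    using permutes_inj[OF assms] permutes_surj[OF assms] .
  have inj: "inj (inv \<sigma>)" using surj by (rule surj_imp_inj_inv)
  fix C assume C: "C \<in> {C. C \<subseteq> \<sigma> ` B \<and> card C = k}"
  show "\<sigma> ` inv \<sigma> ` C = C" using surj by (simp add: image_f_inv_f)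
  have "inv \<sigma> ` C \<subseteq> inv \<sigma> ` \<sigma> ` B" using C by auto
  then show "inv \<sigma> ` C \<in> {C. C \<subseteq> B \<and> card C = k}"
    using C inj inj' by (simp add: card_image inj_on_subset image_inv_f_f)
qed

lemma uniform_image:
  assumes "\<sigma> permutes V" "f \<in> uniform V r"
  shows "(\<lambda>A. f (\<sigma> ` A)) \<in> uniform V r"
proof -
  have inj: "inj \<sigma>" using assms(1) by (rule permutes_inj)
  have "A \<subseteq> V \<and> card A = r" if "f (\<sigma> ` A) \<noteq> 0" for A
  proof -
    have "\<sigma> ` A \<subseteq> V" "card (\<sigma> ` A) = r" using assms(2) that by (auto simp: uniform_def)
    then show ?thesis using inj permutes_in_image[OF assms(1)]
      by (auto simp: card_image inj_on_subset)
  qed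
  then show ?thesis by (simp add: uniform_def)
qed

lemma invariant_cycles: "invariant V (cycles V r :: ('b set \<Rightarrow> 'a::field) set)"
  unfolding invariant_def
proof (intro conjI allI impI ballI)
  show "fun_vs.subspace (cycles V r :: ('b set \<Rightarrow> 'a::field) set)"
    using subspace_uniform[of V r]
    by (auto simp: fun_vs.subspace_def cycles_def down_add down_scale)
qed (auto simp: cycles_def down_image uniform_image simp del: One_nat_def)

lemma subspace_cycles: "fun_vs.subspace (cycles V r :: ('b set \<Rightarrow> 'a::field) set)"
  using invariant_cycles[of V r, where 'a = 'a] unfolding invariant_def by (rule conjunct1)

lemma invariant_Int: "invariant V U \<Longrightarrow> invariant V W \<Longrightarrow> invariant V (U \<inter> W)"
  by (auto simp: invariant_def fun_vs.subspace_inter)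

lemma invariant_down_kernel: "invariant V {f. \<forall>B. down V k f B = (0 :: 'a::field)}"
  by (auto simp: invariant_def fun_vs.subspace_def down_add down_scale down_image)

lemma spread_scale: "spread a b (fscale c f) = fscale c (spread a b f)"
  by (simp add: spread_def fscale_def fun_eq_iff)

lemma spread_zero [simp]: "spread a b 0 = 0" "spread a b (\<lambda>A. 0) = (\<lambda>A. 0)"
  by (simp_all add: spread_def fun_eq_iff)

lemma spreads_scale: "spreads xs (fscale c f) = fscale c (spreads xs f)"
  by (induction xs f rule: spreads.induct) (simp_all add: spread_scale)

lemma spreads_zero [simp]: "spreads xs 0 = 0"
  by (induction xs "0 :: 'a set \<Rightarrow> 'b" rule: spreads.induct) simp_all

lemma spread_uniform:
  fixes f :: "'b set \<Rightarrow> 'a::zero"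
  assumes "f \<in> uniform (V - {a, b}) r" "a \<in> V" "b \<in> V" "finite V"
  shows "spread a b f \<in> uniform V (Suc r)"
proof -
  have "A \<subseteq> V \<and> card A = Suc r" if "spread a b f A \<noteq> 0" for A
  proof -
    have ab: "(a \<in> A) \<noteq> (b \<in> A)" and f: "f (A - {a, b}) \<noteq> 0"
      using that by (auto simp: spread_def split: if_splits)
    then have s: "A - {a, b} \<subseteq> V - {a, b}" "card (A - {a, b}) = r"
      using assms(1) by (auto simp: uniform_def)
    then have "A \<subseteq> V" using assms by auto
    moreover have "finite A" using calculation assms(4) finite_subset by blast
    moreover have "A = insert a (A - {a, b}) \<or> A = insert b (A - {a, b})" using ab by blast
    ultimately show ?thesis using s
      by (metis Diff_iff card_insert_disjoint finite_Diff insertCI)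
  qed
  then show ?thesis by (simp add: uniform_def)
qed

lemma spreads_uniform:
  fixes f :: "'b set \<Rightarrow> 'a::zero"
  assumes "distinct xs" "even (length xs)" "f \<in> uniform (V - set xs) r" "set xs \<subseteq> V" "finite V"
  shows "spreads xs f \<in> uniform V (r + length xs div 2)"
  using assms
proof (induction xs f arbitrary: V rule: spreads.induct)
  case (1 a b xs f)
  have "V - set (a # b # xs) = V - {a, b} - set xs" by auto
  then have "spreads xs f \<in> uniform (V - {a, b}) (r + length xs div 2)"
    using 1 by (intro 1(1)) auto
  then show ?case using 1(5,6) spread_uniform by fastforce
qed auto

lemma link_spread_commute:
  fixes f :: "'b set \<Rightarrow> 'a::field"
  assumes "{a, b} \<inter> {c, d} = {}"
  shows "link a b (spread c d f) = spread c d (link a b f)"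
proof -
  have *: "insert x A - {c, d} = insert x (A - {c, d})" if "x \<in> {a, b}" for A x
    using assms that by auto
  show ?thesis using assms by (auto simp: spread_def link_def fun_eq_iff * simp del: Diff_insert)
qed

lemma link_spreads_commute:
  fixes f :: "'b set \<Rightarrow> 'a::field"
  assumes "{a, b} \<inter> set xs = {}"
  shows "link a b (spreads xs f) = spreads xs (link a b f)"
  using assms
  by (induction xs f rule: spreads.induct) (simp_all add: link_spread_commute)

text \<open>Makes the last pair the innermost one, so that a condition on f for all lists becomes a
  condition on \<open>link a b f\<close> for shorter lists.\<close>

lemma links_snoc:
  "even (length xs) \<Longrightarrow> links (xs @ [a, b]) f = links xs (link a b f)"
  by (induction xs f rule: links.induct) auto

lemma link_uniform:
  fixes f :: "'b set \<Rightarrow> 'a::field"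
  assumes "f \<in> uniform V (Suc r)" "a \<in> V" "b \<in> V" "finite V"
  shows "link a b f \<in> uniform (V - {a, b}) r"
proof -
  have "A \<subseteq> V - {a, b} \<and> card A = r" if nz: "link a b f A \<noteq> 0" for A
  proof -
    have ab: "a \<notin> A" "b \<notin> A" using nz by (auto simp: link_def split: if_splits)
    then obtain x where x: "x \<in> {a, b}" "f (insert x A) \<noteq> 0"
      using nz unfolding link_def by (metis add.right_neutral insert_iff)
    then have "insert x A \<subseteq> V" "card (insert x A) = Suc r" using assms(1) by (auto simp: uniform_def)
    moreover have "x \<notin> A" using x ab by auto
    ultimately show ?thesis using ab assms(4)
      by (metis Diff_empty card_insert_disjoint finite_insert insert_subset nat.inject
          rev_finite_subset subset_Diff_insert)
  qed
  then show ?thesis by (simp add: uniform_def)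
qed

lemma links_uniform:
  fixes f :: "'b set \<Rightarrow> 'a::field"
  assumes "distinct xs" "even (length xs)" "f \<in> uniform V (r + length xs div 2)"
    "set xs \<subseteq> V" "finite V"
  shows "links xs f \<in> uniform (V - set xs) r"
  using assms
proof (induction xs f arbitrary: r rule: links.induct)
  case (1 a b xs f)
  have "links xs f \<in> uniform (V - set xs) (Suc r)"
    using 1 by (intro 1(1)) auto
  then have "link a b (links xs f) \<in> uniform (V - set xs - {a, b}) r"
    using 1 by (intro link_uniform) auto
  moreover have "V - set xs - {a, b} = V - set (a # b # xs)" by auto
  ultimately show ?case by simp
qed auto

lemma layer_uniform: "A \<subseteq> V \<Longrightarrow> layer A m \<in> uniform V m"
  by (auto simp: layer_def uniform_def)

lemma down_eq_0:
  fixes f :: "'b set \<Rightarrow> 'a::comm_monoid_add"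
  assumes "f \<in> uniform V (m + k)" "finite V" "\<not> (B \<subseteq> V \<and> card B = m)"
  shows "down V k f B = 0"
  unfolding down_def
proof (rule sum.neutral, rule ballI, rule ccontr)
  fix C assume C: "C \<in> {C. C \<subseteq> V - B \<and> card C = k}" and "f (B \<union> C) \<noteq> 0"
  then have "B \<union> C \<subseteq> V" "card (B \<union> C) = m + k" using assms(1) by (auto simp: uniform_def)
  moreover have "card (B \<union> C) = card B + card C"
    using calculation(1) C assms(2) by (intro card_Un_disjoint) (auto intro: finite_subset)
  ultimately show False using C assms(3) by simp
qed

lemma down_uniform:
  fixes f :: "'b set \<Rightarrow> 'a::comm_monoid_add"
  assumes "f \<in> uniform V (m + k)" "finite V"
  shows "down V k f \<in> uniform V m"
  using down_eq_0[OF assms] unfolding uniform_def by blast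

section \<open>Transitivity of the symmetric group on lists and subsets\<close>

lemma permutes_extend:
  assumes "finite V" "inj_on f A" "A \<subseteq> V" "f ` A \<subseteq> V"
  obtains \<sigma> where "\<sigma> permutes V" "\<And>x. x \<in> A \<Longrightarrow> \<sigma> x = f x"
proof -
  have "card (V - A) = card (V - f ` A)"
    using assms by (simp add: card_Diff_subset finite_subset card_image)
  then obtain h where h: "bij_betw h (V - A) (V - f ` A)"
    using assms(1) finite_same_card_bij by blast
  define \<sigma> where "\<sigma> x = (if x \<in> A then f x else if x \<in> V then h x else x)" for x
  have "bij_betw \<sigma> A (f ` A)"
    using assms(2) by (subst bij_betw_cong[of _ _ f]) (auto simp: \<sigma>_def bij_betw_def)
  moreover have "bij_betw \<sigma> (V - A) (V - f ` A)"
    using h by (subst bij_betw_cong[of _ _ h]) (auto simp: \<sigma>_def)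
  ultimately have "bij_betw \<sigma> (A \<union> (V - A)) (f ` A \<union> (V - f ` A))"
    by (rule bij_betw_combine) auto
  moreover have "A \<union> (V - A) = V" "f ` A \<union> (V - f ` A) = V" using assms by auto
  ultimately have "\<sigma> permutes V" using assms(3)
    by (intro bij_imp_permutes) (auto simp: \<sigma>_def)
  then show ?thesis using that by (auto simp: \<sigma>_def)
qed

lemma permutes_map_list:
  assumes "finite V" "distinct xs" "distinct ys" "length xs = length ys" "set xs \<subseteq> V" "set ys \<subseteq> V"
  obtains \<sigma> where "\<sigma> permutes V" "map \<sigma> xs = ys"
proof -
  define f where "f x = the (map_of (zip xs ys) x)" for x
  have f: "f (xs ! i) = ys ! i" if "i < length xs" for i
    using assms that by (simp add: f_def map_of_zip_nth)
  have m: "map f xs = ys" using f assms(4) by (intro nth_equalityI) simp_all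
  then have "f ` set xs \<subseteq> V" "inj_on f (set xs)"
    using assms by (metis list.set_map) (metis assms(2,3) distinct_map m)
  then obtain \<sigma> where "\<sigma> permutes V" "\<And>x. x \<in> set xs \<Longrightarrow> \<sigma> x = f x"
    using permutes_extend assms by metis
  then show ?thesis using that m by (metis map_cong)
qed

lemma permutes_image_eq:
  assumes "finite V" "A \<subseteq> V" "B \<subseteq> V" "card A = card B"
  obtains \<sigma> where "\<sigma> permutes V" "\<sigma> ` A = B"
proof -
  have "finite A" "finite B" using assms finite_subset by auto
  then obtain h where h: "bij_betw h A B" using assms(4) finite_same_card_bij by blast
  then obtain \<sigma> where "\<sigma> permutes V" "\<And>x. x \<in> A \<Longrightarrow> \<sigma> x = h x"
    using permutes_extend[of V h A] assms by (metis bij_betw_def)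
  then show ?thesis using that h by (metis bij_betw_def image_cong)
qed

text \<open>Subsets of equal size are connected by exchanges of a single element; the induction is
  on the number of elements of B not yet reached.\<close>

lemma exchange_induct [consumes 4, case_names base exchange]:
  assumes "finite V" "A \<subseteq> V" "B \<subseteq> V" "card A = card B" "P A"
    and step: "\<And>C a b. C \<subseteq> V \<Longrightarrow> a \<in> V - C \<Longrightarrow> b \<in> V - C \<Longrightarrow> a \<noteq> b \<Longrightarrow> Suc (card C) = card B \<Longrightarrow>
      P (insert a C) \<Longrightarrow> P (insert b C)"
  shows "P B"
  using assms(2,4,5)
proof (induction "card (B - A)" arbitrary: A)
  case 0
  have fin: "finite A" "finite B" using 0 assms(1,3) finite_subset by blast+
  then have "B \<subseteq> A" using 0 by simp
  then have "B = A" using card_subset_eq[of A B] fin 0 by simp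
  then show ?case using 0 by simp
next
  case (Suc k)
  have fin: "finite A" "finite B" using Suc assms(1,3) finite_subset by blast+
  obtain b where b: "b \<in> B" "b \<notin> A" using Suc(2) by (metis Diff_iff card.empty equals0I nat.simps(3))
  have "card (A - B) = card (B - A)" using fin Suc(4) card_le_sym_Diff[of A B] card_le_sym_Diff[of B A] by simp
  then obtain a where a: "a \<in> A" "a \<notin> B"
    using Suc(2) by (metis Diff_iff card.empty equals0I nat.simps(3))
  let ?C = "A - {a}"
  have C: "Suc (card ?C) = card B" using a fin Suc(4) by (metis card.remove)
  have "P (insert b ?C)"
    using a b Suc C assms(3) by (intro step[of ?C a b]) (auto simp: insert_absorb)
  moreover have "B - A = insert b (B - insert b ?C)" using a b by auto
  then have "card (B - insert b ?C) = k" using Suc(2) fin by (metis Diff_iff card_insert_disjoint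
        finite_Diff insertCI nat.inject)
  moreover have "card (insert b ?C) = card B" using C b fin by simp
  ultimately show ?case using a b Suc.prems assms(3) by (intro Suc(1)[of "insert b ?C"]) auto
qed

lemma down_1: "finite V \<Longrightarrow> down V 1 f B = (\<Sum>c\<in>V - B. f (insert c B))"
  unfolding down_def
  by (rule sum.reindex_bij_witness[where i = "\<lambda>c. {c}" and j = the_elem])
    (auto simp: card_1_singleton_iff)

text \<open>An m-subset of X has (card X - m choose k) extensions by k elements inside X, and a set
  that is not contained in X has none.\<close>

lemma down_layer:
  fixes X :: "'b set"
  assumes "X \<subseteq> V" "finite V"
  shows "down V k (layer X (m + k) :: 'b set \<Rightarrow> 'a::field) =
    fscale (of_nat ((card X - m) choose k)) (layer X m)"
proof (rule ext)
  fix B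
  show "down V k (layer X (m + k) :: 'b set \<Rightarrow> 'a) B =
      fscale (of_nat ((card X - m) choose k)) (layer X m) B"
  proof (cases "B \<subseteq> X \<and> card B = m")
    case True
    have fX: "finite X" using assms by (rule finite_subset)
    have fB: "finite B" by (rule finite_subset[OF _ fX]) (use True in simp)
    have "down V k (layer X (m + k) :: 'b set \<Rightarrow> 'a) B = (\<Sum>C | C \<subseteq> X - B \<and> card C = k. 1)"
      unfolding down_def
    proof (rule sum.mono_neutral_cong_right)
      fix C assume "C \<in> {C. C \<subseteq> X - B \<and> card C = k}"
      then have C: "C \<subseteq> X - B" "card C = k" by auto
      then have "finite C" using fX by (meson finite_Diff finite_subset)
      then have "card (B \<union> C) = m + k"
        using True fB C by (subst card_Un_disjoint) auto
      then show "layer X (m + k) (B \<union> C) = (1 :: 'a)" using True C by (auto simp: layer_def)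
    qed (use assms in \<open>auto simp: layer_def\<close>)
    also have "\<dots> = of_nat ((card X - m) choose k)"
      using fX fB True by (simp add: n_subsets card_Diff_subset)
    finally show ?thesis using True by (simp add: fscale_def layer_def)
  next
    case False
    then have "down V k (layer X (m + k) :: 'b set \<Rightarrow> 'a) B = 0"
    proof (cases "B \<subseteq> X")
      case True
      then show ?thesis using False assms
        by (intro down_eq_0[of _ _ m]) (auto intro: layer_uniform)
    next
      case False
      then show ?thesis by (auto simp: down_def layer_def intro!: sum.neutral)
    qed
    then show ?thesis using False by (auto simp: fscale_def layer_def)
  qed
qed

lemma spreads_image:
  assumes "inj \<sigma>"
  shows "spreads (map \<sigma> xs) f (\<sigma> ` A) = spreads xs (\<lambda>A. f (\<sigma> ` A)) A"
proof (induction xs arbitrary: A rule: induct_list012)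
  case (3 a b xs)
  have "\<sigma> ` A - {\<sigma> a, \<sigma> b} = \<sigma> ` (A - {a, b})" using assms by (simp add: image_set_diff)
  then show ?case using assms 3(1) by (simp add: spread_def inj_image_mem_iff del: Diff_insert)
qed simp_all

lemma layer_image:
  assumes "\<sigma> permutes V"
  shows "layer (\<sigma> ` X) m (\<sigma> ` A) = layer X m A"
proof -
  have "inj \<sigma>" using assms by (rule permutes_inj)
  then show ?thesis by (simp add: layer_def inj_image_subset_iff card_image inj_on_subset)
qed

lemma spreads_transitive:
  fixes U :: "('b set \<Rightarrow> 'a::field) set"
  assumes "invariant V U" "finite V" "distinct xs" "distinct ys" "length xs = length ys"
    "set xs \<subseteq> V" "set ys \<subseteq> V" "spreads xs (layer {} 0) \<in> U"
  shows "spreads ys (layer {} 0) \<in> U"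
proof -
  obtain \<sigma> where \<sigma>: "\<sigma> permutes V" "map \<sigma> ys = xs"
    using permutes_map_list assms by metis
  then have "(\<lambda>A. spreads xs (layer {} 0) (\<sigma> ` A)) \<in> U" using assms by (simp add: invariant_def)
  moreover have "(\<lambda>A. layer {} 0 (\<sigma> ` A)) = (layer {} 0 :: 'b set \<Rightarrow> 'a)"
    using layer_image[OF \<sigma>(1), of "{}" 0] by auto
  moreover have "spreads xs (layer {} 0) (\<sigma> ` A) = spreads ys (\<lambda>A. layer {} 0 (\<sigma> ` A) :: 'a) A" for A
    using spreads_image[OF permutes_inj[OF \<sigma>(1)], of ys] \<sigma>(2) by simp
  ultimately show ?thesis by simp
qed

lemma layer_transitive:
  fixes U :: "('b set \<Rightarrow> 'a::field) set"
  assumes "invariant V U" "finite V" "A \<subseteq> V" "B \<subseteq> V" "card A = card B" "layer A m \<in> U"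
  shows "layer B m \<in> U"
proof -
  obtain \<sigma> where \<sigma>: "\<sigma> permutes V" "\<sigma> ` B = A" using permutes_image_eq assms by metis
  then have "(\<lambda>C. layer A m (\<sigma> ` C)) \<in> U" using assms by (simp add: invariant_def)
  then show ?thesis using layer_image[OF \<sigma>(1), of B m, where 'b = 'a] \<sigma>(2) by simp
qed

text \<open>Finiteness excludes infinite subsets of X, which also have \<open>card\<close>
  0.\<close>

lemma layer_0:
  assumes "finite X"
  shows "layer X 0 = (layer {} 0 :: 'b set \<Rightarrow> 'a::field)"
proof
  fix A show "layer X 0 A = (layer {} 0 A :: 'a)"
    using assms finite_subset[of A X] by (auto simp: layer_def)
qed

lemma uniform_0_eq:
  assumes "f \<in> uniform V 0" "finite V"
  shows "f = fscale (f {}) (layer {} 0 :: 'b set \<Rightarrow> 'a::field)"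
proof (rule uniform_eqI[OF assms(1)])
  show "fscale (f {}) (layer {} 0) \<in> uniform V 0"
    by (auto simp: uniform_def fscale_def layer_def)
  fix A assume "A \<subseteq> V" "card A = 0"
  then have "A = {}" using assms(2) finite_subset[of A V] by simp
  then show "f A = fscale (f {}) (layer {} 0) A" by (simp add: fscale_def layer_def del: One_nat_def)
qed

lemma spreads_layer_uniform:
  assumes "distinct xs" "even (length xs)" "set xs \<subseteq> V" "finite V"
  shows "spreads xs (layer {} 0 :: 'b set \<Rightarrow> 'a::field) \<in> uniform V (length xs div 2)"
proof -
  have "layer {} 0 \<in> (uniform (V - set xs) 0 :: ('b set \<Rightarrow> 'a) set)" by (rule layer_uniform) simp
  from spreads_uniform[OF assms(1,2) this assms(3,4)] show ?thesis by simp
qed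

lemma sum_fun_apply: "(\<Sum>i\<in>I. g i) x = (\<Sum>i\<in>I. g i x)"
  by (induction I rule: infinite_finite_induct) simp_all

text \<open>In characteristic 2, for finite V with 2 * r \<le> card V, this is the two-row Specht
  module of shape (n - r, r); the two inclusions are \<open>down_spreads_layer\<close> and
  \<open>primitive_span\<close>.\<close>

definition primitive :: "'b set \<Rightarrow> nat \<Rightarrow> ('b set \<Rightarrow> 'a::comm_monoid_add) set" where
  "primitive V r = {f \<in> uniform V r. \<forall>k>0. \<forall>B. down V k f B = 0}"

text \<open>With 2 * r letters, \<open>links xs f\<close> is supported on the empty set, so one
  value decides. It is the sum of f over the sets with one letter from each pair, that is, the inner
  product of f with \<open>spreads xs (layer {} 0)\<close>. These are the cycles orthogonal to the
  two-row polytabloids.\<close>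

definition vanishing :: "'b set \<Rightarrow> nat \<Rightarrow> ('b set \<Rightarrow> 'a::comm_monoid_add) set" where
  "vanishing V r = {f \<in> cycles V r. \<forall>xs. distinct xs \<longrightarrow> length xs = 2 * r \<longrightarrow> set xs \<subseteq> V \<longrightarrow>
     links xs f {} = 0}"

lemma down_0: "finite V \<Longrightarrow> down V 0 f B = f B"
proof -
  assume "finite V"
  then have "{C. C \<subseteq> V - B \<and> card C = 0} = {{}}" by (auto dest: finite_subset)
  then show ?thesis by (simp add: down_def)
qed

text \<open>The range of summation no longer depends on C, so that double sums over C and B can be
  swapped.\<close>

lemma down_superset:
  assumes "finite V" "C \<subseteq> V"
  shows "down V k f C = (\<Sum>B | B \<subseteq> V \<and> card B = card C + k. if C \<subseteq> B then f B else 0)"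
proof -
  have fC: "finite C" using assms(2,1) by (rule finite_subset)
  have "(\<Sum>B | B \<subseteq> V \<and> card B = card C + k. if C \<subseteq> B then f B else 0) =
      (\<Sum>B \<in> {B \<in> {B. B \<subseteq> V \<and> card B = card C + k}. C \<subseteq> B}. f B)"
    using assms(1) by (subst sum.inter_filter) simp_all
  also have "\<dots> = down V k f C"
    unfolding down_def
  proof (rule sum.reindex_bij_witness[where i = "\<lambda>D. C \<union> D" and j = "\<lambda>B. B - C"])
    fix B assume B: "B \<in> {B \<in> {B. B \<subseteq> V \<and> card B = card C + k}. C \<subseteq> B}"
    then show "C \<union> (B - C) = B" by auto
    then show "f (C \<union> (B - C)) = f B" by simp
    show "B - C \<in> {D. D \<subseteq> V - C \<and> card D = k}" using B fC by (auto simp: card_Diff_subset)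
  next
    fix D assume D: "D \<in> {D. D \<subseteq> V - C \<and> card D = k}"
    then show "C \<union> D - C = D" by auto
    have "D \<subseteq> V" using D by blast
    then have "finite D" using assms(1) by (rule finite_subset)
    then have "card (C \<union> D) = card C + k" using D fC by (subst card_Un_disjoint) auto
    then show "C \<union> D \<in> {B \<in> {B. B \<subseteq> V \<and> card B = card C + k}. C \<subseteq> B}" using D assms by auto
  qed
  finally show ?thesis by simp
qed

lemma subspace_primitive: "fun_vs.subspace (primitive V r :: ('b set \<Rightarrow> 'a::field) set)"
  using subspace_uniform[of V r]
  by (auto simp: primitive_def fun_vs.subspace_def down_add down_scale)

lemma subspace_scale_cancel:
  assumes "fun_vs.subspace U" "c \<noteq> 0" "fscale c f \<in> U"
  shows "f \<in> U"
proof -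
  have "fscale (inverse c) (fscale c f) \<in> U" by (rule fun_vs.subspace_scale[OF assms(1,3)])
  moreover have "fscale (inverse c) (fscale c f) = f"
    using assms(2) by (simp add: fscale_def fun_eq_iff mult.assoc[symmetric])
  ultimately show ?thesis by simp
qed

lemma uniform_0_span:
  fixes f :: "'b set \<Rightarrow> 'a::field"
  assumes "f \<in> uniform V 0" "finite V"
  shows "f \<in> fun_vs.span {spreads xs (layer {} 0) | xs. distinct xs \<and> length xs = 2 * 0 \<and> set xs \<subseteq> V}"
proof -
  have "(layer {} 0 :: 'b set \<Rightarrow> 'a) \<in>
      {spreads xs (layer {} 0) | xs. distinct xs \<and> length xs = 2 * 0 \<and> set xs \<subseteq> V}"
    by (intro CollectI exI[of _ "[]"]) simp
  then have "fscale (f {}) (layer {} 0) \<in>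
      fun_vs.span {spreads xs (layer {} 0) | xs. distinct xs \<and> length xs = 2 * 0 \<and> set xs \<subseteq> V}"
    by (intro fun_vs.span_scale fun_vs.span_base)
  then show ?thesis unfolding uniform_0_eq[OF assms, symmetric] .
qed

section \<open>Chains of submodules, constant and affine functions\<close>

definition uniserial_on :: "'b set \<Rightarrow> ('b set \<Rightarrow> 'a::field) set \<Rightarrow> bool" where
  "uniserial_on V S \<longleftrightarrow> (\<forall>U W. invariant V U \<and> U \<subseteq> S \<and> invariant V W \<and> W \<subseteq> S \<longrightarrow> U \<subseteq> W \<or> W \<subseteq> U)"

definition chain_step ::
  "'b set \<Rightarrow> ('b set \<Rightarrow> 'a::field) set \<Rightarrow> ('b set \<Rightarrow> 'a) set \<Rightarrow> ('b set \<Rightarrow> 'a) set \<Rightarrow> bool" where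
  "chain_step V S X Y \<longleftrightarrow> (\<forall>U. invariant V U \<longrightarrow> U \<subseteq> S \<longrightarrow> U \<subseteq> X \<or> Y \<subseteq> U)"

definition flat :: "'b set \<Rightarrow> nat \<Rightarrow> ('b set \<Rightarrow> 'a) \<Rightarrow> bool" where
  "flat V r f \<longleftrightarrow> (\<forall>A B. A \<subseteq> V \<longrightarrow> card A = r \<longrightarrow> B \<subseteq> V \<longrightarrow> card B = r \<longrightarrow> f A = f B)"

definition affine :: "'b set \<Rightarrow> nat \<Rightarrow> ('b \<Rightarrow> 'a) \<Rightarrow> 'a \<Rightarrow> 'b set \<Rightarrow> 'a::comm_monoid_add" where
  "affine V r b c A = (if A \<subseteq> V \<and> card A = r then sum b A + c else 0)"

text \<open>In characteristic 2 this is the sum of b over the complement V - A. The constant term is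
  the one forced by \<open>down V 1\<close>, see \<open>affine_cycles_eq\<close>.\<close>

definition trace_affine :: "'b set \<Rightarrow> nat \<Rightarrow> ('b \<Rightarrow> 'a) \<Rightarrow> 'b set \<Rightarrow> 'a::comm_monoid_add" where
  "trace_affine V r b = affine V r b (sum b V)"

text \<open>Compare two submodules containing X. If one of them lies in X, it equals X and lies in
  the other; otherwise both contain the next member Y and the comparison continues there. At the end
  X is S itself.\<close>

lemma uniserial_on_chain:
  fixes S :: "('b set \<Rightarrow> 'a::field) set"
  assumes "successively (chain_step V S) ({0} # Xs)"
    and "last ({0} # Xs) = S"
  shows "uniserial_on V S"
proof -
  have chain: "U \<subseteq> W \<or> W \<subseteq> U"
    if "successively (chain_step V S) (X # Xs)"
      "X \<subseteq> U" "X \<subseteq> W" "U \<subseteq> last (X # Xs)" "W \<subseteq> last (X # Xs)"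
      "invariant V U" "U \<subseteq> S" "invariant V W" "W \<subseteq> S" for U W X Xs
    using that
  proof (induction Xs arbitrary: X)
    case Nil
    then show ?case by auto
  next
    case (Cons Y Xs)
    have "U \<subseteq> X \<or> Y \<subseteq> U" "W \<subseteq> X \<or> Y \<subseteq> W"
      using Cons.prems(1,6-9) by (simp_all add: chain_step_def del: subset_insert_iff)
    moreover have "U \<subseteq> W \<or> W \<subseteq> U" if "Y \<subseteq> U" "Y \<subseteq> W"
      using Cons.prems that by (intro Cons.IH[of Y]) simp_all
    ultimately show ?case using Cons.prems(2,3) by blast
  qed
  have "{0} \<subseteq> U" if "invariant V U" for U :: "('b set \<Rightarrow> 'a) set"
    using that by (simp add: invariant_def fun_vs.subspace_0)
  then show ?thesis
    unfolding uniserial_on_def using chain[OF assms(1)] assms(2) by simp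
qed

lemma flat_exchange:
  assumes "finite V"
    and "\<And>C a b. C \<subseteq> V \<Longrightarrow> a \<in> V - C \<Longrightarrow> b \<in> V - C \<Longrightarrow> a \<noteq> b \<Longrightarrow> card C = r \<Longrightarrow>
      f (insert a C) = f (insert b C)"
  shows "flat V (Suc r) f"
  unfolding flat_def
proof (intro allI impI)
  fix A B assume AB: "A \<subseteq> V" "card A = Suc r" "B \<subseteq> V" "card B = Suc r"
  have "card A = card B" using AB by simp
  have "f A = f A" ..
  from assms(1) AB(1,3) \<open>card A = card B\<close> this show "f A = f B"
  proof (induction rule: exchange_induct)
    case (exchange C a b)
    then have "card C = r" using AB(4) by simp
    then have "f (insert a C) = f (insert b C)" using exchange by (intro assms(2)) auto
    then show ?case using exchange by simp
  qed
qed

lemma down_large: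
  fixes f :: "'b set \<Rightarrow> 'a::comm_monoid_add"
  assumes "f \<in> uniform V r" "finite V" "r < k"
  shows "down V k f B = 0"
  unfolding down_def
proof (rule sum.neutral, rule ballI, rule ccontr)
  fix C assume C: "C \<in> {C. C \<subseteq> V - B \<and> card C = k}" and "f (B \<union> C) \<noteq> 0"
  then have "B \<union> C \<subseteq> V" "card (B \<union> C) = r" using assms(1) by (auto simp: uniform_def)
  moreover have "card C \<le> card (B \<union> C)"
    by (rule card_mono[OF finite_subset[OF calculation(1) assms(2)]]) simp
  ultimately show False using C assms(3) by simp
qed

section \<open>Down maps on affine functions, and double counting\<close>

lemma sum_pairs:
  fixes b :: "'b \<Rightarrow> 'a::field"
  assumes "finite W"
  shows "(\<Sum>C | C \<subseteq> W \<and> card C = 2. sum b C) = of_nat (card W - 1) * sum b W"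
proof -
  have "(\<Sum>C | C \<subseteq> W \<and> card C = 2. sum b C) =
      (\<Sum>C | C \<subseteq> W \<and> card C = 2. \<Sum>i\<in>W. if i \<in> C then b i else 0)"
  proof (rule sum.cong)
    fix C assume C: "C \<in> {C. C \<subseteq> W \<and> card C = 2}"
    have "(\<Sum>i\<in>W. if i \<in> C then b i else 0) = (\<Sum>i\<in>{i \<in> W. i \<in> C}. b i)"
      using assms by (rule sum.inter_filter[symmetric])
    also have "{i \<in> W. i \<in> C} = C" using C by blast
    finally show "sum b C = (\<Sum>i\<in>W. if i \<in> C then b i else 0)" ..
  qed simp
  also have "\<dots> = (\<Sum>i\<in>W. \<Sum>C | C \<subseteq> W \<and> card C = 2. if i \<in> C then b i else 0)"
    by (rule sum.swap)
  also have "\<dots> = (\<Sum>i\<in>W. of_nat (card W - 1) * b i)"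
  proof (rule sum.cong)
    fix i assume i: "i \<in> W"
    have "{C \<in> {C. C \<subseteq> W \<and> card C = 2}. i \<in> C} = (\<lambda>j. {i, j}) ` (W - {i})"
      using i by (auto simp: card_2_iff)
    moreover have "inj_on (\<lambda>j. {i, j}) (W - {i})" by (rule inj_onI) (auto simp: doubleton_eq_iff)
    ultimately have "card {C \<in> {C. C \<subseteq> W \<and> card C = 2}. i \<in> C} = card W - 1"
      using i by (simp add: card_image)
    moreover have "(\<Sum>C | C \<subseteq> W \<and> card C = 2. if i \<in> C then b i else 0) =
        (\<Sum>C\<in>{C \<in> {C. C \<subseteq> W \<and> card C = 2}. i \<in> C}. b i)"
      using assms by (intro sum.inter_filter[symmetric]) simp
    ultimately show "(\<Sum>C | C \<subseteq> W \<and> card C = 2. if i \<in> C then b i else 0) = of_nat (card W - 1) * b i"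
      by simp
  qed simp
  finally show ?thesis by (simp add: sum_distrib_left)
qed

lemma affine_Un:
  assumes "finite V" "B \<subseteq> V" "card B = r" "C \<subseteq> V - B" "card C = k"
  shows "affine V (r + k) b c (B \<union> C) = sum b B + sum b C + c"
proof -
  have "finite B" using assms(2,1) by (rule finite_subset)
  moreover have "C \<subseteq> V" using assms(4) by blast
  then have "finite C" using assms(1) by (rule finite_subset)
  moreover have "B \<inter> C = {}" using assms(4) by blast
  ultimately show ?thesis using assms \<open>C \<subseteq> V\<close>
    by (simp add: affine_def card_Un_disjoint sum.union_disjoint)
qed

lemma down_1_affine:
  fixes b :: "'b \<Rightarrow> 'a::field"
  assumes "finite V" "B \<subseteq> V" "card B = r"
  shows "down V 1 (affine V (Suc r) b c) B = sum b (V - B) + of_nat (card V - r) * (sum b B + c)"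
proof -
  have "affine V (Suc r) b c (insert x B) = b x + (sum b B + c)" if "x \<in> V - B" for x
    using affine_Un[OF assms, of "{x}" 1 b c] that by (simp add: ac_simps)
  then have "down V 1 (affine V (Suc r) b c) B = (\<Sum>x\<in>V - B. b x + (sum b B + c))"
    unfolding down_1[OF assms(1)] by (intro sum.cong) auto
  moreover have "card (V - B) = card V - r"
    using assms finite_subset[OF assms(2,1)] by (simp add: card_Diff_subset)
  ultimately show ?thesis by (simp add: sum.distrib)
qed

lemma down_2_affine:
  fixes b :: "'b \<Rightarrow> 'a::field"
  assumes "finite V" "B \<subseteq> V" "card B = r"
  shows "down V 2 (affine V (Suc (Suc r)) b c) B =
    of_nat (card V - r - 1) * sum b (V - B) + of_nat ((card V - r) choose 2) * (sum b B + c)"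
proof -
  have c: "card (V - B) = card V - r"
    using assms finite_subset[OF assms(2,1)] by (simp add: card_Diff_subset)
  have "affine V (Suc (Suc r)) b c (B \<union> C) = sum b C + (sum b B + c)"
    if "C \<in> {C. C \<subseteq> V - B \<and> card C = 2}" for C
    using affine_Un[OF assms, of C 2 b c] that by (simp add: ac_simps)
  then have "down V 2 (affine V (Suc (Suc r)) b c) B =
      (\<Sum>C | C \<subseteq> V - B \<and> card C = 2. sum b C + (sum b B + c))"
    unfolding down_def by (intro sum.cong refl)
  also have "\<dots> = of_nat (card V - r - 1) * sum b (V - B) + of_nat ((card V - r) choose 2) * (sum b B + c)"
    using assms(1) by (simp add: sum.distrib sum_pairs n_subsets c)
  finally show ?thesis .
qed

lemma affine_uniform: "affine V r b c \<in> uniform V r"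
  by (auto simp: affine_def uniform_def)

lemma trace_affine_add:
  fixes b b' :: "'b \<Rightarrow> 'a::field"
  shows "trace_affine V r (b + b') = trace_affine V r b + trace_affine V r b'"
  by (auto simp: trace_affine_def affine_def fun_eq_iff sum.distrib)

lemma trace_affine_scale:
  fixes b :: "'b \<Rightarrow> 'a::field"
  shows "trace_affine V r (fscale c b) = fscale c (trace_affine V r b)"
  by (auto simp: trace_affine_def affine_def fun_eq_iff fscale_def sum_distrib_left[symmetric] distrib_left)

lemma trace_affine_image:
  fixes b :: "'b \<Rightarrow> 'a::field"
  assumes "\<sigma> permutes V"
  shows "trace_affine V r b (\<sigma> ` A) = trace_affine V r (b \<circ> \<sigma>) A"
proof -
  have inj: "inj \<sigma>" using assms by (rule permutes_inj)
  have "\<sigma> ` A \<subseteq> V \<longleftrightarrow> A \<subseteq> V" using permutes_in_image[OF assms] by auto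
  moreover have "sum b (\<sigma> ` A) = sum (b \<circ> \<sigma>) A" for A
    by (rule sum.reindex) (rule inj_on_subset[OF inj subset_UNIV])
  moreover have "sum (b \<circ> \<sigma>) V = sum b V"
    using calculation(2)[of V] permutes_image[OF assms] by simp
  ultimately show ?thesis
    using inj by (simp add: trace_affine_def affine_def card_image inj_on_subset)
qed

lemma trace_affine_cong: "(\<And>i. i \<in> V \<Longrightarrow> b i = b' i) \<Longrightarrow> trace_affine V r b = trace_affine V r b'"
  unfolding trace_affine_def affine_def fun_eq_iff
  by (auto intro!: arg_cong2[where f = "(+)"] sum.cong)

lemma flat_down:
  fixes f :: "'b set \<Rightarrow> 'a::field"
  assumes "flat V r f" "A \<subseteq> V" "card A = r" "finite V"
  shows "down V r f {} = of_nat (card V choose r) * f A"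
proof -
  have "f C = f A" if "C \<in> {C. C \<subseteq> V \<and> card C = r}" for C
    using assms(1-3) that unfolding flat_def by blast
  then have "down V r f {} = (\<Sum>C | C \<subseteq> V \<and> card C = r. f A)"
    unfolding down_def by simp
  then show ?thesis using assms(4) by (simp add: n_subsets)
qed

text \<open>The composition rule for d_j and d_k at the empty set: a (j + k)-set A is counted once
  for each of its j-subsets.\<close>

lemma sum_down:
  fixes f :: "'b set \<Rightarrow> 'a::field"
  assumes "finite V"
  shows "(\<Sum>B | B \<subseteq> V \<and> card B = j. down V k f B) =
    of_nat ((j + k) choose j) * down V (j + k) f {}"
proof -
  have "(\<Sum>B | B \<subseteq> V \<and> card B = j. down V k f B) =
      (\<Sum>B | B \<subseteq> V \<and> card B = j. \<Sum>A | A \<subseteq> V \<and> card A = j + k. if B \<subseteq> A then f A else 0)"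
    by (intro sum.cong) (simp_all add: down_superset[OF assms])
  also have "\<dots> = (\<Sum>A | A \<subseteq> V \<and> card A = j + k. \<Sum>B | B \<subseteq> V \<and> card B = j. if B \<subseteq> A then f A else 0)"
    by (rule sum.swap)
  also have "\<dots> = (\<Sum>A | A \<subseteq> V \<and> card A = j + k. of_nat ((j + k) choose j) * f A)"
  proof (rule sum.cong)
    fix A assume A: "A \<in> {A. A \<subseteq> V \<and> card A = j + k}"
    then have fA: "finite A" using assms finite_subset[of A V] by simp
    have "(\<Sum>B | B \<subseteq> V \<and> card B = j. if B \<subseteq> A then f A else 0) =
        (\<Sum>B\<in>{B \<in> {B. B \<subseteq> V \<and> card B = j}. B \<subseteq> A}. f A)"
      using assms by (intro sum.inter_filter[symmetric]) simp
    also have "{B \<in> {B. B \<subseteq> V \<and> card B = j}. B \<subseteq> A} = {B. B \<subseteq> A \<and> card B = j}" using A by blast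
    finally show "(\<Sum>B | B \<subseteq> V \<and> card B = j. if B \<subseteq> A then f A else 0) = of_nat ((j + k) choose j) * f A"
      using A fA by (simp add: n_subsets)
  qed simp
  also have "\<dots> = of_nat ((j + k) choose j) * down V (j + k) f {}"
    by (simp add: sum_distrib_left down_def)
  finally show ?thesis .
qed

section \<open>Kernels of up maps and nonvanishing of products\<close>

lemma not_uniserial_onI:
  assumes "invariant V K" "invariant V L" "invariant V S"
    and "f \<in> S" "f \<in> K" "f \<notin> L" "g \<in> S" "g \<in> L" "g \<notin> K"
  shows "\<not> uniserial_on V S"
proof
  assume "uniserial_on V S"
  moreover have "invariant V (S \<inter> K)" "invariant V (S \<inter> L)" using assms by (auto intro: invariant_Int)
  ultimately have "S \<inter> K \<subseteq> S \<inter> L \<or> S \<inter> L \<subseteq> S \<inter> K" unfolding uniserial_on_def by blast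
  then show False using assms by blast
qed

text \<open>The restriction to B \<subseteq> V matters for the use in
  \<open>not_uniserial_layer\<close>: \<open>up\<close> does not know V, and a set reaching outside
  V could meet X in too few letters for the parity argument.\<close>

lemma invariant_up_kernel: "invariant V {f. \<forall>B\<subseteq>V. up k f B = (0 :: 'a::field)}"
proof -
  have "\<sigma> ` B \<subseteq> V" if "\<sigma> permutes V" "B \<subseteq> V" for \<sigma> B
    using permutes_image[OF that(1)] that(2) by blast
  then show ?thesis
    by (auto simp: invariant_def fun_vs.subspace_def up_add up_scale up_image)
qed

lemma up_layer:
  assumes "finite B" "card B = m + k"
  shows "up k (layer X m) B = (of_nat (card (B \<inter> X) choose m) :: 'a::field)"
proof -
  have card: "card (B - C) = m + k - card C" if "C \<subseteq> B" for C
    using that assms finite_subset[OF that assms(1)] by (simp add: card_Diff_subset)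
  have "up k (layer X m) B = (\<Sum>D | D \<subseteq> B \<and> card D = m. layer X m D :: 'a)"
    unfolding up_def
    by (rule sum.reindex_bij_witness[where i = "\<lambda>D. B - D" and j = "\<lambda>C. B - C"])
      (use card in \<open>auto simp: double_diff\<close>)
  also have "\<dots> = (\<Sum>D | D \<subseteq> B \<inter> X \<and> card D = m. 1)"
    using assms(1) by (intro sum.mono_neutral_cong_right) (auto simp: layer_def)
  also have "\<dots> = of_nat (card (B \<inter> X) choose m)" 
    by (simp only: sum_constant mult_1_right n_subsets[OF finite_Int[OF disjI1[OF assms(1)]]])
  finally show ?thesis .
qed

lemma up_eq_0:
  fixes f :: "'b set \<Rightarrow> 'a::comm_monoid_add"
  assumes "f \<in> uniform V r" "finite B" "card B \<noteq> r + k"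
  shows "up k f B = 0"
  unfolding up_def
proof (rule sum.neutral, rule ballI, rule ccontr)
  fix C assume C: "C \<in> {C. C \<subseteq> B \<and> card C = k}" and "f (B - C) \<noteq> 0"
  then have "card (B - C) = r" using assms(1) by (auto simp: uniform_def)
  moreover have "card (B - C) = card B - k" "k \<le> card B"
    using C assms(2) finite_subset[of C B] card_mono[of B C] by (auto simp: card_Diff_subset)
  ultimately show False using assms(3) by simp
qed

text \<open>T takes one letter of each pair. Among the sets obtained from T \<union> D by removing
  card D letters, only T lies in the support of the product, so the sum has a single nonzero
  term.\<close>

lemma up_spreads:
  assumes "distinct xs" "even (length xs)" "finite D" "D \<inter> set xs = {}"
  shows "\<exists>T\<subseteq>set xs. up (card D) (spreads xs (layer {} 0 :: 'b set \<Rightarrow> 'a::field)) (T \<union> D) = 1"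
  using assms(1,2,4)
proof (induction xs rule: induct_list012)
  case 1
  have "C = D" if "C \<subseteq> D" "card C = card D" for C using card_subset_eq[OF assms(3) that] .
  then have "{C. C \<subseteq> D \<and> card C = card D} = {D}" by blast
  then have "up (card D) (layer {} 0 :: 'b set \<Rightarrow> 'a) D = 1" by (simp add: up_def layer_def)
  then show ?case by simp
next
  case (2 x)
  then show ?case by simp
next
  case (3 a b xs)
  let ?f = "spreads xs (layer {} 0 :: 'b set \<Rightarrow> 'a)"
  obtain T where T: "T \<subseteq> set xs" "up (card D) ?f (T \<union> D) = 1" using 3 by auto
  have ab: "a \<notin> T \<union> D" "b \<notin> T \<union> D" "a \<noteq> b" using T(1) 3 by auto
  have fin: "finite (T \<union> D)" using T(1) assms(3) finite_subset[of T "set xs"] by simp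
  have "up (card D) (spread a b ?f) (insert a (T \<union> D)) = up (card D) ?f (T \<union> D)"
    unfolding up_def
  proof (rule sum.mono_neutral_cong_right)
    show "finite {C. C \<subseteq> insert a (T \<union> D) \<and> card C = card D}" using fin by simp
    show "{C. C \<subseteq> T \<union> D \<and> card C = card D} \<subseteq> {C. C \<subseteq> insert a (T \<union> D) \<and> card C = card D}" by blast
    show "\<forall>C\<in>{C. C \<subseteq> insert a (T \<union> D) \<and> card C = card D} - {C. C \<subseteq> T \<union> D \<and> card C = card D}.
        spread a b ?f (insert a (T \<union> D) - C) = 0"
    proof
      fix C assume "C \<in> {C. C \<subseteq> insert a (T \<union> D) \<and> card C = card D} - {C. C \<subseteq> T \<union> D \<and> card C = card D}"
      then have "a \<in> C" by blast
      then have "a \<notin> insert a (T \<union> D) - C" "b \<notin> insert a (T \<union> D) - C" using ab by blast+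
      then show "spread a b ?f (insert a (T \<union> D) - C) = 0" by (simp add: spread_def)
    qed
    fix C assume "C \<in> {C. C \<subseteq> T \<union> D \<and> card C = card D}"
    then have "a \<in> insert a (T \<union> D) - C" "b \<notin> insert a (T \<union> D) - C"
      "insert a (T \<union> D) - C - {a, b} = T \<union> D - C" using ab by blast+
    then show "spread a b ?f (insert a (T \<union> D) - C) = ?f (T \<union> D - C)"
      by (simp only: spread_def) simp
  qed
  then have "up (card D) (spreads (a # b # xs) (layer {} 0 :: 'b set \<Rightarrow> 'a)) (insert a T \<union> D) = 1"
    using T(2) by simp
  moreover have "insert a T \<subseteq> set (a # b # xs)" using T(1) by auto
  ultimately show ?case by blast
qed

lemma obtain_disjoint_list:
  assumes "finite V" "X \<subseteq> V" "m + card X \<le> card V"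
  obtains xs where "distinct xs" "length xs = m" "set xs \<subseteq> V - X"
proof -
  have fX: "finite X" using assms(2,1) by (rule finite_subset)
  then have "card (V - X) = card V - card X" using assms(2) by (rule card_Diff_subset)
  then have "m \<le> card (V - X)" using assms(3) by simp
  then obtain A where A: "A \<subseteq> V - X" "card A = m" by (meson obtain_subset_with_card_n)
  have "A \<subseteq> V" using A(1) by blast
  then have "finite A" using assms(1) by (rule finite_subset)
  then obtain xs where "set xs = A" "distinct xs" using finite_distinct_list by blast
  then show ?thesis using that A by (metis distinct_card)
qed

text \<open>Adding the first letter of each pair to A gives a set on which the product takes the
  value f A.\<close>

lemma spreads_nonzero:
  fixes f :: "'b set \<Rightarrow> 'a::zero"
  assumes "distinct xs" "even (length xs)" "\<And>A. A \<inter> set xs \<noteq> {} \<Longrightarrow> f A = 0" "f A \<noteq> 0"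
  shows "\<exists>B. spreads xs f B \<noteq> 0 \<and> B \<inter> - set xs = A"
  using assms
proof (induction xs rule: induct_list012)
  case 1
  then show ?case by auto
next
  case (2 x)
  then show ?case by simp
next
  case (3 a b xs)
  have "\<exists>B. spreads xs f B \<noteq> 0 \<and> B \<inter> - set xs = A"
    by (rule 3(1)) (use 3(3-6) in auto)
  then obtain B where B: "spreads xs f B \<noteq> 0" "B \<inter> - set xs = A" by blast
  have "A \<inter> set (a # b # xs) = {}" using 3(5,6) by blast
  then have ab: "a \<notin> B" "b \<notin> B" using B(2) 3(3) by auto
  then have "insert a B - {a, b} = B" by blast
  then have "spreads (a # b # xs) f (insert a B) \<noteq> 0"
    using B(1) ab 3(3) by (auto simp: spread_def)
  moreover have "insert a B \<inter> - set (a # b # xs) = A"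
    using B(2) \<open>A \<inter> set (a # b # xs) = {}\<close> ab by auto
  ultimately show ?case by blast
qed

lemma diff_mod_4:
  fixes n d :: nat
  assumes "d < n" "n mod 4 = (d + 1) mod 4"
  shows "(n - d) mod 4 = 1"
proof -
  obtain x where "n = d + x" using assms(1) less_imp_add_positive by blast
  moreover have "x mod 4 = 1" if "(d + x) mod 4 = (d + 1) mod 4" using that by presburger
  ultimately show ?thesis using assms(2) by simp
qed

lemma choose_small:
  "(3 choose 2) = (3 :: nat)" "(4 choose 2) = (6 :: nat)" "(5 choose 2) = (10 :: nat)"
  "(4 choose 3) = (4 :: nat)" "(5 choose 3) = (10 :: nat)" "(6 choose 3) = (20 :: nat)"
  "(7 choose 4) = (35 :: nat)"
  by (simp_all add: eval_nat_numeral)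

section \<open>Characteristic two\<close>

context
  fixes F :: "'a::field itself"
  assumes char2: "CHAR('a) = 2"
begin

section \<open>Arithmetic mod 2 and commutation rules for the operators\<close>

lemma two_eq_0 [simp]: "(2 :: 'a) = 0"
  using char2 of_nat_CHAR[where 'a = 'a] by simp

lemma add_self [simp]: "x + x = (0 :: 'a)"
  using mult_2[of x] by simp

lemma add_self_fun [simp]: "f + f = (0 :: 'c \<Rightarrow> 'a)"
  by (simp add: fun_eq_iff)

lemma add_self_assoc [simp]: "x + (x + y) = (y :: 'a)"
  by (simp add: add.assoc[symmetric])

lemma add_self_assoc_fun [simp]: "f + (f + g) = (g :: 'c \<Rightarrow> 'a)"
  by (simp add: add.assoc[symmetric])

lemma minus_char2: "x - y = x + (y :: 'a)"
  by (metis add_self add_diff_cancel_right' add.assoc add.right_neutral)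

lemma add_eq_0_char2: "x + y = 0 \<longleftrightarrow> x = (y :: 'a)"
  using minus_char2[of x y] by (metis eq_iff_diff_eq_0)

lemma of_nat_char2: "of_nat k = (if even k then 0 else 1 :: 'a)"
proof (cases "even k")
  case True
  then show ?thesis by (auto elim!: evenE)
next
  case False
  then obtain m where "k = 2 * m + 1" by (elim oddE)
  then show ?thesis using False by (simp only: of_nat_add of_nat_mult) simp
qed

text \<open>An extension of insert a B that contains b can be traded for an extension of insert b B
  that contains a with the same union. These terms cancel mod 2, and the remaining extensions avoid
  both letters.\<close>

lemma link_down:
  fixes f :: "'b set \<Rightarrow> 'a"
  assumes "a \<in> V" "b \<in> V" "a \<noteq> b" "finite V" "a \<notin> B" "b \<notin> B"
  shows "down (V - {a, b}) k (link a b f) B = down V k f (insert a B) + down V k f (insert b B)"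
proof -
  define X where "X a b = (\<Sum>C | C \<subseteq> V - insert a B \<and> card C = k \<and> b \<in> C. f (insert a B \<union> C))" for a b
  define Y where "Y a = (\<Sum>C | C \<subseteq> V - {a, b} - B \<and> card C = k. f (insert a B \<union> C))" for a
  define Z where "Z b = (\<Sum>C | C \<subseteq> V - {a, b} - B \<and> card C = k. f (insert b B \<union> C))" for b
  have fin: "finite {C. C \<subseteq> V - W \<and> P C}" for W P using assms(4) by simp
  have split: "down V k f (insert a B) =
      (\<Sum>C | C \<subseteq> V - {a, b} - B \<and> card C = k. f (insert a B \<union> C)) + X a b" for a b
  proof -
    have "{C. C \<subseteq> V - insert a B \<and> card C = k} =
        {C. C \<subseteq> V - {a, b} - B \<and> card C = k} \<union> {C. C \<subseteq> V - insert a B \<and> card C = k \<and> b \<in> C}"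
      by auto
    then show ?thesis unfolding down_def X_def
      by (simp only:) (intro sum.union_disjoint, use assms(4) in auto)
  qed
  have "X a b = X b a"
    unfolding X_def
  proof (rule sum.reindex_bij_witness[where i = "\<lambda>C. insert b (C - {a})" and j = "\<lambda>C. insert a (C - {b})"])
    fix C assume C: "C \<in> {C. C \<subseteq> V - insert a B \<and> card C = k \<and> b \<in> C}"
    then have fC: "finite C" using assms(4) finite_subset by blast
    show "insert b (insert a (C - {b}) - {a}) = C" using C by auto
    have "card (insert a (C - {b})) = card C" using C fC
      by (subst card_insert_disjoint) (auto simp: card_Suc_Diff1 simp del: card_Diff_insert card_Diff_singleton)
    then show "insert a (C - {b}) \<in> {C. C \<subseteq> V - insert b B \<and> card C = k \<and> a \<in> C}"
      using C assms by auto
    have "insert b B \<union> insert a (C - {b}) = insert a B \<union> C" using C by auto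
    then show "f (insert b B \<union> insert a (C - {b})) = f (insert a B \<union> C)" by simp
  next
    fix C assume C: "C \<in> {C. C \<subseteq> V - insert b B \<and> card C = k \<and> a \<in> C}"
    then have fC: "finite C" using assms(4) finite_subset by blast
    show "insert a (insert b (C - {a}) - {b}) = C" using C by auto
    have "card (insert b (C - {a})) = card C" using C fC
      by (subst card_insert_disjoint) (auto simp: card_Suc_Diff1 simp del: card_Diff_insert card_Diff_singleton)
    then show "insert b (C - {a}) \<in> {C. C \<subseteq> V - insert a B \<and> card C = k \<and> b \<in> C}"
      using C assms by auto
  qed
  moreover have "down (V - {a, b}) k (link a b f) B =
      (\<Sum>C | C \<subseteq> V - {a, b} - B \<and> card C = k. f (insert a B \<union> C) + f (insert b B \<union> C))"
    unfolding down_def link_def using assms by (intro sum.cong) auto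
  ultimately show ?thesis
    unfolding split[of a b] split[of b a] sum.distrib
    by (simp add: insert_commute[of b a] ac_simps)
qed

lemma link_cycles:
  fixes f :: "'b set \<Rightarrow> 'a"
  assumes "f \<in> cycles V (Suc r)" "a \<in> V" "b \<in> V" "a \<noteq> b" "finite V"
  shows "link a b f \<in> cycles (V - {a, b}) r"
proof -
  have "down (V - {a, b}) 1 (link a b f) B = 0" for B
  proof (cases "a \<in> B \<or> b \<in> B")
    case True
    then show ?thesis by (auto simp: down_def link_def intro!: sum.neutral)
  next
    case False
    then show ?thesis using assms by (simp add: link_down cycles_def)
  qed
  then show ?thesis using assms link_uniform[of f V r a b] by (simp add: cycles_def)
qed

text \<open>As f does not involve a and b, substituting x_i + t acts on the two factors separately,
  and x_a + x_b becomes x_a + x_b + 2t. The case split is on which of the two letters lie in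
  B.\<close>

lemma down_spread:
  fixes f :: "'b set \<Rightarrow> 'a"
  assumes "a \<in> V" "b \<in> V" "a \<noteq> b" "finite V" "f \<in> uniform (V - {a, b}) r"
  shows "down V k (spread a b f) = spread a b (down V k f)"
proof
  have f0: "f A = 0" if "a \<in> A \<or> b \<in> A" for A
    using assms(5) that by (auto simp: uniform_def)
  have fin: "finite {C. C \<subseteq> V - W \<and> P C}" for W P using assms(4) by simp
  fix B
  have one: "down V k (spread a b f) B = down V k f (B - {a, b})"
    if ab: "a \<in> B" "b \<notin> B" "a \<in> V" "b \<in> V" and f0: "\<And>A. a \<in> A \<or> b \<in> A \<Longrightarrow> f A = 0" for a b
  proof -
    have "down V k (spread a b f) B =
        (\<Sum>C | C \<subseteq> V - {a, b} - B \<and> card C = k. f ((B - {a, b}) \<union> C))"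
      unfolding down_def
    proof (rule sum.mono_neutral_cong_right)
      show "\<forall>C\<in>{C. C \<subseteq> V - B \<and> card C = k} - {C. C \<subseteq> V - {a, b} - B \<and> card C = k}.
          spread a b f (B \<union> C) = 0"
        using ab by (auto simp: spread_def)
      fix C assume "C \<in> {C. C \<subseteq> V - {a, b} - B \<and> card C = k}"
      then have "b \<notin> B \<union> C" "a \<in> B \<union> C" "B \<union> C - {a, b} = (B - {a, b}) \<union> C" using ab by auto
      then show "spread a b f (B \<union> C) = f ((B - {a, b}) \<union> C)" by (simp only: spread_def) simp
    qed (use assms(4) in auto)
    also have "\<dots> = down V k f (B - {a, b})"
      unfolding down_def
    proof (rule sum.mono_neutral_left)
      show "\<forall>C\<in>{C. C \<subseteq> V - (B - {a, b}) \<and> card C = k} - {C. C \<subseteq> V - {a, b} - B \<and> card C = k}.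
          f ((B - {a, b}) \<union> C) = 0"
        by (auto intro!: f0)
    qed (use assms(4) in auto)
    finally show ?thesis .
  qed
  consider "a \<in> B" "b \<notin> B" | "a \<notin> B" "b \<in> B" | "a \<in> B" "b \<in> B" | "a \<notin> B" "b \<notin> B" by blast
  then show "down V k (spread a b f) B = spread a b (down V k f) B"
  proof cases
    case 1
    then show ?thesis using one[of a b] assms f0 by (simp add: spread_def)
  next
    case 2
    have "spread b a f = spread a b f" by (auto simp: spread_def fun_eq_iff insert_commute)
    moreover have "down V k (spread b a f) B = down V k f (B - {b, a})"
      using 2 assms f0 by (intro one) auto
    ultimately show ?thesis using 2 by (simp add: spread_def insert_commute)
  next
    case 3
    then show ?thesis by (auto simp: spread_def down_def intro!: sum.neutral)
  next
    case 4
    \<comment> \<open>This is the term 2t: for B without a and b only extensions containing exactly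
      one of the letters contribute, and exchanging a and b matches them in pairs.\<close>
    define S where "S a b = {C. C \<subseteq> V - B \<and> card C = k \<and> a \<in> C \<and> b \<notin> C}" for a b
    have move: "insert b (C - {a}) \<in> S b a" "insert a (insert b (C - {a}) - {b}) = C"
      "B \<union> insert b (C - {a}) - {a, b} = B \<union> C - {a, b}"
      if "C \<in> S a b" "b \<in> V" "b \<notin> B" for C a b
    proof -
      have C: "C \<subseteq> V - B" "card C = k" "a \<in> C" "b \<notin> C" using that by (auto simp: S_def)
      then have "finite C" using assms(4) finite_subset by blast
      then have "card (insert b (C - {a})) = card C" using C
        by (subst card_insert_disjoint)
          (auto simp: card_Suc_Diff1 simp del: card_Diff_insert card_Diff_singleton)
      then show "insert b (C - {a}) \<in> S b a" using C that(2,3) by (auto simp: S_def)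
      show "insert a (insert b (C - {a}) - {b}) = C" using C by auto
      show "B \<union> insert b (C - {a}) - {a, b} = B \<union> C - {a, b}" using C by auto
    qed
    have "(\<Sum>C\<in>S a b. spread a b f (B \<union> C)) = (\<Sum>C\<in>S b a. spread a b f (B \<union> C))"
    proof (rule sum.reindex_bij_witness[where i = "\<lambda>C. insert a (C - {b})" and j = "\<lambda>C. insert b (C - {a})"])
      fix C assume C: "C \<in> S a b"
      note m = move[OF C assms(2) 4(2)]
      show "insert a (insert b (C - {a}) - {b}) = C" "insert b (C - {a}) \<in> S b a" by (fact m)+
      show "spread a b f (B \<union> insert b (C - {a})) = spread a b f (B \<union> C)"
        using m(3) C 4 assms(3) by (auto simp: spread_def S_def)
    next
      fix C assume C: "C \<in> S b a"
      note m = move[OF C assms(1) 4(1)]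
      show "insert b (insert a (C - {b}) - {a}) = C" "insert a (C - {b}) \<in> S a b" by (fact m)+
    qed
    moreover have "down V k (spread a b f) B = (\<Sum>C\<in>S a b \<union> S b a. spread a b f (B \<union> C))"
      unfolding down_def
      by (rule sum.mono_neutral_right) (use assms(4) 4 in \<open>auto simp: S_def spread_def\<close>)
    moreover have "\<dots> = (\<Sum>C\<in>S a b. spread a b f (B \<union> C)) + (\<Sum>C\<in>S b a. spread a b f (B \<union> C))"
      by (rule sum.union_disjoint) (use assms(4) in \<open>auto simp: S_def\<close>)
    ultimately show ?thesis using 4 by (simp add: spread_def)
  qed
qed

lemma down_spreads:
  fixes f :: "'b set \<Rightarrow> 'a"
  assumes "distinct xs" "even (length xs)" "f \<in> uniform (V - set xs) r" "set xs \<subseteq> V" "finite V"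
  shows "down V k (spreads xs f) = spreads xs (down V k f)"
  using assms
proof (induction xs f rule: spreads.induct)
  case (1 a b xs f)
  have u: "f \<in> uniform (V - {a, b} - set xs) r"
  proof -
    have "V - set (a # b # xs) = V - {a, b} - set xs" by auto
    then show ?thesis using 1(4) by simp
  qed
  then have "spreads xs f \<in> uniform (V - {a, b}) (r + length xs div 2)"
    using 1 by (intro spreads_uniform) auto
  then have "down V k (spread a b (spreads xs f)) = spread a b (down V k (spreads xs f))"
    using 1 by (intro down_spread) auto
  moreover have "f \<in> uniform (V - set xs) r" using u unfolding uniform_def by fastforce
  ultimately show ?case using 1 by simp
qed auto

lemma down_spreads_layer:
  assumes "distinct xs" "even (length xs)" "set xs \<subseteq> V" "finite V" "k > 0"
  shows "down V k (spreads xs (layer {} 0 :: 'b set \<Rightarrow> 'a)) = 0"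
proof -
  have "down V k (layer {} 0 :: 'b set \<Rightarrow> 'a) = 0"
  proof
    fix B :: "'b set"
    have "\<not> (B \<union> C \<subseteq> {} \<and> card (B \<union> C) = 0)" if "card C = k" for C :: "'b set"
      using assms(5) that by auto
    then have "layer {} 0 (B \<union> C) = (0 :: 'a)" if "card C = k" for C
      using that unfolding layer_def by (rule_tac if_not_P) blast
    then have "down V k (layer {} 0 :: 'b set \<Rightarrow> 'a) B = 0"
      unfolding down_def by (intro sum.neutral) blast
    then show "down V k (layer {} 0 :: 'b set \<Rightarrow> 'a) B = 0 B" by simp
  qed
  moreover have "layer {} 0 \<in> (uniform (V - set xs) 0 :: ('b set \<Rightarrow> 'a) set)" by (rule layer_uniform) simp
  note down_spreads[OF assms(1,2) this assms(3,4), of k]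
  ultimately show ?thesis by simp
qed

text \<open>The variable a enters e_(m+1) of A and a as e_(m+1)(A) + x_a e_m(A); in the sum for a
  and b the terms e_(m+1)(A) cancel.\<close>

lemma layer_insert_add:
  assumes "a \<notin> A" "b \<notin> A" "a \<noteq> b" "finite A"
  shows "layer (insert a A) (Suc m) + layer (insert b A) (Suc m) =
    (spread a b (layer A m) :: 'b set \<Rightarrow> 'a)"
proof
  fix B
  have one: "layer (insert a A) (Suc m) B = (layer A m (B - {a, b}) :: 'a)"
    if "a \<in> B" "b \<notin> B" for a b
  proof -
    have eq: "B - {a, b} = B - {a}" using that by auto
    show ?thesis
    proof (cases "B \<subseteq> insert a A")
      case True
      then have "finite B" using assms(4) finite_subset by blast
      then have "card B = Suc (card (B - {a}))" using that(1) by (rule card.remove)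
      moreover have "B - {a} \<subseteq> A" using True by auto
      ultimately show ?thesis using True unfolding eq by (simp add: layer_def)
    next
      case False
      then show ?thesis unfolding eq by (auto simp: layer_def)
    qed
  qed
  consider "a \<in> B" "b \<notin> B" | "a \<notin> B" "b \<in> B" | "a \<in> B" "b \<in> B" | "a \<notin> B" "b \<notin> B" by blast
  then show "(layer (insert a A) (Suc m) + layer (insert b A) (Suc m)) B =
    (spread a b (layer A m) B :: 'a)"
  proof cases
    case 1
    moreover have "layer (insert b A) (Suc m) B = (0 :: 'a)"
      using 1 assms by (auto simp: layer_def)
    ultimately show ?thesis using one[of a b] by (simp add: spread_def)
  next
    case 2
    moreover have "layer (insert a A) (Suc m) B = (0 :: 'a)"
      using 2 assms by (auto simp: layer_def)
    ultimately show ?thesis using one[of b a] by (simp add: spread_def insert_commute)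
  next
    case 3
    then show ?thesis using assms by (auto simp: spread_def layer_def)
  next
    case 4
    then have "layer (insert a A) (Suc m) B = (layer (insert b A) (Suc m) B :: 'a)"
      by (auto simp: layer_def)
    then show ?thesis using 4 by (simp add: spread_def add_self)
  qed
qed

text \<open>A boundary is a cycle: an (r - 1)-subset of A has exactly two extensions to r-subsets of
  A. For r = 0 there is nothing below the empty set, hence the separate case.\<close>

lemma layer_cycles:
  assumes "A \<subseteq> V" "finite V" "card A = Suc r"
  shows "layer A r \<in> (cycles V r :: ('b set \<Rightarrow> 'a) set)"
proof -
  have "down V 1 (layer A r :: 'b set \<Rightarrow> 'a) = 0"
  proof (cases r)
    case 0
    show ?thesis
    proof
      fix B
      have "down V 1 (layer A r :: 'b set \<Rightarrow> 'a) B = 0"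
        unfolding down_1[OF assms(2)]
      proof (rule sum.neutral, rule ballI, rule ccontr)
        fix c assume "c \<in> V - B" "layer A r (insert c B) \<noteq> (0 :: 'a)"
        then have "insert c B \<subseteq> A" "card (insert c B) = 0" using 0 by (auto simp: layer_def split: if_splits)
        then show False using assms by (metis card_0_eq finite_subset insert_not_empty)
      qed
      then show "down V 1 (layer A r :: 'b set \<Rightarrow> 'a) B = 0 B" by simp
    qed
  next
    case (Suc m)
    then show ?thesis using down_layer[OF assms(1,2), of 1 m, where 'a = 'a] assms(3)
      by (simp add: two_eq_0 fun_eq_iff fscale_def)
  qed
  then have "down V 1 (layer A r :: 'b set \<Rightarrow> 'a) B = 0" for B by simp
  then show ?thesis unfolding cycles_def using layer_uniform[OF assms(1), of r] by blast
qed

text \<open>Acyclicity of the simplex by coning from v: a cycle is determined by its values on the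
  sets avoiding v, and the boundary of insert v A takes the value 1 at A and 0 at all other such
  r-sets.\<close>

lemma cycles_expand:
  fixes f :: "'b set \<Rightarrow> 'a"
  assumes "f \<in> cycles V r" "finite V" "v \<in> V"
  shows "f = (\<Sum>A | A \<subseteq> V - {v} \<and> card A = r. fscale (f A) (layer (insert v A) r))"
proof (rule uniform_eqI)
  show "f \<in> uniform V r" using assms(1) by (simp add: cycles_def)
  show "(\<Sum>A | A \<subseteq> V - {v} \<and> card A = r. fscale (f A) (layer (insert v A) r)) \<in> uniform V r"
    using assms(3) by (intro fun_vs.subspace_sum fun_vs.subspace_scale subspace_uniform)
      (auto simp: uniform_def layer_def)
  fix B assume B: "B \<subseteq> V" "card B = r"
  let ?S = "{A. A \<subseteq> V - {v} \<and> card A = r}"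
  have fB: "finite B" using B assms(2) finite_subset by blast
  have fS: "finite ?S" using assms(2) by simp
  have "(\<Sum>A\<in>?S. fscale (f A) (layer (insert v A) r)) B =
      (\<Sum>A\<in>?S. if B \<subseteq> insert v A then f A else 0)"
    using B(2) by (simp add: sum_fun_apply fscale_def layer_def if_distrib cong: if_cong)
  also have "\<dots> = f B"
  proof (cases "v \<in> B")
    case False
    have "(B \<subseteq> insert v A) = (A = B)" if A: "A \<in> ?S" for A
    proof
      assume "B \<subseteq> insert v A"
      then have "B \<subseteq> A" using False by blast
      moreover have "A \<subseteq> V" using A by blast
      then have "finite A" using assms(2) by (rule finite_subset)
      ultimately have "B = A" using A B(2) by (intro card_subset_eq) simp_all
      then show "A = B" ..
    qed blast
    then have "(\<Sum>A\<in>?S. if B \<subseteq> insert v A then f A else 0) = (\<Sum>A\<in>?S. if A = B then f A else 0)"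
      by (intro sum.cong) auto
    moreover have "B \<subseteq> V - {v}" using B False by auto
    ultimately show ?thesis using B False fS by (simp add: sum.delta')
  next
    case True
    \<comment> \<open>The cycle condition at B - {v} expresses f B through the sets insert c (B -
      {v}) avoiding v, and these are exactly the A that contribute to the right-hand side.\<close>
    let ?B = "B - {v}"
    have cB: "Suc (card ?B) = r" using True fB B by (metis card.remove)
    have im: "(\<lambda>c. insert c ?B) ` (V - B) = {A \<in> ?S. B \<subseteq> insert v A}"
    proof (intro equalityI subsetI)
      fix A assume "A \<in> (\<lambda>c. insert c ?B) ` (V - B)"
      then obtain c where c: "A = insert c ?B" "c \<in> V - B" by blast
      then have "card A = r" using cB fB by simp
      then show "A \<in> {A \<in> ?S. B \<subseteq> insert v A}" using c True B by auto
    next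
      fix A assume A: "A \<in> {A \<in> ?S. B \<subseteq> insert v A}"
      then have "?B \<subseteq> A" "card A = Suc (card ?B)" using cB by auto
      then have "card (A - ?B) = 1" using fB by (subst card_Diff_subset) auto
      then obtain c where "A - ?B = {c}" by (auto simp: card_1_singleton_iff)
      then have "A = insert c ?B" "c \<in> V - B" using \<open>?B \<subseteq> A\<close> A by auto
      then show "A \<in> (\<lambda>c. insert c ?B) ` (V - B)" by blast
    qed
    have "inj_on (\<lambda>c. insert c ?B) (V - B)" by (rule inj_onI) blast
    then have "(\<Sum>c\<in>V - B. f (insert c ?B)) = (\<Sum>A | A \<in> ?S \<and> B \<subseteq> insert v A. f A)"
      by (subst im[symmetric], subst sum.reindex) simp_all
    also have "\<dots> = (\<Sum>A\<in>?S. if B \<subseteq> insert v A then f A else 0)"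
      using fS by (rule sum.inter_filter)
    finally have "(\<Sum>A\<in>?S. if B \<subseteq> insert v A then f A else 0) = (\<Sum>c\<in>V - B. f (insert c ?B))" ..
    moreover have "(\<Sum>c\<in>V - ?B. f (insert c ?B)) = 0"
      using assms by (simp add: cycles_def down_1[symmetric])
    moreover have "V - ?B = insert v (V - B)" using True assms(3) by auto
    ultimately have "f (insert v ?B) + (\<Sum>A\<in>?S. if B \<subseteq> insert v A then f A else 0) = 0"
      using True assms(2) by simp
    then show ?thesis using True by (simp add: insert_absorb add_eq_0_char2)
  qed
  finally show "f B = (\<Sum>A\<in>?S. fscale (f A) (layer (insert v A) r)) B" ..
qed

section \<open>Primitive functions\<close>

text \<open>
  Inclusion and exclusion over the subsets of \<open>A\<close> expresses \<open>f A\<close> by the values of \<open>f\<close> on the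
  \<open>r\<close>-sets disjoint from \<open>A\<close>, and there are none.
\<close>

lemma primitive_small:
  fixes f :: "'b set \<Rightarrow> 'a"
  assumes "finite V" "f \<in> primitive V r" "card V < 2 * r"
  shows "f = 0"
proof (rule uniform_eqI)
  show u: "f \<in> uniform V r" using assms by (simp add: primitive_def)
  show "0 \<in> uniform V r" by (simp add: uniform_def)
  fix A assume A: "A \<subseteq> V" "card A = r"
  have fA: "finite A" using A(1) assms(1) by (rule finite_subset)
  \<comment> \<open>Only C = A survives, where the operator is \<open>down V 0\<close>; every proper
    subset has a down map of positive order, which annihilates f.\<close>
  have "(\<Sum>C\<in>Pow A. down V (r - card C) f C) = (\<Sum>C\<in>Pow A. if C = A then f A else 0)"
  proof (rule sum.cong)
    fix C assume C: "C \<in> Pow A"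
    show "down V (r - card C) f C = (if C = A then f A else 0)"
    proof (cases "C = A")
      case True
      then show ?thesis using A assms(1) by (simp add: down_0)
    next
      case False
      then have "card C < r" using C A fA psubset_card_mono[of A C] by auto
      then show ?thesis using False assms(2) by (simp add: primitive_def)
    qed
  qed simp
  also have "\<dots> = f A" using fA by simp
  finally have "f A = (\<Sum>C\<in>Pow A. down V (r - card C) f C)" ..
  also have "\<dots> = (\<Sum>C\<in>Pow A. \<Sum>B | B \<subseteq> V \<and> card B = r. if C \<subseteq> B then f B else 0)"
  proof (rule sum.cong)
    fix C assume C: "C \<in> Pow A"
    then have "card C \<le> r" using A fA card_mono by auto
    then have "card C + (r - card C) = r" by simp
    moreover have "C \<subseteq> V" using C A by auto
    ultimately show "down V (r - card C) f C = (\<Sum>B | B \<subseteq> V \<and> card B = r. if C \<subseteq> B then f B else 0)"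
      using down_superset[OF assms(1), of C "r - card C" f] by simp
  qed simp
  also have "\<dots> = (\<Sum>B | B \<subseteq> V \<and> card B = r. \<Sum>C\<in>Pow A. if C \<subseteq> B then f B else 0)"
    by (rule sum.swap)
  also have "\<dots> = 0"
  proof (rule sum.neutral, rule ballI)
    fix B assume B: "B \<in> {B. B \<subseteq> V \<and> card B = r}"
    then have fB: "finite B" using assms(1) finite_subset[of B V] by simp
    have "A \<inter> B \<noteq> {}"
    proof
      assume "A \<inter> B = {}"
      then have "card (A \<union> B) = 2 * r" using fA fB A B by (simp add: card_Un_disjoint)
      moreover have "card (A \<union> B) \<le> card V" using A B assms(1) by (intro card_mono) auto
      ultimately show False using assms(3) by simp
    qed
    then have "even (card (Pow (A \<inter> B)))" using fA by (simp add: card_Pow card_gt_0_iff del: Pow_Int_eq)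
    have eq: "{C \<in> Pow A. C \<subseteq> B} = Pow (A \<inter> B)" by auto
    have "(\<Sum>C\<in>Pow A. if C \<subseteq> B then f B else 0) = (\<Sum>C\<in>{C \<in> Pow A. C \<subseteq> B}. f B)"
      using fA by (subst sum.inter_filter) simp_all
    also have "\<dots> = of_nat (card (Pow (A \<inter> B))) * f B" unfolding eq by simp
    finally show "(\<Sum>C\<in>Pow A. if C \<subseteq> B then f B else 0) = 0"
      using \<open>even (card (Pow (A \<inter> B)))\<close> of_nat_char2[of "card (Pow (A \<inter> B))"] by simp
  qed
  finally show "f A = 0 A" by (simp only: zero_fun_apply)
qed

text \<open>
  James's kernel intersection theorem for two-row partitions: splitting off one letter, the
  cofactor of that letter is again primitive.
\<close>

lemma primitive_span:
  fixes f :: "'b set \<Rightarrow> 'a"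
  assumes "finite V" "f \<in> primitive V r"
  shows "f \<in> fun_vs.span {spreads xs (layer {} 0) | xs. distinct xs \<and> length xs = 2 * r \<and> set xs \<subseteq> V}"
  using assms
proof (induction V arbitrary: r f rule: finite_induct)
  case empty
  show ?case
  proof (cases r)
    case 0
    then show ?thesis using empty uniform_0_span[of f "{}"] by (simp add: primitive_def)
  next
    case (Suc q)
    then have "f = 0" using primitive_small[of "{}" f r] empty by simp
    then show ?thesis by (simp only: fun_vs.span_zero)
  qed
next
  case (insert v W)
  let ?V = "insert v W"
  let ?G = "\<lambda>V r. {spreads xs (layer {} 0 :: 'b set \<Rightarrow> 'a) | xs. distinct xs \<and> length xs = 2 * r \<and> set xs \<subseteq> V}"
  have fin: "finite ?V" using insert by simp
  have u: "f \<in> uniform ?V r" and d: "\<And>k B. k > 0 \<Longrightarrow> down ?V k f B = 0"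
    using insert.prems by (simp_all add: primitive_def)
  consider "r = 0" | "card ?V < 2 * r" | q where "r = Suc q" "card W \<ge> Suc (2 * q)"
  proof -
    have "r = 0 \<or> card ?V < 2 * r \<or> (r = Suc (r - 1) \<and> card W \<ge> Suc (2 * (r - 1)))"
      using insert(1,2) by simp arith
    then show thesis using that by blast
  qed
  then show ?case
  proof cases
    case 1
    then show ?thesis using u uniform_0_span[of f ?V] fin by simp
  next
    case 2
    then have "f = 0" using primitive_small[of ?V f r] insert.prems fin by simp
    then show ?thesis by (simp only: fun_vs.span_zero)
  next
    case 3
    define f1 where "f1 A = (if v \<in> A then 0 else f (insert v A))" for A
    have "f1 \<in> primitive W q"
    proof -
      have "A \<subseteq> W \<and> card A = q" if "f1 A \<noteq> 0" for A
      proof -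
        have A: "v \<notin> A" "f (insert v A) \<noteq> 0" using that by (auto simp: f1_def split: if_splits)
        then have "insert v A \<subseteq> ?V" "card (insert v A) = r" using u by (auto simp: uniform_def)
        moreover have "finite A" using calculation(1) insert(1) by (meson finite_insert finite_subset)
        ultimately show ?thesis using A(1) 3(1) by auto
      qed
      moreover have "down W k f1 B = 0" if "k > 0" for k B
      proof (cases "v \<in> B")
        case True
        then show ?thesis by (simp add: down_def f1_def)
      next
        case False
        have "?V - insert v B = W - B" using insert(2) by auto
        then have "down ?V k f (insert v B) = down W k f1 B"
          unfolding down_def using insert(2) False by (intro sum.cong) (auto simp: f1_def)
        then show ?thesis using d[OF that] by simp
      qed
      ultimately show ?thesis by (auto simp: primitive_def uniform_def)
    qed
    then have "f1 \<in> fun_vs.span (?G W q)" by (rule insert.IH)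
    \<comment> \<open>Each product of q factors on W is multiplied by x_v + x_m for a letter m that
      it does not use; such m exists because card W > 2 * q.\<close>
    then have "\<exists>h\<in>fun_vs.span (?G ?V r). \<forall>A. v \<notin> A \<longrightarrow> h (insert v A) = f1 A"
    proof (induction rule: fun_vs.span_induct_alt)
      case base
      show ?case by (intro bexI[of _ 0] fun_vs.span_zero) simp
    next
      case (step c g g')
      then obtain h' where h': "h' \<in> fun_vs.span (?G ?V r)" "\<And>A. v \<notin> A \<Longrightarrow> h' (insert v A) = g' A"
        by blast
      obtain ys where ys: "g = spreads ys (layer {} 0)" "distinct ys" "length ys = 2 * q" "set ys \<subseteq> W"
        using step(1) by blast
      have "card (set ys) < card W" using ys 3 by (simp add: distinct_card)
      then obtain m where m: "m \<in> W" "m \<notin> set ys"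
        by (metis List.finite_set card_mono leD subsetI)
      let ?h = "spreads (v # m # ys) (layer {} 0 :: 'b set \<Rightarrow> 'a)"
      have "?h (insert v A) = g A" if "v \<notin> A" for A
      proof (cases "m \<in> A")
        case True
        have "g \<in> uniform (W - {m}) (length ys div 2)"
          unfolding ys(1) using ys m insert(1) by (intro spreads_layer_uniform) auto
        then have "g A = 0" using True by (auto simp: uniform_def)
        then show ?thesis using True by (simp add: spread_def)
      next
        case False
        have "v \<noteq> m" using m insert(2) by auto
        moreover have "insert v A - {v, m} = A" using that False by auto
        ultimately show ?thesis using False ys(1) by (simp add: spread_def)
      qed
      moreover have "?h \<in> ?G ?V r"
        using ys m insert(2) 3(1) by (intro CollectI exI[of _ "v # m # ys"]) auto
      ultimately show ?case
        using h' by (intro bexI[of _ "fscale c ?h + h'"] fun_vs.span_add fun_vs.span_scale)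
          (auto simp: fscale_def intro: fun_vs.span_base)
    qed
    then obtain h where h: "h \<in> fun_vs.span (?G ?V r)" "\<And>A. v \<notin> A \<Longrightarrow> h (insert v A) = f1 A" by blast
    have "fun_vs.span (?G ?V r) \<subseteq> primitive ?V r"
    proof (rule fun_vs.span_minimal[OF _ subspace_primitive])
      show "?G ?V r \<subseteq> primitive ?V r"
      proof
        fix g assume "g \<in> ?G ?V r"
        then obtain xs where xs: "g = spreads xs (layer {} 0)" "distinct xs" "length xs = 2 * r" "set xs \<subseteq> ?V"
          by blast
        then show "g \<in> primitive ?V r"
          using spreads_layer_uniform[of xs ?V, where 'a = 'a] fin down_spreads_layer[of xs ?V]
          by (simp add: primitive_def)
      qed
    qed
    then have hp: "h \<in> primitive ?V r" using h by blast
    \<comment> \<open>f and h have the same cofactor at v, so the sum no longer involves v and the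
      induction applies on W with the same r.\<close>
    define f0 where "f0 = f + h"
    have f0p: "f0 \<in> primitive ?V r"
      unfolding f0_def by (rule fun_vs.subspace_add[OF subspace_primitive insert.prems hp])
    have f0v: "f0 A = 0" if "v \<in> A" for A
    proof -
      have A: "insert v (A - {v}) = A" using that by auto
      have "h (insert v (A - {v})) = f1 (A - {v})" by (rule h(2)) simp
      then have "h A = f A" using A by (simp add: f1_def)
      then show ?thesis by (simp add: f0_def add_self)
    qed
    have "f0 \<in> primitive W r"
    proof -
      have "A \<subseteq> W \<and> card A = r" if "f0 A \<noteq> 0" for A
      proof -
        have "A \<subseteq> ?V" "card A = r" using that f0p by (auto simp: primitive_def uniform_def)
        moreover have "v \<notin> A" using that f0v by auto
        ultimately show ?thesis by auto
      qed
      moreover have "down W k f0 B = 0" if "k > 0" for k B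
      proof -
        have "down ?V k f0 B = down W k f0 B"
          unfolding down_def
        proof (rule sum.mono_neutral_right)
          show "\<forall>C\<in>{C. C \<subseteq> ?V - B \<and> card C = k} - {C. C \<subseteq> W - B \<and> card C = k}. f0 (B \<union> C) = 0"
            by (auto intro!: f0v)
        qed (use insert(1) in auto)
        then show ?thesis using that f0p by (simp add: primitive_def)
      qed
      ultimately show ?thesis by (auto simp: primitive_def uniform_def)
    qed
    then have "f0 \<in> fun_vs.span (?G W r)" by (rule insert.IH)
    moreover have "?G W r \<subseteq> ?G ?V r" by blast
    ultimately have "f0 \<in> fun_vs.span (?G ?V r)" using fun_vs.span_mono by blast
    moreover have "f = f0 + h" by (simp add: f0_def add.assoc add_self_fun)
    ultimately show ?thesis using h fun_vs.span_add by blast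
  qed
qed

text \<open>Sets containing both or neither of a and b are fixed by the transposition and cancel;
  the others are exchanged in pairs, and both sets of a pair receive the sum of the two
  values.\<close>

lemma swap_add:
  fixes f :: "'b set \<Rightarrow> 'a"
  assumes "a \<noteq> b"
  shows "f + (\<lambda>A. f (transpose a b ` A)) = spread a b (link a b f)"
proof
  fix A
  have img: "transpose a b ` A = insert b (A - {a})" if "a \<in> A" "b \<notin> A" for a b and A :: "'b set"
    using that by (auto simp: transpose_def image_iff)
  have fix_ab: "transpose a b ` A = A" if "(a \<in> A) = (b \<in> A)"
    using that by (auto simp: transpose_def image_iff split: if_splits)
  consider "a \<in> A" "b \<notin> A" | "a \<notin> A" "b \<in> A" | "(a \<in> A) = (b \<in> A)" by blast
  then show "(f + (\<lambda>A. f (transpose a b ` A))) A = spread a b (link a b f) A"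
  proof cases
    case 1
    then have "insert a (A - {a, b}) = A" "insert b (A - {a, b}) = insert b (A - {a})" by auto
    then show ?thesis using 1 img[of a A b] by (simp add: spread_def link_def)
  next
    case 2
    then have "insert b (A - {a, b}) = A" "insert a (A - {a, b}) = insert a (A - {b})" by auto
    then show ?thesis using 2 img[of b A a] by (simp add: spread_def link_def transpose_commute add.commute)
  next
    case 3
    then show ?thesis by (simp add: fix_ab spread_def add_self)
  qed
qed

lemma invariant_swap:
  fixes f :: "'b set \<Rightarrow> 'a"
  assumes "invariant V U" "f \<in> U" "a \<in> V" "b \<in> V" "a \<noteq> b"
  shows "spread a b (link a b f) \<in> U"
proof -
  have "transpose a b permutes V" using assms by (simp add: permutes_swap_id)
  then have "(\<lambda>A. f (transpose a b ` A)) \<in> U" using assms by (simp add: invariant_def)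
  then have "f + (\<lambda>A. f (transpose a b ` A)) \<in> U"
    using assms(1,2) unfolding invariant_def by (intro fun_vs.subspace_add) auto
  then show ?thesis using swap_add[OF assms(5), of f] by simp
qed

text \<open>The operators for disjoint pairs commute, so applying them one after the other amounts
  to extracting all cofactors and then multiplying by all factors.\<close>

lemma invariant_spreads_links:
  fixes f :: "'b set \<Rightarrow> 'a"
  assumes "invariant V U" "f \<in> U" "distinct xs" "even (length xs)" "set xs \<subseteq> V"
  shows "spreads xs (links xs f) \<in> U"
  using assms(3-5)
proof (induction xs rule: induct_list012)
  case (3 a b xs)
  then have "spread a b (link a b (spreads xs (links xs f))) \<in> U"
    using assms(1) by (intro invariant_swap) auto
  then show ?case using 3 by (simp add: link_spreads_commute)
qed (use assms in auto)

lemma primitive_subset: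
  fixes U :: "('b set \<Rightarrow> 'a) set"
  assumes "invariant V U" "finite V" "f \<in> U" "f \<in> cycles V r" "f \<notin> vanishing V r"
  shows "primitive V r \<subseteq> U"
proof -
  obtain xs where xs: "distinct xs" "length xs = 2 * r" "set xs \<subseteq> V" "links xs f {} \<noteq> 0"
    using assms(4,5) by (auto simp: vanishing_def)
  have "f \<in> uniform V (0 + length xs div 2)" using assms(4) xs by (simp add: cycles_def)
  then have "links xs f \<in> uniform (V - set xs) 0"
    by (rule links_uniform[OF xs(1) _ _ xs(3) assms(2), rotated]) (simp add: xs)
  then have "links xs f = fscale (links xs f {}) (layer {} 0)"
    by (rule uniform_0_eq) (simp add: assms(2))
  then have "spreads xs (links xs f) = spreads xs (fscale (links xs f {}) (layer {} 0))"
    by (rule arg_cong)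
  then have "spreads xs (links xs f) = fscale (links xs f {}) (spreads xs (layer {} 0))"
    by (simp only: spreads_scale)
  moreover have "spreads xs (links xs f) \<in> U" using assms xs by (intro invariant_spreads_links) auto
  moreover have sub: "fun_vs.subspace U" using assms(1) by (simp add: invariant_def)
  ultimately have sx: "spreads xs (layer {} 0) \<in> U"
    using xs(4) subspace_scale_cancel by metis
  have "{spreads ys (layer {} 0) | ys. distinct ys \<and> length ys = 2 * r \<and> set ys \<subseteq> V} \<subseteq> U"
    using spreads_transitive[OF assms(1,2) xs(1)] xs sx by auto
  then have "fun_vs.span {spreads ys (layer {} 0) | ys. distinct ys \<and> length ys = 2 * r \<and> set ys \<subseteq> V} \<subseteq> U"
    using sub by (rule fun_vs.span_minimal)
  then show ?thesis using primitive_span[OF assms(2)] by blast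
qed

section \<open>Vanishing functions\<close>

text \<open>The boundaries of the (r + 1)-sets are permuted transitively and span the
  cycles.\<close>

lemma cycles_generated:
  fixes U :: "('b set \<Rightarrow> 'a) set"
  assumes "invariant V U" "finite V" "A \<subseteq> V" "card A = Suc r" "layer A r \<in> U"
  shows "cycles V r \<subseteq> U"
proof
  fix f :: "'b set \<Rightarrow> 'a" assume f: "f \<in> cycles V r"
  have "A \<noteq> {}" using assms(4) by auto
  then obtain v where v: "v \<in> V" using assms(3) by blast
  have sub: "fun_vs.subspace U" using assms(1) by (simp add: invariant_def)
  have "layer (insert v B) r \<in> U" if B: "B \<subseteq> V - {v}" "card B = r" for B
  proof -
    have "B \<subseteq> V" using B by blast
    then have "finite B" using assms(2) by (rule finite_subset)
    moreover have "v \<notin> B" using B by blast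
    ultimately have "card A = card (insert v B)" using assms(4) B by simp
    then show ?thesis using layer_transitive[OF assms(1,2,3) _ _ assms(5)] v \<open>B \<subseteq> V\<close> by simp
  qed
  then have "(\<Sum>A | A \<subseteq> V - {v} \<and> card A = r. fscale (f A) (layer (insert v A) r)) \<in> U"
    using fun_vs.subspace_sum[OF sub] fun_vs.subspace_scale[OF sub]
    by (metis (mono_tags, lifting) mem_Collect_eq)
  then show "f \<in> U" unfolding cycles_expand[OF f assms(2) v, symmetric] .
qed

text \<open>Appending a and b to a list of 2 * r letters avoiding them gives a test list for f. This
  recursion lowers the degree by 1 and the number of letters by 2, so it keeps the parity of card
  V.\<close>

lemma vanishing_link:
  fixes f :: "'b set \<Rightarrow> 'a"
  assumes "f \<in> vanishing V (Suc r)" "a \<in> V" "b \<in> V" "a \<noteq> b" "finite V"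
  shows "link a b f \<in> vanishing (V - {a, b}) r"
proof -
  have "links xs (link a b f) {} = 0"
    if xs: "distinct xs" "length xs = 2 * r" "set xs \<subseteq> V - {a, b}" for xs
  proof -
    have "distinct (xs @ [a, b])" "length (xs @ [a, b]) = 2 * Suc r" "set (xs @ [a, b]) \<subseteq> V"
      using xs assms by auto
    then have "links (xs @ [a, b]) f {} = 0" using assms(1) unfolding vanishing_def by blast
    then show ?thesis using links_snoc[of xs a b f] xs by simp
  qed
  moreover have "link a b f \<in> cycles (V - {a, b}) r"
    using assms by (intro link_cycles) (simp_all add: vanishing_def)
  ultimately show ?thesis by (simp add: vanishing_def)
qed

lemma vanishing_1_flat:
  fixes f :: "'b set \<Rightarrow> 'a"
  assumes "f \<in> vanishing V 1" "finite V"
  shows "flat V 1 f"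
  unfolding One_nat_def
proof (rule flat_exchange[OF assms(2)])
  fix C a b assume C: "C \<subseteq> V" "a \<in> V - C" "b \<in> V - C" "a \<noteq> b" "card C = 0"
  have "finite C" using C(1) assms(2) by (rule finite_subset)
  then have "C = {}" using C(5) by simp
  have "distinct [a, b]" "length [a, b] = 2 * 1" "set [a, b] \<subseteq> V" using C by auto
  then have "links [a, b] f {} = 0" using assms(1) unfolding vanishing_def by blast
  then show "f (insert a C) = f (insert b C)"
    using \<open>C = {}\<close> by (simp add: link_def add_eq_0_char2)
qed

lemma flat_eq_0:
  fixes f :: "'b set \<Rightarrow> 'a"
  assumes "flat V r f" "f \<in> uniform V r" "finite V" "odd (card V choose r)" "down V r f {} = 0"
  shows "f = 0"
proof (rule uniform_eqI[OF assms(2)])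
  show "0 \<in> uniform V r" by (simp add: uniform_def)
  fix A assume A: "A \<subseteq> V" "card A = r"
  then have "of_nat (card V choose r) * f A = 0"
    using flat_down[OF assms(1) A assms(3)] assms(5) by simp
  then show "f A = 0 A" using assms(4) of_nat_char2[of "card V choose r"] by simp
qed

text \<open>f is constant on singletons, and the sum of an odd number of copies of this constant is
  0.\<close>

lemma vanishing_1_odd:
  fixes f :: "'b set \<Rightarrow> 'a"
  assumes "f \<in> vanishing V 1" "finite V" "odd (card V)"
  shows "f = 0"
proof (rule flat_eq_0[OF vanishing_1_flat[OF assms(1,2)]])
  have f: "f \<in> cycles V 1" using assms(1) by (simp only: vanishing_def mem_Collect_eq)
  then show "f \<in> uniform V 1" "down V 1 f {} = 0" by (simp_all only: cycles_def mem_Collect_eq)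
qed (use assms in simp_all)

text \<open>V - {a, b} again has odd size, so \<open>link a b f\<close> is 0 by the case of degree
  1, and an exchange of a by b does not change f.\<close>

lemma vanishing_2_flat:
  fixes f :: "'b set \<Rightarrow> 'a"
  assumes "f \<in> vanishing V 2" "finite V" "odd (card V)"
  shows "flat V 2 f"
  unfolding numeral_2_eq_2
proof (rule flat_exchange[OF assms(2)])
  fix C a b assume C: "C \<subseteq> V" "a \<in> V - C" "b \<in> V - C" "a \<noteq> b" "card C = Suc 0"
  have "card {a, b} = 2" using C(4) by simp
  moreover have "card {a, b} \<le> card V" using C assms(2) by (intro card_mono) auto
  moreover have "card (V - {a, b}) = card V - card {a, b}" using C by (intro card_Diff_subset) auto
  ultimately have "card V = card (V - {a, b}) + 2" by simp
  then have "odd (card (V - {a, b}))" using assms(3) by simp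
  moreover have "link a b f \<in> vanishing (V - {a, b}) 1"
    using C assms by (intro vanishing_link) (auto simp: numeral_2_eq_2)
  ultimately have "link a b f = 0" using assms(2) by (intro vanishing_1_odd) auto
  then have "link a b f C = 0" by simp
  then show "f (insert a C) = f (insert b C)"
    using C by (simp add: link_def add_eq_0_char2)
qed

text \<open>A discrete integration: the change of f under an exchange of i by j depends only on i
  and j and is additive along exchanges, so it is b i + b j for a potential b measured from a fixed
  letter v; then f + sum b is constant. The bound on card V leaves room for r-sets avoiding i, j and
  v.\<close>

lemma flat_links_affine:
  fixes f :: "'b set \<Rightarrow> 'a"
  assumes fin: "finite V" and card: "card V \<ge> r + 3" and f: "f \<in> uniform V (Suc r)"
    and flat: "\<And>i j. i \<in> V \<Longrightarrow> j \<in> V \<Longrightarrow> i \<noteq> j \<Longrightarrow> flat (V - {i, j}) r (link i j f)"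
  obtains b c where "f = affine V (Suc r) b c"
proof -
  have same: "f (insert i A) + f (insert j A) = f (insert i B) + f (insert j B)"
    if "i \<in> V" "j \<in> V" "i \<noteq> j" "A \<subseteq> V - {i, j}" "card A = r" "B \<subseteq> V - {i, j}" "card B = r" for i j A B
  proof -
    have "link i j f A = link i j f B" using flat[of i j] that unfolding flat_def by blast
    moreover have "i \<notin> A" "j \<notin> A" "i \<notin> B" "j \<notin> B" using that by auto
    ultimately show ?thesis by (simp add: link_def)
  qed
  have "V \<noteq> {}" using card by auto
  then obtain v where v: "v \<in> V" by blast
  have ex: "\<exists>A. A \<subseteq> V - {i, j, v} \<and> card A = r" for i j
  proof -
    have "card {i, j, v} \<le> 3" by (simp add: card_insert_le_m1)
    then have "r \<le> card V - card {i, j, v}" using card by simp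
    also have "\<dots> \<le> card (V - {i, j, v})" by (rule diff_card_le_card_Diff) simp
    finally show ?thesis by (meson obtain_subset_with_card_n)
  qed
  \<comment> \<open>A reference set for measuring b i; the existence statement is used with j =
    i.\<close>
  define A where "A i = (SOME A. A \<subseteq> V - {i, i, v} \<and> card A = r)" for i
  have A: "A i \<subseteq> V - {i, v}" "card (A i) = r" for i
    using someI_ex[OF ex[of i i]] unfolding A_def by auto
  define b where "b i = (if i = v then 0 else f (insert i (A i)) + f (insert v (A i)))" for i
  have bv: "f (insert i B) + f (insert v B) = b i"
    if "i \<in> V" "B \<subseteq> V - {i, v}" "card B = r" for i B
    using same[of i v B "A i"] that A[of i] v by (cases "i = v") (auto simp: b_def add_self)
  have bij: "f (insert i B) + f (insert j B) = b i + b j"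
    if ij: "i \<in> V" "j \<in> V" "i \<noteq> j" "B \<subseteq> V - {i, j}" "card B = r" for i j B
  proof -
    \<comment> \<open>On a set avoiding v the exchange of i by j can be routed through v.\<close>
    obtain B' where B': "B' \<subseteq> V - {i, j, v}" "card B' = r" using ex by blast
    have "f (insert i B) + f (insert j B) = f (insert i B') + f (insert j B')"
      using same[of i j B B'] ij B' by blast
    also have "\<dots> = (f (insert i B') + f (insert v B')) + (f (insert j B') + f (insert v B'))"
      using add_self_assoc[of "f (insert v B')"] by (simp add: ac_simps add_self)
    also have "\<dots> = b i + b j"
    proof -
      have "B' \<subseteq> V - {i, v}" "B' \<subseteq> V - {j, v}" using B' by blast+
      then show ?thesis using bv[OF ij(1) _ B'(2)] bv[OF ij(2) _ B'(2)] by (simp only:)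
    qed
    finally show ?thesis .
  qed
  define g where "g B = f B + sum b B" for B
  have "flat V (Suc r) g"
  proof (rule flat_exchange[OF fin])
    fix C i j assume C: "C \<subseteq> V" "i \<in> V - C" "j \<in> V - C" "i \<noteq> j" "card C = r"
    have fC: "finite C" using C(1) fin by (rule finite_subset)
    have "f (insert i C) + f (insert j C) = b i + b j" using C by (intro bij) auto
    then have "(f (insert i C) + b i) + (f (insert j C) + b j) = (b i + b j) + (b i + b j)"
      by (simp only: ac_simps)
    then have "f (insert i C) + b i = f (insert j C) + b j"
      by (simp only: add_self add_eq_0_char2)
    then show "g (insert i C) = g (insert j C)"
      using C fC by (simp add: g_def add.assoc[symmetric])
  qed
  obtain A0 where A0: "A0 \<subseteq> V" "card A0 = Suc r"
    using card obtain_subset_with_card_n[of "Suc r" V] by auto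
  have "f = affine V (Suc r) b (g A0)"
  proof (rule uniform_eqI[OF f affine_uniform])
    fix B assume B: "B \<subseteq> V" "card B = Suc r"
    have "g B = g A0" using B \<open>flat V (Suc r) g\<close> A0 unfolding flat_def by blast
    have "f B = sum b B + g B"
      by (simp only: g_def add.left_commute[of "sum b B" "f B"] add_self add_0_right)
    then show "f B = affine V (Suc r) b (g A0) B"
      using B \<open>g B = g A0\<close> by (simp add: affine_def)
  qed
  then show ?thesis by (rule that)
qed

section \<open>Degrees two and three: the map d_2 and generators of the cycles\<close>

lemma cycles_down_3:
  fixes f :: "'b set \<Rightarrow> 'a"
  assumes "f \<in> cycles V 3" "finite V"
  shows "down V 3 f {} = 0"
proof -
  have "(\<Sum>B | B \<subseteq> V \<and> card B = 2. down V 1 f B) = 0"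
    using assms(1) unfolding cycles_def by (intro sum.neutral) blast
  \<comment> \<open>Applying d_2 to d_1 f gives 3 times d_3 f, and 3 is odd.\<close>
  then have "of_nat ((2 + 1) choose 2) * down V (2 + 1) f {} = 0"
    using sum_down[OF assms(2), of 1 f 2] by (simp only:)
  moreover have "(2 + 1) choose 2 = (3 :: nat)" by (simp add: choose_two)
  moreover have "of_nat 3 = (1 :: 'a)" using of_nat_char2[of 3] by simp
  ultimately show ?thesis by (simp only: mult_1_left) simp
qed

text \<open>For r \<le> 3 the map d_2 is the only one left to check: d_3 follows from d_1 when r =
  3, and a map of order above r is 0.\<close>

lemma primitiveI:
  fixes f :: "'b set \<Rightarrow> 'a"
  assumes "f \<in> cycles V r" "r \<le> 3" "finite V" "\<And>B. down V 2 f B = 0"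
  shows "f \<in> primitive V r"
proof -
  have u: "f \<in> uniform V r" using assms(1) by (simp add: cycles_def)
  have "down V k f B = 0" if "k > 0" for k B
  proof -
    have "k = 1 \<or> k = 2 \<or> r < k \<or> k = 3 \<and> r = 3" using that assms(2) by arith
    then consider "k = 1" | "k = 2" | "r < k" | "k = 3" "r = 3" by blast
    then show ?thesis
    proof cases
      case 1
      then show ?thesis using assms(1) by (simp add: cycles_def)
    next
      case 2
      then show ?thesis using assms(4) by simp
    next
      case 3
      then show ?thesis by (rule down_large[OF u assms(3)])
    next
      case 4
      show ?thesis
      proof (cases "B \<subseteq> V \<and> card B = 0")
        case True
        then have "finite B" using assms(3) finite_subset[of B V] by simp
        then have "B = {}" using True by simp
        then show ?thesis using cycles_down_3[of f V] assms(1,3) 4 by simp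
      next
        case False
        then show ?thesis using u 4 assms(3) by (intro down_eq_0[of _ _ 0]) simp_all
      qed
    qed
  qed
  then show ?thesis using u by (simp add: primitive_def)
qed

lemma cycles_1_primitive:
  assumes "finite V"
  shows "cycles V 1 \<subseteq> (primitive V 1 :: ('b set \<Rightarrow> 'a) set)"
proof
  fix f :: "'b set \<Rightarrow> 'a" assume f: "f \<in> cycles V 1"
  then have "f \<in> uniform V 1" by (simp only: cycles_def mem_Collect_eq)
  then have "down V 2 f B = 0" for B by (rule down_large[OF _ assms]) simp
  then show "f \<in> primitive V 1" using f assms by (intro primitiveI) simp_all
qed

lemma down_layer_3:
  assumes "A \<subseteq> V" "card A = 3" "finite V"
  shows "down V 2 (layer A 2 :: 'b set \<Rightarrow> 'a) = layer A 0"
proof -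
  have "of_nat (3 choose 2) = (1 :: 'a)"
    using of_nat_char2[of "3 choose 2"] by (simp add: choose_two)
  then show ?thesis
    using down_layer[OF assms(1,3), of 2 0, where 'a = 'a] assms(2)
    by (simp only: add_0 diff_zero fun_vs.scale_one)
qed

text \<open>On cycles of degree 2 the map d_2 takes values in the constants, with kernel
  \<open>primitive V 2\<close>. So the quotient has dimension at most 1, and the boundary of a
  triangle, where d_2 gives 3 = 1, represents it.\<close>

lemma cycles_2_subset:
  fixes U :: "('b set \<Rightarrow> 'a) set"
  assumes inv: "invariant V U" and fin: "finite V" and prim: "primitive V 2 \<subseteq> U"
    and f: "f \<in> U" "f \<in> cycles V 2" "f \<notin> primitive V 2" and "3 \<le> card V"
  shows "cycles V 2 \<subseteq> U"
proof -
  have sub: "fun_vs.subspace U" using inv by (simp add: invariant_def)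
  note csub = subspace_cycles[of V 2, where 'a = 'a]
  have u: "f \<in> uniform V (0 + 2)" using f(2) by (simp only: cycles_def mem_Collect_eq add_0)
  obtain A where A: "A \<subseteq> V" "card A = 3" using assms(7) by (meson obtain_subset_with_card_n)
  let ?c = "down V 2 f {}"
  let ?P = "layer A 2 :: 'b set \<Rightarrow> 'a"
  have P: "?P \<in> cycles V 2" using A fin by (intro layer_cycles) simp_all
  have dP: "down V 2 ?P = layer A 0" using A fin by (intro down_layer_3)
  have "down V 2 (f + fscale ?c ?P) B = 0" for B
  proof (cases "B = {}")
    case True
    then show ?thesis
      by (simp add: down_add down_scale dP layer_def add_self)
  next
    case False
    have "\<not> (B \<subseteq> V \<and> card B = 0)" using False fin finite_subset[of B V] by auto
    then have "down V 2 f B = 0" by (rule down_eq_0[OF u fin])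
    moreover have "layer A 0 B = (0 :: 'a)"
      using False finite_subset[OF A(1) fin] finite_subset[of B A] by (auto simp: layer_def)
    ultimately show ?thesis by (simp add: down_add down_scale dP)
  qed
  then have "f + fscale ?c ?P \<in> primitive V 2"
    using fin f(2) P by (intro primitiveI fun_vs.subspace_add[OF csub] fun_vs.subspace_scale[OF csub]) simp_all
  then have "f + fscale ?c ?P \<in> U" using prim by blast
  then have "f + (f + fscale ?c ?P) \<in> U" by (rule fun_vs.subspace_add[OF sub f(1)])
  then have "fscale ?c ?P \<in> U" by (simp only: add_self_assoc_fun)
  moreover have "?c \<noteq> 0"
  proof
    assume "?c = 0"
    have "down V 2 f B = 0" for B
    proof (cases "B = {}")
      case False
      then have "\<not> (B \<subseteq> V \<and> card B = 0)" using fin finite_subset[of B V] by auto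
      then show ?thesis by (rule down_eq_0[OF u fin])
    qed (use \<open>?c = 0\<close> in simp)
    then show False using primitiveI[OF f(2) _ fin] f(3) by simp
  qed
  ultimately have "?P \<in> U" by (rule subspace_scale_cancel[OF sub, rotated])
  then show ?thesis using A by (intro cycles_generated[OF inv fin A(1)]) simp_all
qed

text \<open>An r-subset of Z lies in exactly two of the sets Z - {z}.\<close>

lemma sum_layers_eq_0:
  assumes "finite Z" "card Z = Suc (Suc r)"
  shows "(\<Sum>z\<in>Z. layer (Z - {z}) r) = (0 :: 'b set \<Rightarrow> 'a)"
proof
  fix B
  show "(\<Sum>z\<in>Z. layer (Z - {z}) r) B = (0 :: 'b set \<Rightarrow> 'a) B"
  proof (cases "B \<subseteq> Z \<and> card B = r")
    case True
    have "(\<Sum>z\<in>Z. layer (Z - {z}) r) B = (\<Sum>z\<in>Z. if z \<notin> B then 1 else 0 :: 'a)"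
      unfolding sum_fun_apply using True by (intro sum.cong) (auto simp: layer_def)
    also have "\<dots> = (\<Sum>z\<in>{z \<in> Z. z \<notin> B}. 1)"
      using assms(1) by (rule sum.inter_filter[symmetric])
    also have "{z \<in> Z. z \<notin> B} = Z - B" by blast
    also have "card (Z - B) = 2"
      using True assms finite_subset[of B Z] by (subst card_Diff_subset) auto
    then have "(\<Sum>z\<in>Z - B. 1) = (0 :: 'a)" by (simp add: two_eq_0)
    finally show ?thesis by simp
  next
    case False
    then have "layer (Z - {z}) r B = (0 :: 'a)" for z by (auto simp: layer_def)
    then show ?thesis by (simp add: sum_fun_apply)
  qed
qed

text \<open>
  Once \<open>U\<close> contains one difference of two generators, it contains all of them; the relation
  between the five generators inside a 5-set then yields a generator itself.
\<close>

lemma cycles_3_generated: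
  fixes U :: "('b set \<Rightarrow> 'a) set"
  assumes inv: "invariant V U" and fin: "finite V" and "5 \<le> card V"
    and ij: "i \<in> V" "j \<in> V" "i \<noteq> j" and A: "A \<subseteq> V - {i, j}" "card A = 3"
    and in_U: "layer (insert i A) 3 + layer (insert j A) 3 \<in> U"
  shows "cycles V 3 \<subseteq> U"
proof -
  have sub: "fun_vs.subspace U" using inv by (simp add: invariant_def)
  have fin_sub: "finite X" if "X \<subseteq> V" for X using that fin by (rule finite_subset)
  have all: "layer (insert a C) 3 + layer (insert b C) 3 \<in> U"
    if ab: "a \<in> V" "b \<in> V" "a \<noteq> b" and C: "C \<subseteq> V - {a, b}" "card C = 3" for a b C
  proof -
    have "A \<subseteq> V" "C \<subseteq> V" using A C by blast+
    then obtain xs ys where xs: "set xs = A" "distinct xs" and ys: "set ys = C" "distinct ys"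
      using finite_distinct_list[OF fin_sub] by metis
    have "length xs = 3" "length ys = 3" using xs ys A(2) C(2) by (metis distinct_card)+
    then have len: "length (a # b # ys) = length (i # j # xs)" by simp
    have "distinct (a # b # ys)" "distinct (i # j # xs)" using xs ys ab ij A C by auto
    moreover have "set (a # b # ys) \<subseteq> V" "set (i # j # xs) \<subseteq> V"
      using xs(1) ys(1) ab ij \<open>A \<subseteq> V\<close> \<open>C \<subseteq> V\<close> by simp_all
    ultimately obtain \<sigma> where \<sigma>: "\<sigma> permutes V" "map \<sigma> (a # b # ys) = i # j # xs"
      using permutes_map_list[OF fin _ _ len] by metis
    then have \<sigma>': "\<sigma> a = i" "\<sigma> b = j" "\<sigma> ` C = A"
      unfolding xs(1)[symmetric] ys(1)[symmetric] by (simp_all flip: set_map)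
    have "(\<lambda>B. (layer (insert i A) 3 + layer (insert j A) 3) (\<sigma> ` B)) \<in> U"
      using inv in_U \<sigma>(1) unfolding invariant_def by blast
    moreover have "layer (insert i A) 3 (\<sigma> ` B) = (layer (insert a C) 3 B :: 'a)"
      "layer (insert j A) 3 (\<sigma> ` B) = (layer (insert b C) 3 B :: 'a)" for B
      using layer_image[OF \<sigma>(1), of "insert a C" 3 B, where 'b = 'a]
        layer_image[OF \<sigma>(1), of "insert b C" 3 B, where 'b = 'a] \<sigma>' by simp_all
    ultimately show ?thesis by (simp add: plus_fun_def)
  qed
  obtain Z where Z: "Z \<subseteq> V" "card Z = 5" using assms(3) by (meson obtain_subset_with_card_n)
  have fZ: "finite Z" using Z(1) by (rule fin_sub)
  have "Z \<noteq> {}" using Z(2) by auto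
  then obtain z0 where z0: "z0 \<in> Z" by blast
  let ?P = "layer (Z - {z0}) 3 :: 'b set \<Rightarrow> 'a"
  have cz: "Z - {z} \<subseteq> V" "card (Z - {z}) = 4" if "z \<in> Z" for z using that Z fZ by auto
  \<comment> \<open>Exchanging one letter at a time, the differences telescope.\<close>
  have diff: "?P + layer X 3 \<in> U" if X: "X \<subseteq> V" "card X = 4" for X
  proof -
    have "card (Z - {z0}) = card X" using cz(2)[OF z0] X(2) by (simp only:)
    moreover have "?P + ?P \<in> U" by (simp only: add_self_fun fun_vs.subspace_0[OF sub])
    ultimately show ?thesis
    proof (induction rule: exchange_induct[OF fin cz(1)[OF z0] X(1), where P = "\<lambda>X. ?P + layer X 3 \<in> U", consumes 2, case_names exchange])
      case (exchange C a b)
      then have "layer (insert a C) 3 + layer (insert b C) 3 \<in> U" using X(2) by (intro all) auto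
      then have "(?P + layer (insert a C) 3) + (layer (insert a C) 3 + layer (insert b C) 3) \<in> U"
        by (rule fun_vs.subspace_add[OF sub exchange(6)])
      then show ?case by (simp only: add.assoc add_self_assoc_fun)
    qed
  qed
  \<comment> \<open>The relation removes the second summands, and five copies of ?P add up to ?P
    because 5 is odd.\<close>
  have "(\<Sum>z\<in>Z. ?P + layer (Z - {z}) 3) \<in> U"
    using cz by (intro fun_vs.subspace_sum[OF sub] diff) simp_all
  moreover have "(\<Sum>z\<in>Z. ?P + layer (Z - {z}) 3) = (\<Sum>z\<in>Z. ?P) + 0"
    unfolding sum.distrib using sum_layers_eq_0[of Z 3] fZ Z(2) by simp
  moreover have "(\<Sum>z\<in>Z. ?P) = ?P"
  proof
    fix B
    have "of_nat 5 = (1 :: 'a)" using of_nat_char2[of 5] by simp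
    then show "(\<Sum>z\<in>Z. ?P) B = ?P B" using Z(2) by (simp add: sum_fun_apply)
  qed
  ultimately have "?P \<in> U" by simp
  then show ?thesis
    using cycles_generated[OF inv fin cz(1)[OF z0], of 3] cz(2)[OF z0] by simp
qed

text \<open>Here g = d_2 f is a function on letters. For odd card V it is not a nonzero constant, so
  some g i and g j differ, and then d_2 maps f + (i j) f to a nonzero multiple of x_i + x_j. The
  product of x_i + x_j with e_2 of three other letters has d_2 equal to x_i + x_j, so modulo
  \<open>primitive V 3\<close> it lies in U; it is a difference of two generators.\<close>

lemma cycles_3_subset:
  fixes U :: "('b set \<Rightarrow> 'a) set"
  assumes inv: "invariant V U" and fin: "finite V" and prim: "primitive V 3 \<subseteq> U"
    and f: "f \<in> U" "U \<subseteq> cycles V 3" "f \<notin> primitive V 3" and V: "5 \<le> card V" "odd (card V)"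
  shows "cycles V 3 \<subseteq> U"
proof -
  have sub: "fun_vs.subspace U" using inv by (simp add: invariant_def)
  note csub = subspace_cycles[of V 3, where 'a = 'a]
  have fc: "f \<in> cycles V 3" using f by blast
  have "(1 + 2 :: nat) = 3" by simp
  then have fu: "f \<in> uniform V (1 + 2)" using fc by (simp only: cycles_def mem_Collect_eq)
  define g where "g = down V 2 f"
  have gu: "g \<in> uniform V (Suc 0)" unfolding g_def using down_uniform[OF fu fin] by simp
  have "\<exists>i\<in>V. \<exists>j\<in>V. g {i} \<noteq> g {j}"
  proof (rule ccontr)
    assume *: "\<not> (\<exists>i\<in>V. \<exists>j\<in>V. g {i} \<noteq> g {j})"
    have "flat V 1 g"
      unfolding flat_def
    proof (intro allI impI)
      fix A B assume "A \<subseteq> V" "card A = 1" "B \<subseteq> V" "card B = 1"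
      then show "g A = g B" using * by (auto simp: card_1_singleton_iff)
    qed
    \<comment> \<open>d_1 g is 3 times d_3 f, which vanishes on cycles; for odd card V a constant g
      with sum 0 is then 0.\<close>
    moreover have "down V 1 g {} = 0"
    proof -
      have "down V 1 g {} = (\<Sum>B | B \<subseteq> V \<and> card B = 1. g B)" by (simp add: down_def)
      also have "\<dots> = of_nat ((1 + 2) choose 1) * down V (1 + 2) f {}"
        unfolding g_def using fin by (rule sum_down)
      also have "\<dots> = 0" by (simp only: \<open>1 + 2 = 3\<close> cycles_down_3[OF fc fin] mult_zero_right)
      finally show ?thesis .
    qed
    ultimately have "g = 0" using gu fin V(2) by (intro flat_eq_0[of V 1]) simp_all
    then show False using primitiveI[OF fc _ fin] f(3) by (simp add: g_def)
  qed
  then obtain i j where ij: "i \<in> V" "j \<in> V" "i \<noteq> j" "g {i} \<noteq> g {j}" by metis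
  let ?c = "g {i} + g {j}"
  have "card (V - {i, j}) \<ge> 3" using V(1) diff_card_le_card_Diff[of "{i, j}" V] ij(3) by simp
  then obtain A where A: "A \<subseteq> V - {i, j}" "card A = 3" by (meson obtain_subset_with_card_n)
  have AV: "A \<subseteq> V" using A(1) by blast
  then have fA: "finite A" using fin by (rule finite_subset)
  have nA: "i \<notin> A" "j \<notin> A" using A(1) by auto
  let ?h = "spread i j (link i j f)"
  let ?q = "spread i j (layer A 2) :: 'b set \<Rightarrow> 'a"
  have hU: "?h \<in> U" using ij by (intro invariant_swap[OF inv f(1)])
  have q: "?q = layer (insert i A) 3 + layer (insert j A) 3"
    using layer_insert_add[OF nA ij(3) fA, of 2] by simp
  have "?q \<in> cycles V 3"
    unfolding q using AV ij nA A(2) fA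
    by (intro fun_vs.subspace_add[OF csub] layer_cycles[OF _ fin]) simp_all
  have dh: "down V 2 ?h = spread i j (link i j g)"
  proof -
    have "transpose i j permutes V" using ij by (simp add: permutes_swap_id)
    then have "down V 2 (\<lambda>A. f (transpose i j ` A)) = (\<lambda>A. g (transpose i j ` A))"
      unfolding g_def by (intro ext down_image)
    moreover have "down V 2 (f + f') = down V 2 f + down V 2 f'" for f' :: "'b set \<Rightarrow> 'a"
      by (rule ext) (simp add: down_add)
    ultimately show ?thesis
      unfolding swap_add[OF ij(3), symmetric] by (simp add: g_def)
  qed
  have "link i j g \<in> uniform (V - {i, j}) 0" using link_uniform[OF gu ij(1,2) fin] .
  moreover have "link i j g {} = ?c" by (simp add: link_def)
  ultimately have lg: "link i j g = fscale ?c (layer {} 0)"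
    using uniform_0_eq[of "link i j g" "V - {i, j}"] fin by simp
  have dq: "down V 2 ?q = spread i j (layer {} 0)"
  proof -
    have "layer A 2 \<in> (uniform (V - {i, j}) 2 :: ('b set \<Rightarrow> 'a) set)" using A(1) by (rule layer_uniform)
    then have "down V 2 ?q = spread i j (down V 2 (layer A 2))"
      using ij fin by (intro down_spread)
    also have "down V 2 (layer A 2 :: 'b set \<Rightarrow> 'a) = layer A 0"
      using AV A(2) fin by (intro down_layer_3)
    also have "\<dots> = layer {} 0" using fA by (rule layer_0)
    finally show ?thesis .
  qed
  have "down V 2 (?h + fscale ?c ?q) B = 0" for B
    unfolding down_add down_scale dh dq lg spread_scale by (simp add: fscale_def add_self)
  moreover have "?h + fscale ?c ?q \<in> cycles V 3"
    using hU f(2) \<open>?q \<in> cycles V 3\<close>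
    by (intro fun_vs.subspace_add[OF csub] fun_vs.subspace_scale[OF csub]) auto
  ultimately have "?h + fscale ?c ?q \<in> U" using primitiveI[OF _ _ fin] prim by blast
  then have "?h + (?h + fscale ?c ?q) \<in> U" by (rule fun_vs.subspace_add[OF sub hU])
  then have "fscale ?c ?q \<in> U" by (simp only: add_self_assoc_fun)
  moreover have "?c \<noteq> 0" using ij(4) by (simp add: add_eq_0_char2)
  ultimately have "?q \<in> U" by (rule subspace_scale_cancel[OF sub, rotated])
  then show ?thesis using cycles_3_generated[OF inv fin V(1) ij(1-3) A] q by simp
qed

section \<open>Affine functions among the cycles and the primitive functions\<close>

lemma affine_cycles_eq:
  fixes b :: "'b \<Rightarrow> 'a"
  assumes "affine V (Suc r) b c \<in> cycles V (Suc r)" "finite V" "r < card V" "odd (card V - r)"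
  shows "affine V (Suc r) b c = trace_affine V (Suc r) b"
proof -
  obtain B where B: "B \<subseteq> V" "card B = r" using assms(3) by (meson obtain_subset_with_card_n less_imp_le)
  have "sum b (V - B) + of_nat (card V - r) * (sum b B + c) = 0"
    using assms(1) down_1_affine[OF assms(2) B, of b c] by (simp add: cycles_def)
  then have "sum b (V - B) + sum b B + c = 0"
    using assms(4) of_nat_char2[of "card V - r"] by (simp add: add.assoc)
  moreover have "sum b (V - B) + sum b B = sum b V"
    using B assms(2) by (simp add: sum.subset_diff[of B V])
  ultimately have "sum b V = c" by (simp add: add_eq_0_char2)
  then show ?thesis by (simp add: trace_affine_def)
qed

text \<open>For odd card V - r the value at an r-set B is sum b (V - B) + sum b B + sum b V, in
  which every weight occurs twice.\<close>

lemma trace_affine_cycles: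
  fixes b :: "'b \<Rightarrow> 'a"
  assumes "finite V" "odd (card V - r)"
  shows "trace_affine V (Suc r) b \<in> cycles V (Suc r)"
proof -
  have u: "trace_affine V (Suc r) b \<in> uniform V (Suc r)"
    unfolding trace_affine_def by (rule affine_uniform)
  have "down V 1 (trace_affine V (Suc r) b) B = 0" for B
  proof (cases "B \<subseteq> V \<and> card B = r")
    case True
    have "sum b V = sum b (V - B) + sum b B" using True assms(1) by (intro sum.subset_diff) auto
    moreover have "down V 1 (trace_affine V (Suc r) b) B = sum b (V - B) + (sum b B + sum b V)"
      using True assms of_nat_char2[of "card V - r"]
      unfolding trace_affine_def by (simp only: down_1_affine if_False mult_1_left)
    ultimately have "down V 1 (trace_affine V (Suc r) b) B =
        (sum b (V - B) + sum b B) + (sum b (V - B) + sum b B)" by (simp only: add.assoc)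
    then show ?thesis by (simp only: add_self)
  next
    case False
    have "trace_affine V (Suc r) b \<in> uniform V (r + 1)" using u by simp
    then show ?thesis using assms(1) False by (rule down_eq_0)
  qed
  then show ?thesis using u unfolding cycles_def by blast
qed

text \<open>If m = card V - r is 2 mod 4, both m - 1 and (m choose 2) are odd, so under d_2 again
  every weight occurs twice. The values r = 0 and r = 1 serve degrees 2 and 3.\<close>

lemma trace_affine_primitive:
  fixes b :: "'b \<Rightarrow> 'a"
  assumes "finite V" "r \<le> 1" "(card V - r) mod 4 = 2"
  shows "trace_affine V (r + 2) b \<in> primitive V (r + 2)"
proof (rule primitiveI)
  let ?m = "card V - r"
  obtain q where q: "?m = 4 * q + 2" using assms(3) by (metis mult_div_mod_eq)
  then have "card V - Suc r = 4 * q + 1" by simp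
  then have odd: "odd (card V - Suc r)" by simp
  show "trace_affine V (r + 2) b \<in> cycles V (r + 2)"
    using trace_affine_cycles[OF assms(1) odd, of b] by simp
  show "r + 2 \<le> 3" using assms(2) by simp
  show "finite V" by fact
  fix B
  show "down V 2 (trace_affine V (r + 2) b) B = 0"
  proof (cases "B \<subseteq> V \<and> card B = r")
    case True
    have "?m choose 2 = (2 * q + 1) * (4 * q + 1)"
      unfolding q choose_two by (simp add: algebra_simps)
    then have "of_nat (?m choose 2) = (1 :: 'a)" "of_nat (?m - 1) = (1 :: 'a)"
      using of_nat_char2[of "?m choose 2"] of_nat_char2[of "?m - 1"] q by simp_all
    moreover have "down V 2 (trace_affine V (r + 2) b) B =
        of_nat (?m - 1) * sum b (V - B) + of_nat (?m choose 2) * (sum b B + sum b V)"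
      using down_2_affine[OF assms(1), of B r b "sum b V"] True by (simp add: trace_affine_def)
    ultimately have "down V 2 (trace_affine V (r + 2) b) B = sum b (V - B) + (sum b B + sum b V)"
      by (simp only: mult_1_left)
    moreover have "sum b V = sum b (V - B) + sum b B" using True assms(1) by (intro sum.subset_diff) auto
    ultimately have "down V 2 (trace_affine V (r + 2) b) B =
        (sum b (V - B) + sum b B) + (sum b (V - B) + sum b B)" by (simp only: add.assoc)
    then show ?thesis by (simp only: add_self)
  next
    case False
    have "trace_affine V (r + 2) b \<in> uniform V (r + 2)"
      unfolding trace_affine_def by (rule affine_uniform)
    then show ?thesis using assms(1) False by (rule down_eq_0)
  qed
qed

lemma vanishing_trace_affine:
  fixes f :: "'b set \<Rightarrow> 'a"
  assumes "f \<in> vanishing V (Suc r)" "finite V" "r + 3 \<le> card V" "odd (card V - r)"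
    and "\<And>i j. i \<in> V \<Longrightarrow> j \<in> V \<Longrightarrow> i \<noteq> j \<Longrightarrow> flat (V - {i, j}) r (link i j f)"
  obtains b where "f = trace_affine V (Suc r) b"
proof -
  have c: "f \<in> cycles V (Suc r)" using assms(1) unfolding vanishing_def by blast
  then have "f \<in> uniform V (Suc r)" unfolding cycles_def by blast
  then obtain b d where f: "f = affine V (Suc r) b d"
    using flat_links_affine[OF assms(2,3)] assms(5) by metis
  then have "f = trace_affine V (Suc r) b"
    using affine_cycles_eq[of V r b d] c assms(2-4) by simp
  then show ?thesis by (rule that)
qed

text \<open>
  \<open>f + (i j) f\<close> is the trace-affine function of \<open>b i + b j\<close> times the indicator of \<open>{i, j}\<close>,
  and these indicators span the weights of trace \<open>0\<close>.
\<close>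

lemma trace_affine_subset:
  fixes U :: "('b set \<Rightarrow> 'a) set"
  assumes inv: "invariant V U" and fin: "finite V"
    and f: "trace_affine V r b \<in> U" "trace_affine V r b \<noteq> 0" and even: "even (card V + r)"
    and b': "sum b' V = 0"
  shows "trace_affine V r b' \<in> U"
proof -
  have sub: "fun_vs.subspace U" using inv by (simp add: invariant_def)
  define \<chi> where "\<chi> i j k = (if k = i \<or> k = j then 1 else 0 :: 'a)" for i j k :: 'b
  \<comment> \<open>A constant weight c yields (card V + r) * c at every r-set, which is 0 by the
    parity assumption.\<close>
  have "\<exists>i\<in>V. \<exists>j\<in>V. b i \<noteq> b j"
  proof (rule ccontr)
    assume *: "\<not> (\<exists>i\<in>V. \<exists>j\<in>V. b i \<noteq> b j)"
    then obtain c where c: "\<And>k. k \<in> V \<Longrightarrow> b k = c" by metis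
    have sc: "sum b A = of_nat (card A) * c" if "A \<subseteq> V" for A
    proof -
      have "sum b A = (\<Sum>k\<in>A. c)" using that c by (intro sum.cong) blast+
      then show ?thesis by simp
    qed
    have "trace_affine V r b A = 0" for A
    proof (cases "A \<subseteq> V \<and> card A = r")
      case True
      then have "trace_affine V r b A = of_nat (card V + r) * c"
        by (simp add: trace_affine_def affine_def sc distrib_right add.commute)
      then show ?thesis using even of_nat_char2[of "card V + r"] by simp
    next
      case False
      then show ?thesis unfolding trace_affine_def affine_def by (rule if_not_P)
    qed
    then show False using f(2) by (simp add: fun_eq_iff)
  qed
  then obtain i j where ij: "i \<in> V" "j \<in> V" "b i \<noteq> b j" by metis
  let ?\<tau> = "transpose i j"
  have \<tau>: "?\<tau> permutes V" using ij by (simp add: permutes_swap_id)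
  then have "(\<lambda>A. trace_affine V r b (?\<tau> ` A)) \<in> U" using inv f(1) by (simp add: invariant_def)
  then have "trace_affine V r (b \<circ> ?\<tau>) \<in> U" by (simp add: trace_affine_image[OF \<tau>])
  then have "trace_affine V r (b + (b \<circ> ?\<tau>)) \<in> U"
    unfolding trace_affine_add by (rule fun_vs.subspace_add[OF sub f(1)])
  moreover have "b + (b \<circ> ?\<tau>) = fscale (b i + b j) (\<chi> i j)"
    by (auto simp: fun_eq_iff fscale_def \<chi>_def transpose_def add_self add.commute)
  ultimately have "fscale (b i + b j) (trace_affine V r (\<chi> i j)) \<in> U"
    by (simp only: trace_affine_scale)
  moreover have "b i + b j \<noteq> 0" using ij by (simp add: add_eq_0_char2)
  ultimately have \<chi>ij: "trace_affine V r (\<chi> i j) \<in> U" by (rule subspace_scale_cancel[OF sub, rotated])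
  have \<chi>: "trace_affine V r (\<chi> k l) \<in> U" if kl: "k \<in> V" "l \<in> V" "k \<noteq> l" for k l
  proof -
    have "i \<noteq> j" using ij(3) by auto
    then obtain \<sigma> where \<sigma>: "\<sigma> permutes V" "map \<sigma> [k, l] = [i, j]"
      using permutes_map_list[OF fin, of "[k, l]" "[i, j]"] kl ij by auto
    have "(\<lambda>A. trace_affine V r (\<chi> i j) (\<sigma> ` A)) \<in> U"
      using inv \<chi>ij \<sigma>(1) unfolding invariant_def by blast
    moreover have "\<chi> i j \<circ> \<sigma> = \<chi> k l"
    proof
      fix x
      have "\<sigma> x = i \<longleftrightarrow> x = k" "\<sigma> x = j \<longleftrightarrow> x = l"
        using \<sigma>(2) inj_eq[OF permutes_inj[OF \<sigma>(1)]] by auto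
      then show "(\<chi> i j \<circ> \<sigma>) x = \<chi> k l x" by (simp add: \<chi>_def)
    qed
    ultimately show ?thesis by (simp add: trace_affine_image[OF \<sigma>(1)])
  qed
  let ?T = "{b :: 'b \<Rightarrow> 'a. trace_affine V r b \<in> U}"
  have subT: "fun_vs.subspace ?T"
  proof (rule fun_vs.subspaceI)
    have "trace_affine V r (0 :: 'b \<Rightarrow> 'a) = 0" by (simp add: trace_affine_def affine_def fun_eq_iff)
    then show "0 \<in> ?T" by (simp add: fun_vs.subspace_0[OF sub])
  next
    fix x y assume "x \<in> ?T" "y \<in> ?T"
    then show "x + y \<in> ?T" by (simp add: trace_affine_add fun_vs.subspace_add[OF sub])
  next
    fix c x assume "x \<in> ?T"
    then show "fscale c x \<in> ?T" by (simp add: trace_affine_scale fun_vs.subspace_scale[OF sub])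
  qed
  \<comment> \<open>The coordinates away from i can be prescribed freely; the one at i then agrees
    because b' has trace 0.\<close>
  let ?b = "\<Sum>k\<in>V - {i}. fscale (b' k) (\<chi> k i)"
  have "?b \<in> ?T"
    using \<chi> ij(1) by (intro fun_vs.subspace_sum[OF subT] fun_vs.subspace_scale[OF subT]) simp_all
  moreover have "b' k = ?b k" if k: "k \<in> V" for k
  proof (cases "k = i")
    case True
    have "?b k = (\<Sum>k\<in>V - {i}. b' k)" using True by (simp add: sum_fun_apply fscale_def \<chi>_def)
    moreover have "b' i + (\<Sum>k\<in>V - {i}. b' k) = 0" using b' fin ij(1) by (simp add: sum.remove)
    ultimately show ?thesis using True by (simp add: add_eq_0_char2)
  next
    case False
    have "?b k = (\<Sum>l\<in>V - {i}. if l = k then b' l else 0)"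
      unfolding sum_fun_apply using False by (intro sum.cong) (auto simp: fscale_def \<chi>_def)
    then show ?thesis using False k fin by simp
  qed
  then have "trace_affine V r b' = trace_affine V r ?b" by (rule trace_affine_cong)
  ultimately show ?thesis by simp
qed

lemma flat_subset:
  fixes U :: "('b set \<Rightarrow> 'a) set"
  assumes "invariant V U" "finite V" "f \<in> U" "f \<noteq> 0" "f \<in> uniform V r" "flat V r f"
    and g: "g \<in> uniform V r" "flat V r g"
  shows "g \<in> U"
proof -
  have sub: "fun_vs.subspace U" using assms(1) by (simp add: invariant_def)
  obtain A where "f A \<noteq> 0" using assms(4) by (auto simp: fun_eq_iff)
  then have A: "A \<subseteq> V" "card A = r" using assms(5) by (auto simp: uniform_def)
  have "g = fscale (g A / f A) f"
  proof (rule uniform_eqI[OF g(1) fun_vs.subspace_scale[OF subspace_uniform assms(5)]])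
    fix B assume "B \<subseteq> V" "card B = r"
    then have "g B = g A" "f B = f A" using A g(2) assms(6) unfolding flat_def by blast+
    then show "g B = fscale (g A / f A) f B" using \<open>f A \<noteq> 0\<close> by (simp add: fscale_def)
  qed
  then show ?thesis using fun_vs.subspace_scale[OF sub assms(3)] by metis
qed

section \<open>The uniserial cases\<close>

lemma vanishing_2_flat_link:
  fixes f :: "'b set \<Rightarrow> 'a"
  assumes "f \<in> vanishing V 2" "finite V" "i \<in> V" "j \<in> V" "i \<noteq> j"
  shows "flat (V - {i, j}) 1 (link i j f)"
proof (rule vanishing_1_flat)
  have "f \<in> vanishing V (Suc 1)" using assms(1) by (simp add: numeral_2_eq_2)
  then show "link i j f \<in> vanishing (V - {i, j}) 1"
    using assms(3,4,5,2) by (rule vanishing_link)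
  show "finite (V - {i, j})" using assms(2) by simp
qed

lemma vanishing_3_flat_link:
  fixes f :: "'b set \<Rightarrow> 'a"
  assumes "f \<in> vanishing V 3" "finite V" "odd (card V)" "i \<in> V" "j \<in> V" "i \<noteq> j"
  shows "flat (V - {i, j}) 2 (link i j f)"
proof (rule vanishing_2_flat)
  have "f \<in> vanishing V (Suc 2)" using assms(1) by (simp add: eval_nat_numeral)
  then show "link i j f \<in> vanishing (V - {i, j}) 2"
    using assms(4,5,6,2) by (rule vanishing_link)
  show "finite (V - {i, j})" using assms(2) by simp
  have "card {i, j} = 2" using assms(6) by simp
  moreover have "card {i, j} \<le> card V" using assms by (intro card_mono) auto
  moreover have "card (V - {i, j}) = card V - card {i, j}" using assms by (intro card_Diff_subset) auto
  ultimately have "card V = card (V - {i, j}) + 2" by simp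
  then show "odd (card (V - {i, j}))" using assms(3) by simp
qed

text \<open>James's submodule theorem in this setting: a single element of U outside
  \<open>vanishing\<close> forces the whole of \<open>primitive\<close> into U.\<close>

lemma vanishing_or_primitive:
  fixes U :: "('b set \<Rightarrow> 'a) set"
  assumes "invariant V U" "U \<subseteq> cycles V r" "finite V"
  shows "U \<subseteq> vanishing V r \<or> primitive V r \<subseteq> U"
  using primitive_subset[OF assms(1,3)] assms(2) by blast

lemma vanishing_uniform: "f \<in> vanishing V r \<Longrightarrow> f \<in> uniform V r"
  unfolding vanishing_def cycles_def by blast

text \<open>The first step of a chain that begins with constants: these form at most a line, and a
  submodule not contained in it contains \<open>primitive\<close>, hence that line.\<close>

lemma vanishing_flat_subset:
  fixes U :: "('b set \<Rightarrow> 'a) set"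
  assumes "invariant V U" "U \<subseteq> cycles V r" "finite V"
    and "\<And>g. g \<in> vanishing V r \<Longrightarrow> flat V r (g :: 'b set \<Rightarrow> 'a)"
    and "vanishing V r \<subseteq> (primitive V r :: ('b set \<Rightarrow> 'a) set)"
  shows "U \<subseteq> {0} \<or> vanishing V r \<subseteq> U"
proof (cases "U \<subseteq> vanishing V r")
  case True
  show ?thesis
  proof (rule disjCI)
    assume "\<not> vanishing V r \<subseteq> U"
    then obtain g where g: "g \<in> vanishing V r" "g \<notin> U" by blast
    show "U \<subseteq> {0}"
    proof (rule subsetI, rule ccontr)
      fix f assume f: "f \<in> U" "f \<notin> {0}"
      then have "f \<in> vanishing V r" using True by blast
      then have "g \<in> U"
        using flat_subset[OF assms(1,3) f(1) _ vanishing_uniform assms(4) vanishing_uniform assms(4)]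
          f(2) g(1) by blast
      then show False using g(2) by blast
    qed
  qed
next
  case False
  then show ?thesis using vanishing_or_primitive[OF assms(1-3)] assms(5) by blast
qed

lemma uniserial_0:
  fixes V :: "'b set"
  assumes "finite V"
  shows "uniserial_on V (cycles V 0 :: ('b set \<Rightarrow> 'a) set)"
proof (rule uniserial_on_chain[where Xs = "[cycles V 0]"])
  have flat: "flat V 0 (f :: 'b set \<Rightarrow> 'a)" for f
    unfolding flat_def using assms finite_subset[of _ V] by (metis card_0_eq)
  have "U \<subseteq> {0} \<or> cycles V 0 \<subseteq> U"
    if U: "invariant V U" "U \<subseteq> cycles V 0" for U :: "('b set \<Rightarrow> 'a) set"
  proof (rule disjCI)
    assume "\<not> cycles V 0 \<subseteq> U"
    then obtain g where g: "g \<in> cycles V 0" "g \<notin> U" by blast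
    show "U \<subseteq> {0}"
    proof (rule subsetI, rule ccontr)
      fix f assume f: "f \<in> U" "f \<notin> {0}"
      then have "f \<in> uniform V 0" "g \<in> uniform V 0" using U(2) g(1) unfolding cycles_def by blast+
      then have "g \<in> U" using flat_subset[OF U(1) assms f(1)] f(2) flat by blast
      then show False using g(2) by blast
    qed
  qed
  then show "successively (chain_step V (cycles V 0))
      [{0}, cycles V 0 :: ('b set \<Rightarrow> 'a) set]"
    by (simp only: successively.simps chain_step_def) blast
qed simp

text \<open>In degree 1 all cycles are primitive, so the dichotomy settles the case. The middle
  member consists of the constants with sum 0; for odd card V it is 0.\<close>

lemma uniserial_1:
  fixes V :: "'b set"
  assumes "finite V"
  shows "uniserial_on V (cycles V 1 :: ('b set \<Rightarrow> 'a) set)"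
proof (rule uniserial_on_chain[where Xs = "[vanishing V 1, cycles V 1]"])
  note prim = cycles_1_primitive[OF assms]
  have "vanishing V 1 \<subseteq> (primitive V 1 :: ('b set \<Rightarrow> 'a) set)"
    using prim unfolding vanishing_def by blast
  then have "U \<subseteq> {0} \<or> vanishing V 1 \<subseteq> U"
    if "invariant V U" "U \<subseteq> cycles V 1" for U :: "('b set \<Rightarrow> 'a) set"
    using vanishing_flat_subset[OF that assms] vanishing_1_flat[OF _ assms] by blast
  moreover have "U \<subseteq> vanishing V 1 \<or> cycles V 1 \<subseteq> U"
    if "invariant V U" "U \<subseteq> cycles V 1" for U :: "('b set \<Rightarrow> 'a) set"
    using vanishing_or_primitive[OF that assms] prim by blast
  ultimately show "successively (chain_step V (cycles V 1))
      [{0}, vanishing V 1, cycles V 1 :: ('b set \<Rightarrow> 'a) set]"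
    by (simp only: successively.simps chain_step_def) blast
qed simp

lemma primitive_or_cycles_2:
  fixes U :: "('b set \<Rightarrow> 'a) set"
  assumes U: "invariant V U" "U \<subseteq> cycles V 2" and fin: "finite V" and "3 \<le> card V"
    and "vanishing V 2 \<subseteq> (primitive V 2 :: ('b set \<Rightarrow> 'a) set)"
  shows "U \<subseteq> primitive V 2 \<or> cycles V 2 \<subseteq> U"
proof (cases "U \<subseteq> primitive V 2")
  case False
  then obtain f where f: "f \<in> U" "f \<notin> primitive V 2" by blast
  then have "primitive V 2 \<subseteq> U" using vanishing_or_primitive[OF U fin] assms(5) by blast
  then have "cycles V 2 \<subseteq> U" using f U(2) assms(4) by (intro cycles_2_subset[OF U(1) fin]) auto
  then show ?thesis ..
qed simp

text \<open>For odd card V \<open>vanishing\<close> consists of constants. For card V = 4q + 1 the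
  number (card V choose 2) is even, so d_2 annihilates them and \<open>vanishing\<close> lies below
  \<open>primitive\<close>; at 3 mod 4 this binomial is odd.\<close>

lemma uniserial_2_odd:
  fixes V :: "'b set"
  assumes fin: "finite V" and V: "card V mod 4 = 1" "3 \<le> card V"
  shows "uniserial_on V (cycles V 2 :: ('b set \<Rightarrow> 'a) set)"
proof (rule uniserial_on_chain[where Xs = "[vanishing V 2, primitive V 2, cycles V 2]"])
  obtain q where q: "card V = 4 * q + 1" using V(1) by (metis mult_div_mod_eq)
  then have odd: "odd (card V)" by simp
  have "card V choose 2 = 2 * (q * (4 * q + 1))" unfolding q choose_two by simp
  then have even: "of_nat (card V choose 2) = (0 :: 'a)"
    using of_nat_char2[of "card V choose 2"] by simp
  have flat: "flat V 2 f" if "f \<in> vanishing V 2" for f :: "'b set \<Rightarrow> 'a"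
    using that fin odd by (rule vanishing_2_flat)
  have vp: "vanishing V 2 \<subseteq> (primitive V 2 :: ('b set \<Rightarrow> 'a) set)"
  proof
    fix f :: "'b set \<Rightarrow> 'a" assume f: "f \<in> vanishing V 2"
    then have u: "f \<in> uniform V (0 + 2)" using vanishing_uniform by (simp only: add_0)
    obtain A where A: "A \<subseteq> V" "card A = 2"
      using V(2) obtain_subset_with_card_n[of 2 V] by auto
    have "down V 2 f B = 0" for B
    proof (cases "B = {}")
      case True
      then show ?thesis using flat_down[OF flat[OF f] A fin] even by simp
    next
      case False
      then have "\<not> (B \<subseteq> V \<and> card B = 0)" using fin finite_subset[of B V] by auto
      then show ?thesis by (rule down_eq_0[OF u fin])
    qed
    moreover have "f \<in> cycles V 2" using f unfolding vanishing_def by blast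
    ultimately show "f \<in> primitive V 2" using fin by (intro primitiveI) simp_all
  qed
  have "U \<subseteq> {0} \<or> vanishing V 2 \<subseteq> U"
    if "invariant V U" "U \<subseteq> cycles V 2" for U :: "('b set \<Rightarrow> 'a) set"
    using vanishing_flat_subset[OF that fin flat vp] .
  moreover have "U \<subseteq> vanishing V 2 \<or> primitive V 2 \<subseteq> U"
    if "invariant V U" "U \<subseteq> cycles V 2" for U :: "('b set \<Rightarrow> 'a) set"
    using vanishing_or_primitive[OF that fin] .
  moreover have "U \<subseteq> primitive V 2 \<or> cycles V 2 \<subseteq> U"
    if "invariant V U" "U \<subseteq> cycles V 2" for U :: "('b set \<Rightarrow> 'a) set"
    using primitive_or_cycles_2[OF that fin V(2) vp] .
  ultimately show "successively (chain_step V (cycles V 2))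
      [{0}, vanishing V 2, primitive V 2, cycles V 2 :: ('b set \<Rightarrow> 'a) set]"
    by (simp only: successively.simps chain_step_def) blast
qed simp

text \<open>A submodule outside \<open>vanishing\<close> contains \<open>primitive\<close>, hence
  all trace-affine functions; inside \<open>vanishing\<close> a nonzero element is trace-affine and
  generates those of trace 0.\<close>

lemma trace_zero_subset:
  fixes U :: "('b set \<Rightarrow> 'a) set"
  assumes U: "invariant V U" "U \<subseteq> cycles V r" and fin: "finite V" and even: "even (card V + r)"
    and vt: "\<And>f. f \<in> vanishing V r \<Longrightarrow> \<exists>b. f = (trace_affine V r b :: 'b set \<Rightarrow> 'a)"
    and tp: "\<And>b. (trace_affine V r b :: 'b set \<Rightarrow> 'a) \<in> primitive V r"
  shows "U \<subseteq> {0} \<or> {trace_affine V r b | b. sum b V = 0} \<subseteq> U"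
proof (rule disjCI)
  assume *: "\<not> {trace_affine V r b | b. sum b V = 0} \<subseteq> U"
  then obtain b' where b': "sum b' V = 0" "trace_affine V r b' \<notin> U" by blast
  then have "\<not> primitive V r \<subseteq> U" using tp by blast
  then have uv: "U \<subseteq> vanishing V r" using vanishing_or_primitive[OF U fin] by blast
  show "U \<subseteq> {0}"
  proof (rule subsetI, rule ccontr)
    fix f assume f: "f \<in> U" "f \<notin> {0}"
    then obtain b where "f = trace_affine V r b" using uv vt by blast
    then show False using trace_affine_subset[OF U(1) fin _ _ even b'(1)] f b'(2) by blast
  qed
qed

text \<open>Adding a constant to b changes neither the function nor, as card V is even, the trace.
  So the functions of trace 0 form an additional member of the chain, of codimension at most 1 in
  \<open>vanishing\<close>.\<close>

lemma uniserial_2_even: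
  fixes V :: "'b set"
  assumes fin: "finite V" and V: "card V mod 4 = 2" "4 \<le> card V"
  shows "uniserial_on V (cycles V 2 :: ('b set \<Rightarrow> 'a) set)"
proof (rule uniserial_on_chain[where
      Xs = "[{trace_affine V 2 b | b. sum b V = 0}, vanishing V 2, primitive V 2, cycles V 2]"])
  let ?D = "{trace_affine V 2 b | b. sum b V = (0 :: 'a)}"
  obtain q where q: "card V = 4 * q + 2" using V(1) by (metis mult_div_mod_eq)
  then have even: "even (card V + 2)" "odd (card V - 1)" by simp_all
  have tp: "trace_affine V 2 b \<in> primitive V 2" for b :: "'b \<Rightarrow> 'a"
  proof -
    have "(card V - 0) mod 4 = 2" using V(1) by simp
    from trace_affine_primitive[OF fin le0 this, of b] show ?thesis by (simp only: add_0)
  qed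
  have vt: "\<exists>b. f = trace_affine V 2 b" if f: "f \<in> vanishing V 2" for f :: "'b set \<Rightarrow> 'a"
  proof -
    have "f \<in> vanishing V (Suc 1)" using f by (simp add: numeral_2_eq_2)
    moreover have "1 + 3 \<le> card V" using V(2) by simp
    ultimately obtain b where "f = trace_affine V (Suc 1) b"
      using vanishing_trace_affine[OF _ fin _ even(2)] vanishing_2_flat_link[OF f fin] by metis
    then show ?thesis by (auto simp: numeral_2_eq_2)
  qed
  then have vp: "vanishing V 2 \<subseteq> (primitive V 2 :: ('b set \<Rightarrow> 'a) set)" using tp by blast
  have "U \<subseteq> {0} \<or> ?D \<subseteq> U"
    if "invariant V U" "U \<subseteq> cycles V 2" for U :: "('b set \<Rightarrow> 'a) set"
    using trace_zero_subset[OF that fin even(1) vt tp] .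
  moreover have "U \<subseteq> ?D \<or> vanishing V 2 \<subseteq> U"
    if U: "invariant V U" "U \<subseteq> cycles V 2" for U :: "('b set \<Rightarrow> 'a) set"
  proof (cases "U \<subseteq> vanishing V 2")
    case False
    then show ?thesis using vanishing_or_primitive[OF U fin] vp by blast
  next
    case True
    have sub: "fun_vs.subspace U" using U(1) by (simp add: invariant_def)
    show ?thesis
    proof (cases "U \<subseteq> ?D")
      case False
      then obtain f where f: "f \<in> U" "f \<notin> ?D" by blast
      then obtain b where b: "f = trace_affine V 2 b" using True vt by blast
      then have s: "sum b V \<noteq> 0" using f(2) by blast
      have "trace_affine V 2 (\<lambda>_. 0) = (0 :: 'b set \<Rightarrow> 'a)"
        by (simp add: trace_affine_def affine_def fun_eq_iff)
      moreover have "trace_affine V 2 (\<lambda>_. 0) \<in> ?D" by (intro CollectI exI[of _ "\<lambda>_. 0"]) simp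
      ultimately have "f \<noteq> 0" using f(2) by metis
      have "vanishing V 2 \<subseteq> U"
      proof
        fix g :: "'b set \<Rightarrow> 'a" assume "g \<in> vanishing V 2"
        then obtain b' where b': "g = trace_affine V 2 b'" using vt by blast
        \<comment> \<open>The multiple of b that, added to b', makes the trace 0.\<close>
        let ?c = "sum b' V / sum b V"
        have "sum (b' + fscale ?c b) V = sum b' V + ?c * sum b V"
          by (simp add: sum.distrib fscale_def sum_distrib_left)
        also have "\<dots> = 0" using s by (simp add: add_self)
        finally have "trace_affine V 2 (b' + fscale ?c b) \<in> U"
          using trace_affine_subset[OF U(1) fin _ _ even(1)] f(1) \<open>f \<noteq> 0\<close> b by blast
        then have "g + fscale ?c f \<in> U" by (simp only: trace_affine_add trace_affine_scale b b')
        then have "fscale ?c f + (g + fscale ?c f) \<in> U"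
          by (rule fun_vs.subspace_add[OF sub fun_vs.subspace_scale[OF sub f(1)]])
        then show "g \<in> U" by (simp only: add.left_commute[of "fscale ?c f" g] add_self_fun add_0_right)
      qed
      then show ?thesis ..
    qed simp
  qed
  moreover have "U \<subseteq> vanishing V 2 \<or> primitive V 2 \<subseteq> U"
    if "invariant V U" "U \<subseteq> cycles V 2" for U :: "('b set \<Rightarrow> 'a) set"
    using vanishing_or_primitive[OF that fin] .
  moreover have "U \<subseteq> primitive V 2 \<or> cycles V 2 \<subseteq> U"
    if "invariant V U" "U \<subseteq> cycles V 2" for U :: "('b set \<Rightarrow> 'a) set"
    using primitive_or_cycles_2[OF that fin _ vp] V(2) by simp
  ultimately show "successively (chain_step V (cycles V 2))
      [{0}, ?D, vanishing V 2, primitive V 2, cycles V 2 :: ('b set \<Rightarrow> 'a) set]"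
    by (simp only: successively.simps chain_step_def) blast
qed simp

text \<open>Unlike in degree 2 with even card V, adding the constant weight sum b V leaves the
  function unchanged and makes the trace 0, because card V is odd. So every function in
  \<open>vanishing\<close> has a weight of trace 0, and the chain needs no intermediate
  member.\<close>

lemma uniserial_3:
  fixes V :: "'b set"
  assumes fin: "finite V" and V: "card V mod 4 = 3" "5 \<le> card V"
  shows "uniserial_on V (cycles V 3 :: ('b set \<Rightarrow> 'a) set)"
proof (rule uniserial_on_chain[where Xs = "[vanishing V 3, primitive V 3, cycles V 3]"])
  obtain q where q: "card V = 4 * q + 3" using V(1) by (metis mult_div_mod_eq)
  then have odd: "odd (card V)" "odd (card V - 2)" "even (card V + 3)" by simp_all
  have "card V - 1 = 2 + 4 * q" using q by simp
  then have m: "(card V - 1) mod 4 = 2" by (simp only: mod_mult_self2) simp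
  have "(1 + 2 :: nat) = 3" by simp
  then have tp: "trace_affine V 3 b \<in> primitive V 3" for b :: "'b \<Rightarrow> 'a"
    using trace_affine_primitive[OF fin order_refl m, of b] by (simp only:)
  have vt: "\<exists>b. f = trace_affine V 3 b" if f: "f \<in> vanishing V 3" for f :: "'b set \<Rightarrow> 'a"
  proof -
    have "f \<in> vanishing V (Suc 2)" using f by (simp add: eval_nat_numeral)
    moreover have "2 + 3 \<le> card V" using V(2) by simp
    ultimately obtain b where "f = trace_affine V (Suc 2) b"
      using vanishing_trace_affine[OF _ fin _ odd(2)] vanishing_3_flat_link[OF f fin odd(1)] by metis
    then show ?thesis by (auto simp: eval_nat_numeral)
  qed
  then have vp: "vanishing V 3 \<subseteq> (primitive V 3 :: ('b set \<Rightarrow> 'a) set)" using tp by blast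
  have vz: "vanishing V 3 \<subseteq> {trace_affine V 3 b | b. sum b V = (0 :: 'a)}"
  proof
    fix f :: "'b set \<Rightarrow> 'a" assume "f \<in> vanishing V 3"
    then obtain b where b: "f = trace_affine V 3 b" using vt by blast
    let ?k = "\<lambda>_::'b. sum b V"
    have "of_nat (card V) = (1 :: 'a)" "of_nat 3 = (1 :: 'a)"
      using of_nat_char2[of "card V"] of_nat_char2[of 3] odd(1) by simp_all
    then have k: "sum ?k A = sum b V" if "A = V \<or> card A = 3" for A
      using that by auto
    have "trace_affine V 3 ?k A = 0" for A
    proof (cases "A \<subseteq> V \<and> card A = 3")
      case True
      then have "trace_affine V 3 ?k A = sum ?k A + sum ?k V"
        unfolding trace_affine_def affine_def by (rule if_P)
      also have "sum ?k A = sum b V" by (rule k) (use True in simp)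
      also have "sum ?k V = sum b V" by (rule k) simp
      finally show ?thesis by (simp only: add_self)
    next
      case False
      then show ?thesis unfolding trace_affine_def affine_def by (rule if_not_P)
    qed
    then have "trace_affine V 3 ?k = 0" by (simp add: fun_eq_iff)
    then have "f = trace_affine V 3 (b + ?k)" by (simp add: trace_affine_add b)
    moreover have "sum (b + ?k) V = 0"
    proof -
      have "sum (b + ?k) V = sum b V + sum ?k V" by (simp only: plus_fun_def sum.distrib)
      also have "sum ?k V = sum b V" by (rule k) simp
      finally show ?thesis by (simp only: add_self)
    qed
    ultimately show "f \<in> {trace_affine V 3 b | b. sum b V = 0}" by blast
  qed
  have "U \<subseteq> {0} \<or> vanishing V 3 \<subseteq> U"
    if "invariant V U" "U \<subseteq> cycles V 3" for U :: "('b set \<Rightarrow> 'a) set"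
    using trace_zero_subset[OF that fin odd(3) vt tp] vz by blast
  moreover have "U \<subseteq> vanishing V 3 \<or> primitive V 3 \<subseteq> U"
    if "invariant V U" "U \<subseteq> cycles V 3" for U :: "('b set \<Rightarrow> 'a) set"
    using vanishing_or_primitive[OF that fin] .
  moreover have "U \<subseteq> primitive V 3 \<or> cycles V 3 \<subseteq> U"
    if U: "invariant V U" "U \<subseteq> cycles V 3" for U :: "('b set \<Rightarrow> 'a) set"
  proof (cases "U \<subseteq> primitive V 3")
    case False
    then obtain f where f: "f \<in> U" "f \<notin> primitive V 3" by blast
    then have "primitive V 3 \<subseteq> U" using vanishing_or_primitive[OF U fin] vp by blast
    then have "cycles V 3 \<subseteq> U" by (rule cycles_3_subset[OF U(1) fin _ f(1) U(2) f(2) V(2) odd(1)])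
    then show ?thesis ..
  qed simp
  ultimately show "successively (chain_step V (cycles V 3))
      [{0}, vanishing V 3, primitive V 3, cycles V 3 :: ('b set \<Rightarrow> 'a) set]"
    by (simp only: successively.simps chain_step_def) blast
qed simp

section \<open>The cases that are not uniserial\<close>

lemma spreads_cycles:
  fixes f :: "'b set \<Rightarrow> 'a"
  assumes "distinct xs" "even (length xs)" "set xs \<subseteq> V" "finite V" "f \<in> uniform (V - set xs) m"
    "down V 1 f = 0"
  shows "spreads xs f \<in> cycles V (m + length xs div 2)"
proof -
  have "down V 1 (spreads xs f) = 0"
    using down_spreads[OF assms(1,2,5,3,4)] assms(6) by simp
  then have "down V 1 (spreads xs f) B = 0" for B by (simp only: zero_fun_apply)
  then show ?thesis
    using spreads_uniform[OF assms(1,2,5,3,4)] unfolding cycles_def by blast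
qed

text \<open>A two-row polytabloid is annihilated by d_2 but not by \<open>up k\<close>, while g
  behaves the other way round. The bound on card V leaves k letters outside the 2 * r letters of the
  polytabloid.\<close>

lemma not_uniserial_up:
  fixes g :: "'b set \<Rightarrow> 'a"
  assumes fin: "finite V" and card: "2 * r + k \<le> card V"
    and g: "g \<in> cycles V r" "\<And>B. B \<subseteq> V \<Longrightarrow> up k g B = 0" "down V 2 g B \<noteq> 0"
  shows "\<not> uniserial_on V (cycles V r :: ('b set \<Rightarrow> 'a) set)"
proof -
  obtain xs where xs: "distinct xs" "length xs = 2 * r" "set xs \<subseteq> V - {}"
    by (rule obtain_disjoint_list[OF fin, of "{}" "2 * r"]) (use card in auto)
  have "card (V - set xs) = card V - card (set xs)" using xs(3) by (intro card_Diff_subset) auto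
  then have "k \<le> card (V - set xs)" using card xs by (simp add: distinct_card)
  then obtain D where D: "D \<subseteq> V - set xs" "card D = k" by (meson obtain_subset_with_card_n)
  have "D \<subseteq> V" using D by blast
  then have fD: "finite D" using fin by (rule finite_subset)
  let ?p = "spreads xs (layer {} 0) :: 'b set \<Rightarrow> 'a"
  have even: "even (length xs)" using xs(2) by simp
  have "D \<inter> set xs = {}" using D(1) by blast
  then obtain T where T: "T \<subseteq> set xs" "up k ?p (T \<union> D) = 1"
    using up_spreads[OF xs(1) even fD] D(2) by metis
  have TD: "T \<union> D \<subseteq> V" using T(1) xs(3) \<open>D \<subseteq> V\<close> by blast
  have dp: "down V j ?p = 0" if "j > 0" for j
    using xs fin that by (intro down_spreads_layer) auto
  have "?p \<in> uniform V r" using spreads_layer_uniform[of xs V, where 'a = 'a] xs fin by simp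
  then have "?p \<in> cycles V r" using dp[of 1] unfolding cycles_def by simp
  moreover have "?p \<notin> {f. \<forall>B\<subseteq>V. up k f B = 0}" using T(2) TD by force
  moreover have "?p \<in> {f. \<forall>B. down V 2 f B = 0}" using dp[of 2] by simp
  moreover have "g \<in> {f. \<forall>B\<subseteq>V. up k f B = 0}" "g \<notin> {f. \<forall>B. down V 2 f B = 0}"
    using g(2,3) by blast+
  ultimately show ?thesis
    using g(1) by (intro not_uniserial_onI[OF invariant_down_kernel invariant_up_kernel invariant_cycles])
qed

text \<open>The witness is \<open>layer X r\<close>, where X omits e letters. With card X - r = 4p +
  1, the coefficients for d_1 and d_2 are 4p + 2, even, and (4p + 3 choose 2), odd. A set of r + k
  letters meets X in b letters with r + k - e \<le> b \<le> r + k, and there \<open>up k\<close>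
  takes the value (b choose r).\<close>

lemma not_uniserial_layer:
  fixes V :: "'b set"
  assumes fin: "finite V" and r: "2 \<le> r" "2 * r + k \<le> card V" and mod: "(card V - (e + r)) mod 4 = 1"
    and even: "\<And>b. r + k \<le> b + e \<Longrightarrow> b \<le> r + k \<Longrightarrow> even (b choose r)"
  shows "\<not> uniserial_on V (cycles V r :: ('b set \<Rightarrow> 'a) set)"
proof -
  obtain q where q: "r = q + 2" using r(1) by (metis add.commute le_Suc_ex)
  obtain X where X: "X \<subseteq> V" "card X = card V - e"
    by (rule obtain_subset_with_card_n[of "card V - e" V]) simp_all
  obtain p where p: "card X - r = 4 * p + 1" using mod unfolding X(2) diff_diff_left by (metis mult_div_mod_eq)
  have fX: "finite X" using X(1) fin by (rule finite_subset)
  let ?g = "layer X r :: 'b set \<Rightarrow> 'a"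
  have "card X - (q + 1) = 4 * p + 2" using p q by simp
  then have "even ((card X - (q + 1)) choose 1)" by simp
  moreover have "r = (q + 1) + 1" using q by simp
  ultimately have "down V 1 ?g B = 0" for B
    using down_layer[OF X(1) fin, of 1 "q + 1", where 'a = 'a]
      of_nat_char2[of "(card X - (q + 1)) choose 1"] by (simp only: fscale_def if_True mult_zero_left)
  then have "?g \<in> cycles V r" using layer_uniform[OF X(1), of r] unfolding cycles_def by blast
  moreover have "up k ?g B = 0" if B: "B \<subseteq> V" for B
  proof (cases "card B = r + k")
    case True
    have fB: "finite B" using B fin by (rule finite_subset)
    have "card (B - X) \<le> card (V - X)" using B fin by (intro card_mono) auto
    also have "card (V - X) \<le> e" using X fX by (simp add: card_Diff_subset)
    finally have "r + k \<le> card (B \<inter> X) + e" using card_Int_Diff[OF fB, of X] True by simp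
    moreover have "card (B \<inter> X) \<le> r + k" using card_mono[OF fB, of "B \<inter> X"] True by simp
    ultimately have "even (card (B \<inter> X) choose r)" by (rule even)
    then show ?thesis
      using up_layer[OF fB True, of X, where 'a = 'a] of_nat_char2[of "card (B \<inter> X) choose r"] by simp
  next
    case False
    then show ?thesis by (rule up_eq_0[OF layer_uniform[OF X(1)] finite_subset[OF B fin]])
  qed
  moreover obtain B where B: "B \<subseteq> X" "card B = q"
    by (rule obtain_subset_with_card_n[of q X]) (use p q in simp)
  have "down V 2 ?g B \<noteq> 0"
  proof -
    have "card X - q = 4 * p + 3" using p q by simp
    moreover have "(4 * p + 3) choose 2 = (4 * p + 3) * (2 * p + 1)"
      by (simp add: choose_two algebra_simps)
    ultimately have "of_nat ((card X - q) choose 2) = (1 :: 'a)"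
      using of_nat_char2[of "(card X - q) choose 2"] by simp
    then show ?thesis
      using down_layer[OF X(1) fin, of 2 q, where 'a = 'a] B
      unfolding q by (simp only: fun_vs.scale_one) (simp add: layer_def)
  qed
  ultimately show ?thesis by (rule not_uniserial_up[OF fin r(2)])
qed

text \<open>Witnesses are products of r - m factors x_a + x_b with e_m of a disjoint set X, on which
  the d_j act through e_m alone. For card X = 3, m = 2 the coefficients of d_1 and d_2 are 2 and 3,
  and d_4 exceeds the degree; for card X = 7, m = 4 those of d_1, d_2, d_4 are 4, 10, 35. Both
  witnesses use 2 * r - 1 letters.\<close>

lemma not_uniserial_ge_4:
  fixes V :: "'b set"
  assumes fin: "finite V" and r: "4 \<le> r" "2 * r \<le> card V + 1"
  shows "\<not> uniserial_on V (cycles V r :: ('b set \<Rightarrow> 'a) set)"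
proof -
  have witness: "\<exists>f \<in> (cycles V r :: ('b set \<Rightarrow> 'a) set). (\<forall>j. down V j (layer X m :: 'b set \<Rightarrow> 'a) = 0 \<longrightarrow> down V j f = 0) \<and>
      (\<forall>j. down V j (layer X m :: 'b set \<Rightarrow> 'a) = layer X 0 \<longrightarrow> down V j f \<noteq> 0)"
    if X: "X \<subseteq> V" "2 * (r - m) + card X \<le> card V" "m \<le> r" "down V 1 (layer X m :: 'b set \<Rightarrow> 'a) = 0"
    for X m
  proof -
    obtain xs where xs: "distinct xs" "length xs = 2 * (r - m)" "set xs \<subseteq> V - X"
      by (rule obtain_disjoint_list[OF fin X(1,2)])
    have even: "even (length xs)" using xs(2) by simp
    have sub: "set xs \<subseteq> V" "X \<subseteq> V - set xs" using xs(3) X(1) by blast+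
    have u: "layer X m \<in> (uniform (V - set xs) m :: ('b set \<Rightarrow> 'a) set)"
      using sub(2) by (rule layer_uniform)
    let ?f = "spreads xs (layer X m) :: 'b set \<Rightarrow> 'a"
    have d: "down V j ?f = spreads xs (down V j (layer X m))" for j
      by (rule down_spreads[OF xs(1) even u sub(1) fin])
    have fc: "?f \<in> cycles V r"
      using spreads_cycles[OF xs(1) even sub(1) fin u X(4)] xs(2) X(3) by simp
    have nz: "spreads xs (layer X 0) \<noteq> (0 :: 'b set \<Rightarrow> 'a)"
    proof -
      have "layer X 0 A = (0 :: 'a)" if "A \<inter> set xs \<noteq> {}" for A
        using that sub(2) by (auto simp: layer_def)
      moreover have "layer X 0 {} \<noteq> (0 :: 'a)" by (simp add: layer_def)
      ultimately have "\<exists>B. spreads xs (layer X 0) B \<noteq> (0 :: 'a) \<and> B \<inter> - set xs = {}"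
        by (rule spreads_nonzero[OF xs(1) even])
      then show ?thesis by (metis zero_fun_apply)
    qed
    show ?thesis by (rule bexI[OF _ fc]) (simp add: d nz)
  qed
  have layer: "down V j (layer X k :: 'b set \<Rightarrow> 'a) = (if even ((card X - m) choose j) then 0 else layer X m)"
    if "X \<subseteq> V" "k = m + j" for X m j k
    unfolding that(2) down_layer[OF that(1) fin] of_nat_char2 by (simp add: fscale_def fun_eq_iff)
  obtain X where X: "X \<subseteq> V" "card X = 3" by (rule obtain_subset_with_card_n[of 3 V]) (use r in simp)
  obtain Y where Y: "Y \<subseteq> V" "card Y = 7" by (rule obtain_subset_with_card_n[of 7 V]) (use r in simp)
  have "layer X 2 \<in> (uniform V 2 :: ('b set \<Rightarrow> 'a) set)" using X(1) by (rule layer_uniform)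
  then have "down V 4 (layer X 2 :: 'b set \<Rightarrow> 'a) B = 0" for B by (rule down_large[OF _ fin]) simp
  then have X4: "down V 4 (layer X 2 :: 'b set \<Rightarrow> 'a) = 0" by (simp add: fun_eq_iff)
  have X1: "down V 1 (layer X 2 :: 'b set \<Rightarrow> 'a) = 0" and X2: "down V 2 (layer X 2 :: 'b set \<Rightarrow> 'a) = layer X 0"
    using layer[OF X(1), of 2 1 1] layer[OF X(1), of 2 0 2] X(2) by (simp_all add: choose_small)
  have Y1: "down V 1 (layer Y 4 :: 'b set \<Rightarrow> 'a) = 0" and Y2: "down V 2 (layer Y 4 :: 'b set \<Rightarrow> 'a) = 0"
    and Y4: "down V 4 (layer Y 4 :: 'b set \<Rightarrow> 'a) = layer Y 0"
    using layer[OF Y(1), of 4 3 1] layer[OF Y(1), of 4 2 2] layer[OF Y(1), of 4 0 4] Y(2)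
    by (simp_all add: choose_small)
  obtain f where f: "f \<in> cycles V r" "down V 4 f = (0 :: 'b set \<Rightarrow> 'a)" "down V 2 f \<noteq> 0"
  proof -
    have "2 * (r - 2) + card X \<le> card V" "2 \<le> r" using X(2) r by arith+
    then show thesis using witness[OF X(1) _ _ X1] X2 X4 that by blast
  qed
  obtain g where g: "g \<in> cycles V r" "down V 2 g = (0 :: 'b set \<Rightarrow> 'a)" "down V 4 g \<noteq> 0"
  proof -
    have "2 * (r - 4) + card Y \<le> card V" using Y(2) r by arith
    then show thesis using witness[OF Y(1) _ r(1) Y1] Y2 Y4 that by blast
  qed
  have ker: "h \<in> {f. \<forall>B. down V j f B = 0} \<longleftrightarrow> down V j h = 0" for h :: "'b set \<Rightarrow> 'a" and j
    by (auto simp: fun_eq_iff)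
  show ?thesis
    by (rule not_uniserial_onI[OF invariant_down_kernel[of V 4] invariant_down_kernel[of V 2] invariant_cycles])
      (use f g in \<open>simp_all only: ker simp_thms\<close>)
qed

text \<open>In \<open>not_uniserial_layer\<close>, e is fixed by card V mod 4 = (e + r + 1) mod 4,
  and k = e + 4 - r makes the intersections start at 4 letters, so (b choose r) must be even for 4
  \<le> b \<le> e + 4. For r = 2 the values are 6, 10, 15, for r = 3 they are 4, 10, 20, 35: the odd
  entries limit e to 1 and 2, and the residues left over are the uniserial ones.\<close>

lemma uniserial_on_cycles_iff:
  fixes V :: "'b set"
  assumes fin: "finite V" and r: "r < card V - r"
  shows "uniserial_on V (cycles V r :: ('b set \<Rightarrow> 'a) set) \<longleftrightarrow>
    r = 0 \<or> r = 1 \<or> (r = 2 \<and> (card V mod 4 = 1 \<or> card V mod 4 = 2)) \<or> (r = 3 \<and> card V mod 4 = 3)"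
proof -
  consider "r = 0" | "r = 1" | "r = 2" | "r = 3" | "4 \<le> r" by linarith
  then show ?thesis
  proof cases
    case 1
    then show ?thesis using uniserial_0[OF fin] by simp
  next
    case 2
    then show ?thesis using uniserial_1[OF fin] by (simp only: simp_thms)
  next
    case 3
    have n: "5 \<le> card V" using r 3 by simp
    have "card V mod 4 < 4" by simp
    then consider "card V mod 4 = 0" | "card V mod 4 = 1" | "card V mod 4 = 2" | "card V mod 4 = 3" by linarith
    then show ?thesis
    proof cases
      case 1
      have "\<not> uniserial_on V (cycles V 2 :: ('b set \<Rightarrow> 'a) set)"
      proof (rule not_uniserial_layer[OF fin])
        show "2 * 2 + 3 \<le> card V" using 1 n by presburger
        show "(card V - (1 + 2)) mod 4 = 1" by (rule diff_mod_4) (use 1 n in simp_all)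
        fix b :: nat assume "2 + 3 \<le> b + 1" "b \<le> 2 + 3"
        then have "b = 4 \<or> b = 5" by arith
        then show "even (b choose 2)" by (auto simp: choose_small)
      qed simp
      then show ?thesis using 1 3 by simp
    next
      case 2
      then show ?thesis using uniserial_2_odd[OF fin 2] n 3 by simp
    next
      case c: 3
      then show ?thesis using uniserial_2_even[OF fin c] n 3 by simp
    next
      case 4
      have "\<not> uniserial_on V (cycles V 2 :: ('b set \<Rightarrow> 'a) set)"
      proof (rule not_uniserial_layer[OF fin])
        show "2 * 2 + 2 \<le> card V" using 4 n by presburger
        show "(card V - (0 + 2)) mod 4 = 1" by (rule diff_mod_4) (use 4 n in simp_all)
        fix b :: nat assume "2 + 2 \<le> b + 0" "b \<le> 2 + 2"
        then have "b = 4" by arith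
        then show "even (b choose 2)" by (auto simp: choose_small)
      qed simp
      then show ?thesis using 4 3 by simp
    qed
  next
    case 4
    have n: "7 \<le> card V" using r 4 by simp
    have not: "\<not> uniserial_on V (cycles V 3 :: ('b set \<Rightarrow> 'a) set)"
      if "2 * 3 + k \<le> card V" "card V mod 4 = (e + 3 + 1) mod 4" "3 + k = e + 4" "e \<le> 2" for k e
    proof (rule not_uniserial_layer[OF fin _ that(1)])
      show "(card V - (e + 3)) mod 4 = 1" using that n by (intro diff_mod_4) simp_all
      fix b assume "3 + k \<le> b + e" "b \<le> 3 + k"
      then have "b = 4 \<or> b = 5 \<or> b = 6" using that(3,4) by arith
      then show "even (b choose 3)" by (auto simp: choose_small)
    qed simp
    have "card V mod 4 < 4" by simp
    then consider "card V mod 4 = 0" | "card V mod 4 = 1" | "card V mod 4 = 2" | "card V mod 4 = 3" by linarith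
    then show ?thesis
    proof cases
      case 1
      then have "2 * 3 + 1 \<le> card V" using n by presburger
      then show ?thesis using not[of 1 0] 1 4 by simp
    next
      case 2
      then have "2 * 3 + 2 \<le> card V" using n by presburger
      then show ?thesis using not[of 2 1] 2 4 by simp
    next
      case c: 3
      then have "2 * 3 + 3 \<le> card V" using n by presburger
      then show ?thesis using not[of 3 2] c 4 by simp
    next
      case c: 4
      then show ?thesis using uniserial_3[OF fin c] n 4 by simp
    qed
  next
    case 5
    then show ?thesis using not_uniserial_ge_4[OF fin 5] r by simp
  qed
qed

end

section \<open>Hook Specht modules as modules of cycles\<close>

definition lower :: "nat list \<Rightarrow> tableau \<Rightarrow> nat set" where
  "lower \<mu> t = (\<Union>i\<in>{1..}. row_of \<mu> t i)"

text \<open>All tableaux in a tabloid have the same letters below the first row, so the union reads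
  off this set without a choice.\<close>

definition lower_tabloid :: "nat list \<Rightarrow> tabloid \<Rightarrow> nat set" where
  "lower_tabloid \<mu> T = \<Union> (lower \<mu> ` T)"

text \<open>A hook tabloid is an ordered r-tuple of letters; the lifted function depends only on the
  underlying set. The value 0 off \<open>tabloids\<close> keeps it in
  \<open>perm_module\<close>.\<close>

definition lift :: "nat list \<Rightarrow> (nat set \<Rightarrow> 'a::field) \<Rightarrow> tabloid \<Rightarrow> 'a" where
  "lift \<mu> f T = (if T \<in> tabloids \<mu> then f (lower_tabloid \<mu> T) else 0)"

lemma row_of_row_equiv:
  assumes "(s, t) \<in> row_equiv \<mu>"
  shows "row_of \<mu> t i = row_of \<mu> s i"
proof -
  obtain \<sigma> where "\<sigma> \<in> row_stabilizer \<mu> s" "t = act_tableau \<mu> \<sigma> s"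
    using assms by (auto simp: row_equiv_def)
  then show ?thesis by (simp add: row_of_act row_stabilizer_def)
qed

lemma lower_act: "lower \<mu> (act_tableau \<mu> \<sigma> t) = \<sigma> ` lower \<mu> t"
  by (simp add: lower_def row_of_act image_UN)

lemma lower_tabloid_of:
  assumes "t \<in> tableaux \<mu>"
  shows "lower_tabloid \<mu> (tabloid_of \<mu> t) = lower \<mu> t"
proof -
  have "lower \<mu> u = lower \<mu> t" if "u \<in> tabloid_of \<mu> t" for u
    using row_of_row_equiv[of t u \<mu>] that by (simp add: lower_def tabloid_of_def)
  moreover have "t \<in> tabloid_of \<mu> t"
    using equiv_class_self[OF equiv_row_equiv assms] by (simp add: tabloid_of_def)
  ultimately show ?thesis unfolding lower_tabloid_def by blast
qed

lemma lower_tabloid_act: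
  assumes "\<sigma> \<in> symgroup \<mu>" "T \<in> tabloids \<mu>"
  shows "lower_tabloid \<mu> (act_tabloid \<mu> \<sigma> T) = \<sigma> ` lower_tabloid \<mu> T"
proof -
  obtain t where "t \<in> tableaux \<mu>" "T = tabloid_of \<mu> t" using assms(2) by (rule tabloidsE)
  then show ?thesis
    using assms(1) by (simp add: act_tabloid_of lower_tabloid_of act_tableau_in lower_act)
qed

lemma act_tabloid_inverse:
  assumes "\<sigma> \<in> symgroup \<mu>" "T \<in> tabloids \<mu>"
  shows "act_tabloid \<mu> (inv \<sigma>) (act_tabloid \<mu> \<sigma> T) = T"
    "act_tabloid \<mu> \<sigma> (act_tabloid \<mu> (inv \<sigma>) T) = T"
proof -
  obtain t where t: "t \<in> tableaux \<mu>" "T = tabloid_of \<mu> t" using assms(2) by (rule tabloidsE)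
  show "act_tabloid \<mu> (inv \<sigma>) (act_tabloid \<mu> \<sigma> T) = T"
    "act_tabloid \<mu> \<sigma> (act_tabloid \<mu> (inv \<sigma>) T) = T"
    using assms(1) t symgroup_invs[OF assms(1)]
    by (simp_all add: act_tabloid_of act_tableau_in symgroup_inv act_tableau_comp act_tableau_id)
qed

text \<open>\<open>act\<close> moves basis vectors, hence acts on coordinates through the
  inverse.\<close>

lemma act_lift:
  assumes "\<sigma> \<in> symgroup \<mu>"
  shows "act \<mu> \<sigma> (lift \<mu> f) = lift \<mu> (\<lambda>A. f (inv \<sigma> ` A))"
proof
  fix U
  have "act \<mu> \<sigma> (lift \<mu> f) U = (\<Sum>T\<in>tabloids \<mu>. lift \<mu> f T * (if U = act_tabloid \<mu> \<sigma> T then 1 else 0))"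
    by (simp add: act_def sum_fun_apply fscale_def basis_vec_def)
  also have "\<dots> = lift \<mu> (\<lambda>A. f (inv \<sigma> ` A)) U"
  proof (cases "U \<in> tabloids \<mu>")
    case True
    let ?T = "act_tabloid \<mu> (inv \<sigma>) U"
    note T = act_tabloid_in[OF symgroup_inv[OF assms] True]
    have "(U = act_tabloid \<mu> \<sigma> T) = (T = ?T)" if "T \<in> tabloids \<mu>" for T
      using act_tabloid_inverse[OF assms] that True by metis
    then have "(\<Sum>T\<in>tabloids \<mu>. lift \<mu> f T * (if U = act_tabloid \<mu> \<sigma> T then 1 else 0)) =
        (\<Sum>T\<in>tabloids \<mu>. if T = ?T then lift \<mu> f T else 0)"
      by (intro sum.cong) auto
    also have "\<dots> = lift \<mu> f ?T" using finite_tabloids T by simp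
    also have "\<dots> = f (inv \<sigma> ` lower_tabloid \<mu> U)"
      using T True lower_tabloid_act[OF symgroup_inv[OF assms]] by (simp add: lift_def)
    finally show ?thesis using True by (simp add: lift_def)
  next
    case False
    then have "U \<noteq> act_tabloid \<mu> \<sigma> T" if "T \<in> tabloids \<mu>" for T
      using act_tabloid_in[OF assms that] by blast
    then show ?thesis using False by (simp add: lift_def)
  qed
  finally show "act \<mu> \<sigma> (lift \<mu> f) U = lift \<mu> (\<lambda>A. f (inv \<sigma> ` A)) U" .
qed

lemma lift_linear: "Vector_Spaces.linear fscale fscale (lift \<mu> :: (nat set \<Rightarrow> 'a::field) \<Rightarrow> _)"
proof (unfold_locales)
  fix f g :: "nat set \<Rightarrow> 'a" and c
  show "lift \<mu> (f + g) = lift \<mu> f + lift \<mu> g" by (simp add: lift_def fun_eq_iff)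
  show "lift \<mu> (fscale c f) = fscale c (lift \<mu> f)" by (simp add: lift_def fscale_def fun_eq_iff)
qed

lemma lift_perm_module: "lift \<mu> f \<in> perm_module \<mu>"
  by (simp add: perm_module_def lift_def)

lemma tableau_exists: "\<exists>t. t \<in> tableaux \<mu>"
proof -
  have c: "card (diagram \<mu>) = card (letters \<mu>)"
    unfolding diagram_Sigma letters_def by (simp add: sum_list_sum_nth atLeast0LessThan)
  have finite_letters: "finite (letters \<mu>)" by (simp add: letters_def)
  obtain t where t: "bij_betw t (diagram \<mu>) (letters \<mu>)"
    using finite_same_card_bij[OF finite_diagram finite_letters c] by blast
  then have "bij_betw (restrict t (diagram \<mu>)) (diagram \<mu>) (letters \<mu>)"
    by (subst bij_betw_cong[of _ _ t]) auto
  then show ?thesis by (auto simp: tableaux_def)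
qed

text \<open>If the rows agree as sets, t composed with the inverse of s permutes the letters,
  carries s to t and preserves every row.\<close>

lemma tabloid_of_eq_iff:
  assumes "s \<in> tableaux \<mu>" "t \<in> tableaux \<mu>"
  shows "tabloid_of \<mu> s = tabloid_of \<mu> t \<longleftrightarrow> (\<forall>i. row_of \<mu> s i = row_of \<mu> t i)"
proof
  assume "tabloid_of \<mu> s = tabloid_of \<mu> t"
  then have "(s, t) \<in> row_equiv \<mu>"
    using eq_equiv_class_iff[OF equiv_row_equiv assms] by (simp add: tabloid_of_def)
  then show "\<forall>i. row_of \<mu> s i = row_of \<mu> t i" using row_of_row_equiv by metis
next
  assume rows: "\<forall>i. row_of \<mu> s i = row_of \<mu> t i"
  have s: "bij_betw s (diagram \<mu>) (letters \<mu>)" and t: "bij_betw t (diagram \<mu>) (letters \<mu>)"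
    using assms by (auto simp: tableaux_def)
  let ?f = "t \<circ> inv_into (diagram \<mu>) s"
  have f: "bij_betw ?f (letters \<mu>) (letters \<mu>)"
    using bij_betw_inv_into[OF s] t by (rule bij_betw_trans)
  have "finite (letters \<mu>)" by (simp add: letters_def)
  then obtain \<sigma> where \<sigma>: "\<sigma> permutes letters \<mu>" "\<And>x. x \<in> letters \<mu> \<Longrightarrow> \<sigma> x = ?f x"
    using permutes_extend[of "letters \<mu>" ?f "letters \<mu>"] f by (auto simp: bij_betw_def)
  have "\<sigma> (s c) = t c" if "c \<in> diagram \<mu>" for c
  proof -
    have "s c \<in> letters \<mu>" using s that by (auto simp: bij_betw_def)
    then show ?thesis using \<sigma>(2) s that by (simp add: bij_betw_def)
  qed
  then have "act_tableau \<mu> \<sigma> s = t"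
    using assms(2) unfolding act_tableau_def compose_def tableaux_def
    by (auto simp: extensional_def restrict_def fun_eq_iff)
  moreover have "\<sigma> \<in> row_stabilizer \<mu> s"
    using \<sigma>(1) rows row_of_act[of \<mu> \<sigma> s] calculation by (simp add: row_stabilizer_def symgroup_def)
  ultimately have "(s, t) \<in> row_equiv \<mu>" using assms by (auto simp: row_equiv_def)
  then show "tabloid_of \<mu> s = tabloid_of \<mu> t"
    using equiv_class_eq[OF equiv_row_equiv] by (simp add: tabloid_of_def)
qed

section \<open>Combinatorics of hook tableaux\<close>

context
  fixes n r :: nat
  assumes r: "r < n - r"
begin

abbreviation (input) "\<mu> \<equiv> hook n r"

lemma letters_hook: "letters \<mu> = {1..n}"
  using r by (simp add: letters_def sum_list_hook)

lemma symgroup_hook: "\<sigma> \<in> symgroup \<mu> \<longleftrightarrow> \<sigma> permutes {1..n}"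
  by (simp add: symgroup_def letters_hook)

lemma diagram_hook:
  "(i, j) \<in> diagram \<mu> \<longleftrightarrow> i = 0 \<and> j < n - r \<or> 1 \<le> i \<and> i \<le> r \<and> j = 0"
  by (cases i) (auto simp: diagram_def hook_def)

lemma row_of_hook: "1 \<le> i \<Longrightarrow> row_of \<mu> t i = (if i \<le> r then {t (i, 0)} else {})"
  by (auto simp: row_of_def diagram_hook)

lemma lower_hook: "lower \<mu> t = (\<lambda>i. t (i, 0)) ` {1..r}"
proof -
  have "lower \<mu> t = (\<Union>i\<in>{1..}. if i \<le> r then {t (i, 0)} else {})"
    unfolding lower_def by (intro SUP_cong) (simp_all add: row_of_hook)
  also have "\<dots> = (\<lambda>i. t (i, 0)) ` {1..r}" by (auto split: if_splits)
  finally show ?thesis .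
qed

lemma column_of_hook_0: "column_of \<mu> t 0 = insert (t (0, 0)) (lower \<mu> t)"
proof -
  have "(i, 0) \<in> diagram \<mu> \<longleftrightarrow> i = 0 \<or> i \<in> {1..r}" for i using r by (auto simp: diagram_hook)
  then show ?thesis unfolding column_of_def lower_hook by auto
qed

lemma column_of_hook: "1 \<le> j \<Longrightarrow> column_of \<mu> t j = (if j < n - r then {t (0, j)} else {})"
  by (auto simp: column_of_def diagram_hook)

lemma tableau_hook:
  assumes "t \<in> tableaux \<mu>"
  shows "inj_on (\<lambda>i. t (i, 0)) {0..r}" "lower \<mu> t \<subseteq> {1..n}" "card (lower \<mu> t) = r"
    "t (0, 0) \<in> {1..n}" "t (0, 0) \<notin> lower \<mu> t"
    "{1..n} = column_of \<mu> t 0 \<union> (\<lambda>j. t (0, j)) ` {1..<n - r}"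
    "column_of \<mu> t 0 \<inter> (\<lambda>j. t (0, j)) ` {1..<n - r} = {}"
    "row_of \<mu> t 0 = {1..n} - lower \<mu> t"
proof -
  have t: "inj_on t (diagram \<mu>)" "t ` diagram \<mu> = {1..n}"
    using assms by (simp_all add: tableaux_def letters_hook bij_betw_def)
  \<comment> \<open>The diagram is split in two ways: into first column and arm for the facts on
    columns, into leg and first row for those on rows.\<close>
  have d: "diagram \<mu> = (\<lambda>i. (i, 0)) ` {0..r} \<union> (\<lambda>j. (0, j)) ` {1..<n - r}"
    using r by (force simp: diagram_hook)
  have d': "diagram \<mu> = (\<lambda>i. (i, 0)) ` {1..r} \<union> (\<lambda>j. (0, j)) ` {0..<n - r}"
    using r by (force simp: diagram_hook)
  have disj: "(\<lambda>i. (i, 0)) ` {0..r} \<inter> (\<lambda>j. (0, j)) ` {1..<n - r} = {}"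
    "(\<lambda>i. (i, 0)) ` {1..r} \<inter> (\<lambda>j. (0, j)) ` {0..<n - r} = ({} :: (nat \<times> nat) set)" by auto
  show inj: "inj_on (\<lambda>i. t (i, 0)) {0..r}"
    using t(1) unfolding d by (auto simp: inj_on_def)
  have low: "lower \<mu> t = t ` (\<lambda>i. (i, 0)) ` {1..r}" by (simp add: lower_hook image_image)
  have "{0..r} = insert 0 {1..r}" by auto
  then have col: "column_of \<mu> t 0 = t ` (\<lambda>i. (i, 0)) ` {0..r}"
    by (simp add: column_of_hook_0 lower_hook image_image)
  show "lower \<mu> t \<subseteq> {1..n}" unfolding low t(2)[symmetric] d' by blast
  show "card (lower \<mu> t) = r"
    unfolding lower_hook using inj_on_subset[OF inj, of "{1..r}"] by (subst card_image) auto
  show "t (0, 0) \<in> {1..n}" unfolding t(2)[symmetric] d by auto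
  show "t (0, 0) \<notin> lower \<mu> t"
    unfolding lower_hook using inj_onD[OF inj, of 0] by fastforce
  show "{1..n} = column_of \<mu> t 0 \<union> (\<lambda>j. t (0, j)) ` {1..<n - r}"
    unfolding t(2)[symmetric] col d by (simp add: image_Un image_image)
  show "column_of \<mu> t 0 \<inter> (\<lambda>j. t (0, j)) ` {1..<n - r} = {}"
  proof -
    have "t ` (\<lambda>i. (i, 0)) ` {0..r} \<inter> t ` (\<lambda>j. (0, j)) ` {1..<n - r} = t ` ({} :: (nat \<times> nat) set)"
      unfolding disj(1)[symmetric] using d by (intro inj_on_image_Int[OF t(1), symmetric]) auto
    then show ?thesis by (simp add: col image_image)
  qed
  have "row_of \<mu> t 0 = t ` (\<lambda>j. (0, j)) ` {0..<n - r}"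
    by (auto simp: row_of_def diagram_hook)
  moreover have "t ` (\<lambda>i. (i, 0)) ` {1..r} \<inter> t ` (\<lambda>j. (0, j)) ` {0..<n - r} = t ` ({} :: (nat \<times> nat) set)"
    unfolding disj(2)[symmetric] using d' by (intro inj_on_image_Int[OF t(1), symmetric]) auto
  ultimately show "row_of \<mu> t 0 = {1..n} - lower \<mu> t"
    unfolding low t(2)[symmetric] d' image_Un by blast
qed

lemma tabloid_of_hook_eq_iff:
  assumes "s \<in> tableaux \<mu>" "t \<in> tableaux \<mu>"
  shows "tabloid_of \<mu> s = tabloid_of \<mu> t \<longleftrightarrow> (\<forall>i\<in>{1..r}. s (i, 0) = t (i, 0))"
  unfolding tabloid_of_eq_iff[OF assms]
proof
  assume rows: "\<forall>i. row_of \<mu> s i = row_of \<mu> t i"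
  show "\<forall>i\<in>{1..r}. s (i, 0) = t (i, 0)"
  proof
    fix i assume i: "i \<in> {1..r}"
    have "row_of \<mu> s i = row_of \<mu> t i" using rows by blast
    then show "s (i, 0) = t (i, 0)" using i row_of_hook[of i] by simp
  qed
next
  assume eq: "\<forall>i\<in>{1..r}. s (i, 0) = t (i, 0)"
  show "\<forall>i. row_of \<mu> s i = row_of \<mu> t i"
  proof
    fix i
    show "row_of \<mu> s i = row_of \<mu> t i"
    proof (cases "i = 0")
      case True
      have "lower \<mu> s = lower \<mu> t"
        unfolding lower_hook using eq by (intro image_cong) auto
      then show ?thesis using tableau_hook(8)[OF assms(1)] tableau_hook(8)[OF assms(2)] True by simp
    next
      case False
      then show ?thesis using eq row_of_hook[of i] by simp
    qed
  qed
qed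

lemma tableau_hook_exists:
  assumes "x \<in> {1..n}" "A \<subseteq> {1..n}" "x \<notin> A" "card A = r"
  shows "\<exists>t\<in>tableaux \<mu>. t (0, 0) = x \<and> lower \<mu> t = A"
proof -
  obtain s where s: "s \<in> tableaux \<mu>" using tableau_exists by blast
  let ?B = "lower \<mu> s"
  note B = tableau_hook[OF s]
  have "finite A" "finite ?B" using assms(2) B(2) by (auto intro: finite_subset)
  then obtain h where h: "bij_betw h ?B A" using finite_same_card_bij assms(4) B(3) by metis
  let ?f = "h(s (0, 0) := x)"
  have f: "?f ` insert (s (0, 0)) ?B = insert x A" "?f ` ?B = A"
    using h B(5) by (auto simp: bij_betw_def)
  have inj: "inj_on ?f (insert (s (0, 0)) ?B)"
    using h B(5) assms(3) by (auto simp: bij_betw_def inj_on_def)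
  have "insert (s (0, 0)) ?B \<subseteq> {1..n}" using B(2,4) by blast
  moreover have "?f ` insert (s (0, 0)) ?B \<subseteq> {1..n}" unfolding f(1) using assms(1,2) by blast
  ultimately obtain \<sigma> where \<sigma>: "\<sigma> permutes {1..n}" "\<And>y. y \<in> insert (s (0, 0)) ?B \<Longrightarrow> \<sigma> y = ?f y"
    using permutes_extend[OF finite_atLeastAtMost inj] by metis
  have "\<sigma> ` ?B = A" using \<sigma>(2) f(2) by (metis image_cong insertI2)
  moreover have "act_tableau \<mu> \<sigma> s (0, 0) = x"
  proof -
    have "(0, 0) \<in> diagram \<mu>" using r by (simp add: diagram_hook)
    then show ?thesis using \<sigma>(2)[of "s (0, 0)"] by (simp add: act_tableau_def compose_def)
  qed
  moreover have "act_tableau \<mu> \<sigma> s \<in> tableaux \<mu>"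
    using \<sigma>(1) s by (intro act_tableau_in) (simp_all add: symgroup_hook)
  ultimately show ?thesis using lower_act by metis
qed

text \<open>The other columns are single cells, so their letters are fixed.\<close>

lemma column_stabilizer_hook:
  assumes "t \<in> tableaux \<mu>"
  shows "column_stabilizer \<mu> t = {\<sigma>. \<sigma> permutes column_of \<mu> t 0}"
proof (intro equalityI subsetI)
  let ?C = "column_of \<mu> t 0"
  note t = tableau_hook[OF assms]
  fix \<sigma> assume "\<sigma> \<in> column_stabilizer \<mu> t"
  then have \<sigma>: "\<sigma> permutes {1..n}" "\<And>j. \<sigma> ` column_of \<mu> t j = column_of \<mu> t j"
    by (auto simp: column_stabilizer_def symgroup_hook)
  have "\<sigma> x = x" if "x \<in> {1..n} - ?C" for x
  proof -
    have "x \<in> (\<lambda>j. t (0, j)) ` {1..<n - r}" using t(6) that by blast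
    then obtain j where j: "1 \<le> j" "j < n - r" "x = t (0, j)" by auto
    then show ?thesis using \<sigma>(2)[of j] column_of_hook[of j t] by simp
  qed
  then show "\<sigma> \<in> {\<sigma>. \<sigma> permutes ?C}" using permutes_superset[OF \<sigma>(1)] by blast
next
  let ?C = "column_of \<mu> t 0"
  note t = tableau_hook[OF assms]
  fix \<sigma> assume "\<sigma> \<in> {\<sigma>. \<sigma> permutes ?C}"
  then have \<sigma>: "\<sigma> permutes ?C" by simp
  have "?C \<subseteq> {1..n}" using t(6) by blast
  with \<sigma> have "\<sigma> permutes {1..n}" by (rule permutes_subset)
  moreover have "\<sigma> ` column_of \<mu> t j = column_of \<mu> t j" for j
  proof (cases "j = 0")
    case True
    then show ?thesis using permutes_image[OF \<sigma>] by simp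
  next
    case False
    have "\<sigma> (t (0, j)) = t (0, j)" if "j < n - r"
    proof -
      have "t (0, j) \<in> (\<lambda>j. t (0, j)) ` {1..<n - r}" using that False by auto
      then have "t (0, j) \<notin> ?C" using t(7) by blast
      then show ?thesis by (rule permutes_not_in[OF \<sigma>])
    qed
    then show ?thesis using column_of_hook[of j t] False by simp
  qed
  ultimately show "\<sigma> \<in> column_stabilizer \<mu> t"
    by (simp add: column_stabilizer_def symgroup_hook)
qed

section \<open>The hook Specht module and its submodules in characteristic two\<close>

context
  fixes F :: "'a::field itself"
  assumes char2: "CHAR('a) = 2"
begin

text \<open>Signs are 1, and a permutation of the r + 1 letters of the first column is determined by
  the images of the r letters below the corner. So every ordering of every r-subset of the column
  occurs exactly once in the polytabloid.\<close>

lemma polytabloid_hook: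
  assumes t: "t \<in> tableaux \<mu>"
  shows "polytabloid \<mu> t = lift \<mu> (layer (column_of \<mu> t 0) r :: nat set \<Rightarrow> 'a)"
proof
  fix T
  let ?C = "column_of \<mu> t 0" and ?S = "column_stabilizer \<mu> t"
  have S: "\<sigma> \<in> symgroup \<mu>" if "\<sigma> \<in> ?S" for \<sigma> using that by (simp add: column_stabilizer_def)
  have sgn: "of_int (sign \<sigma>) = (1 :: 'a)" for \<sigma> :: "nat \<Rightarrow> nat"
    using minus_char2[OF char2, of 0 1] by (simp add: sign_def)
  have poly: "polytabloid \<mu> t T = (\<Sum>\<sigma>\<in>?S. if T = act_tabloid \<mu> \<sigma> (tabloid_of \<mu> t) then 1 else 0 :: 'a)"
    by (simp add: polytabloid_def sum_fun_apply fscale_def basis_vec_def sgn)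
  show "polytabloid \<mu> t T = lift \<mu> (layer ?C r :: nat set \<Rightarrow> 'a) T"
  proof (cases "T \<in> tabloids \<mu>")
    case False
    then have "T \<noteq> act_tabloid \<mu> \<sigma> (tabloid_of \<mu> t)" if "\<sigma> \<in> ?S" for \<sigma>
      using act_tabloid_in[OF S[OF that] tabloid_of_in[OF t]] by blast
    then show ?thesis unfolding poly using False by (simp add: lift_def)
  next
    case True
    then obtain u where u: "u \<in> tableaux \<mu>" "T = tabloid_of \<mu> u" by (rule tabloidsE)
    let ?E = "{\<sigma> \<in> ?S. \<forall>i\<in>{1..r}. \<sigma> (t (i, 0)) = u (i, 0)}"
    have "?C \<subseteq> {1..n}" using tableau_hook(6)[OF t] by blast
    then have finC: "finite ?C" by (rule finite_subset) simp
    then have finS: "finite ?S" unfolding column_stabilizer_hook[OF t] by (rule finite_permutations)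
    have iff: "(T = act_tabloid \<mu> \<sigma> (tabloid_of \<mu> t)) = (\<forall>i\<in>{1..r}. \<sigma> (t (i, 0)) = u (i, 0))"
      if "\<sigma> \<in> ?S" for \<sigma>
    proof -
      have "act_tabloid \<mu> \<sigma> (tabloid_of \<mu> t) = tabloid_of \<mu> (act_tableau \<mu> \<sigma> t)"
        using S[OF that] t by (rule act_tabloid_of)
      moreover have "tabloid_of \<mu> (act_tableau \<mu> \<sigma> t) = tabloid_of \<mu> u \<longleftrightarrow>
          (\<forall>i\<in>{1..r}. act_tableau \<mu> \<sigma> t (i, 0) = u (i, 0))"
        using act_tableau_in[OF S[OF that] t] u(1) by (rule tabloid_of_hook_eq_iff)
      moreover have "act_tableau \<mu> \<sigma> t (i, 0) = \<sigma> (t (i, 0))" if "i \<in> {1..r}" for i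
        using that by (simp add: act_tableau_def compose_def diagram_hook)
      ultimately show ?thesis using u(2) by auto
    qed
    have "polytabloid \<mu> t T = (\<Sum>\<sigma>\<in>?S. if \<forall>i\<in>{1..r}. \<sigma> (t (i, 0)) = u (i, 0) then 1 else 0 :: 'a)"
      unfolding poly using iff by (intro sum.cong) simp_all
    also have "\<dots> = of_nat (card ?E)"
      using finS by (subst sum.inter_filter[symmetric]) simp_all
    also have "\<dots> = layer ?C r (lower \<mu> u)"
    proof (cases "lower \<mu> u \<subseteq> ?C")
      case False
      have "?E = {}"
      proof (rule ccontr)
        assume "?E \<noteq> {}"
        then obtain \<sigma> where \<sigma>: "\<sigma> permutes ?C" "\<forall>i\<in>{1..r}. \<sigma> (t (i, 0)) = u (i, 0)"
          unfolding column_stabilizer_hook[OF t] by blast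
        have "u (i, 0) \<in> ?C" if i: "i \<in> {1..r}" for i
        proof -
          have "t (i, 0) \<in> ?C" using i by (simp add: column_of_hook_0 lower_hook)
          then have "\<sigma> (t (i, 0)) \<in> ?C" using permutes_in_image[OF \<sigma>(1)] by simp
          then show ?thesis using \<sigma>(2) i by simp
        qed
        then show False using False unfolding lower_hook by blast
      qed
      then have "card ?E = 0" by (simp only: card.empty)
      then show ?thesis using False by (simp add: layer_def)
    next
      case True
      define f where "f = (\<lambda>x. u (inv_into {1..r} (\<lambda>i. t (i, 0)) x, 0))"
      have injt: "inj_on (\<lambda>i. t (i, 0)) {1..r}" and inju: "inj_on (\<lambda>i. u (i, 0)) {1..r}"
        using inj_on_subset[OF tableau_hook(1)[OF t], of "{1..r}"]
          inj_on_subset[OF tableau_hook(1)[OF u(1)], of "{1..r}"] by auto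
      have f: "f (t (i, 0)) = u (i, 0)" if "i \<in> {1..r}" for i
        unfolding f_def using inv_into_f_f[OF injt that] by simp
      have "inj_on f (lower \<mu> t)"
        unfolding lower_hook
      proof (rule inj_onI)
        fix x y assume "x \<in> (\<lambda>i. t (i, 0)) ` {1..r}" "y \<in> (\<lambda>i. t (i, 0)) ` {1..r}" "f x = f y"
        then obtain i j where ij: "i \<in> {1..r}" "j \<in> {1..r}" "x = t (i, 0)" "y = t (j, 0)"
          "u (i, 0) = u (j, 0)" using f by auto
        then have "i = j" using inj_onD[OF inju] by blast
        then show "x = y" using ij by simp
      qed
      moreover have "lower \<mu> t \<subseteq> ?C" by (auto simp: column_of_hook_0)
      moreover have "f ` lower \<mu> t \<subseteq> ?C"
      proof -
        have "f ` lower \<mu> t = lower \<mu> u" unfolding lower_hook image_image using f by (intro image_cong) auto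
        then show ?thesis using True by simp
      qed
      ultimately obtain \<sigma> where \<sigma>: "\<sigma> permutes ?C" "\<And>x. x \<in> lower \<mu> t \<Longrightarrow> \<sigma> x = f x"
        using permutes_extend[OF finC] by metis
      have "\<sigma> \<in> ?E" unfolding column_stabilizer_hook[OF t] using \<sigma> f by (auto simp: lower_hook)
      moreover have "\<tau> = \<sigma>" if "\<tau> \<in> ?E" for \<tau>
      proof -
        have \<tau>: "\<tau> permutes ?C" "\<forall>i\<in>{1..r}. \<tau> (t (i, 0)) = u (i, 0)"
          using that unfolding column_stabilizer_hook[OF t] by auto
        have p: "inv \<tau> \<circ> \<sigma> permutes ?C" using \<sigma>(1) permutes_inv[OF \<tau>(1)] by (rule permutes_compose)
        have "(inv \<tau> \<circ> \<sigma>) x = x" if x: "x \<in> ?C - {t (0, 0)}" for x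
        proof -
          obtain i where i: "i \<in> {1..r}" "x = t (i, 0)"
            using x unfolding column_of_hook_0 lower_hook by blast
          then have "\<sigma> x = \<tau> x" using \<sigma>(2)[of x] f \<tau>(2) by (simp add: lower_hook)
          then show ?thesis using permutes_inverses(2)[OF \<tau>(1)] by simp
        qed
        \<comment> \<open>The two permutations agree below the corner, so their quotient can move
          only the corner letter and is the identity.\<close>
        then have "inv \<tau> \<circ> \<sigma> permutes {t (0, 0)}" using permutes_superset[OF p] by blast
        then have "inv \<tau> \<circ> \<sigma> = id" by simp
        then have "\<tau> \<circ> (inv \<tau> \<circ> \<sigma>) = \<tau>" by simp
        then show ?thesis using permutes_inv_o(1)[OF \<tau>(1)] by (simp add: o_assoc)
      qed
      ultimately have "?E = {\<sigma>}" by blast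
      then have "card ?E = 1" by (simp only: card_1_singleton_iff One_nat_def) blast
      then show ?thesis using True tableau_hook(3)[OF u(1)] by (simp add: layer_def)
    qed
    also have "\<dots> = lift \<mu> (layer ?C r) T"
      using True u by (simp add: lift_def lower_tabloid_of)
    finally show ?thesis .
  qed
qed

text \<open>Polytabloids are the lifts of the boundaries of the (r + 1)-sets, and by
  \<open>cycles_expand\<close> with cone point n these span all cycles.\<close>

lemma specht_hook: "specht \<mu> = lift \<mu> ` (cycles {1..n} r :: (nat set \<Rightarrow> 'a) set)"
proof -
  interpret l: Vector_Spaces.linear "fscale :: 'a \<Rightarrow> _" fscale "lift \<mu>" by (rule lift_linear)
  let ?L = "{layer A r | A. A \<subseteq> {1..n} \<and> card A = Suc r} :: (nat set \<Rightarrow> 'a) set"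
  have "polytabloid \<mu> ` tableaux \<mu> = lift \<mu> ` ?L"
  proof (intro equalityI subsetI)
    fix x :: "tabloid \<Rightarrow> 'a" assume "x \<in> polytabloid \<mu> ` tableaux \<mu>"
    then obtain t where t: "t \<in> tableaux \<mu>" "x = polytabloid \<mu> t" by blast
    let ?C = "column_of \<mu> t 0"
    have "?C \<subseteq> {1..n}" using tableau_hook(6)[OF t(1)] by blast
    moreover have "finite (lower \<mu> t)" by (simp add: lower_hook)
    then have "card ?C = Suc r"
      using tableau_hook(3,5)[OF t(1)] by (simp add: column_of_hook_0)
    ultimately show "x \<in> lift \<mu> ` ?L" using t polytabloid_hook by blast
  next
    fix x :: "tabloid \<Rightarrow> 'a" assume "x \<in> lift \<mu> ` ?L"
    then obtain C where C: "x = lift \<mu> (layer C r)" "C \<subseteq> {1..n}" "card C = Suc r" by blast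
    have "C \<noteq> {}" using C(3) by auto
    then obtain c where c: "c \<in> C" by blast
    have "finite C" using C(2) by (rule finite_subset) simp
    then have "card (C - {c}) = r" using C(3) c by simp
    then obtain t where t: "t \<in> tableaux \<mu>" "t (0, 0) = c" "lower \<mu> t = C - {c}"
      using tableau_hook_exists[of c "C - {c}"] C(2) c by blast
    have "column_of \<mu> t 0 = C" unfolding column_of_hook_0 t(2,3) using c by blast
    then have "x = polytabloid \<mu> t" using polytabloid_hook[OF t(1)] C(1) by simp
    then show "x \<in> polytabloid \<mu> ` tableaux \<mu>" using t(1) by blast
  qed
  then have "specht \<mu> = lift \<mu> ` fun_vs.span ?L"
    by (simp only: specht_def l.span_image)
  moreover have "fun_vs.span ?L = cycles {1..n} r"
  proof
    show "fun_vs.span ?L \<subseteq> cycles {1..n} r"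
    proof (rule fun_vs.span_minimal[OF _ subspace_cycles])
      show "?L \<subseteq> cycles {1..n} r"
      proof
        fix x assume "x \<in> ?L"
        then obtain A where A: "x = layer A r" "A \<subseteq> {1..n}" "card A = Suc r" by blast
        show "x \<in> cycles {1..n} r" unfolding A(1) using A(2) _ A(3) by (rule layer_cycles[OF char2]) simp
      qed
    qed
    show "cycles {1..n} r \<subseteq> fun_vs.span ?L"
    proof
      fix f :: "nat set \<Rightarrow> 'a" assume f: "f \<in> cycles {1..n} r"
      have n: "n \<in> {1..n}" "finite {1..n}" using r by auto
      have "layer (insert n A) r \<in> ?L" if A: "A \<subseteq> {1..n} - {n}" "card A = r" for A
      proof -
        have "finite A" using A(1) by (rule finite_subset) simp
        moreover have "n \<notin> A" using A(1) by blast
        ultimately have "card (insert n A) = Suc r" using A(2) by simp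
        moreover have "insert n A \<subseteq> {1..n}" using A(1) n(1) by blast
        ultimately show ?thesis by blast
      qed
      then have "(\<Sum>A | A \<subseteq> {1..n} - {n} \<and> card A = r. fscale (f A) (layer (insert n A) r)) \<in> fun_vs.span ?L"
        by (intro fun_vs.span_sum fun_vs.span_scale fun_vs.span_base) simp
      then show "f \<in> fun_vs.span ?L"
        unfolding cycles_expand[OF char2 f n(2,1), symmetric] .
    qed
  qed
  ultimately show ?thesis by simp
qed

text \<open>Every r-set occurs below the first row of some tableau, since r < n leaves a letter for
  the corner.\<close>

lemma lift_hook_inj:
  assumes "f \<in> uniform {1..n} r" "g \<in> uniform {1..n} r" "lift \<mu> f = lift \<mu> (g :: nat set \<Rightarrow> 'a)"
  shows "f = g"
proof (rule uniform_eqI[OF assms(1,2)])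
  fix A assume A: "A \<subseteq> {1..n}" "card A = r"
  have "A \<noteq> {1..n}" using A(2) r by auto
  then obtain x where "x \<in> {1..n}" "x \<notin> A" using A(1) by blast
  then obtain t where t: "t \<in> tableaux \<mu>" "lower \<mu> t = A"
    using tableau_hook_exists A by blast
  have "lift \<mu> f (tabloid_of \<mu> t) = lift \<mu> g (tabloid_of \<mu> t)"
    using assms(3) by (rule fun_cong)
  then show "f A = g A" using t by (simp add: lift_def lower_tabloid_of tabloid_of_in)
qed

lemma submodule_lift:
  assumes "invariant {1..n} U" "U \<subseteq> (cycles {1..n} r :: (nat set \<Rightarrow> 'a) set)"
  shows "submodule \<mu> (lift \<mu> ` U)"
proof -
  interpret l: Vector_Spaces.linear "fscale :: 'a \<Rightarrow> _" fscale "lift \<mu>" by (rule lift_linear)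
  have "lift \<mu> ` U \<subseteq> perm_module \<mu>" using lift_perm_module by blast
  moreover have "fun_vs.subspace (lift \<mu> ` U)"
    using assms(1) by (intro l.subspace_image) (simp add: invariant_def)
  moreover have "act \<mu> \<sigma> g \<in> lift \<mu> ` U"
    if \<sigma>: "\<sigma> \<in> symgroup \<mu>" and g: "g \<in> lift \<mu> ` U" for \<sigma> g
  proof -
    obtain f where f: "f \<in> U" "g = lift \<mu> f" using g by blast
    have "inv \<sigma> permutes {1..n}" using \<sigma> by (simp add: symgroup_hook permutes_inv)
    then have "(\<lambda>A. f (inv \<sigma> ` A)) \<in> U" using assms(1) f(1) unfolding invariant_def by blast
    then show ?thesis using act_lift[OF \<sigma>, of f] f(2) by blast
  qed
  ultimately show ?thesis by (simp add: submodule_def)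
qed

text \<open>U is the preimage of W among the cycles; W is recovered because the lifts of cycles
  exhaust the Specht module.\<close>

lemma submodule_specht_hookE:
  assumes "submodule \<mu> W" "W \<subseteq> (specht \<mu> :: (tabloid \<Rightarrow> 'a) set)"
  obtains U where "invariant {1..n} U" "U \<subseteq> cycles {1..n} r" "W = lift \<mu> ` U"
proof -
  interpret l: Vector_Spaces.linear "fscale :: 'a \<Rightarrow> _" fscale "lift \<mu>" by (rule lift_linear)
  let ?U = "cycles {1..n} r \<inter> {f. lift \<mu> f \<in> W}"
  have subW: "fun_vs.subspace W" using assms(1) by (simp add: submodule_def)
  have "invariant {1..n} {f. lift \<mu> f \<in> W}"
    unfolding invariant_def
  proof (intro conjI allI impI ballI)
    show "fun_vs.subspace {f. lift \<mu> f \<in> W}"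
      using l.subspace_vimage[OF subW] by (simp add: vimage_def)
    fix \<sigma> :: "nat \<Rightarrow> nat" and f assume \<sigma>: "\<sigma> permutes {1..n}" and f: "f \<in> {f. lift \<mu> f \<in> W}"
    have s: "inv \<sigma> \<in> symgroup \<mu>" using permutes_inv[OF \<sigma>] by (simp add: symgroup_hook)
    have "act \<mu> (inv \<sigma>) (lift \<mu> f) \<in> W"
      using assms(1) s f unfolding submodule_def by blast
    then show "(\<lambda>A. f (\<sigma> ` A)) \<in> {f. lift \<mu> f \<in> W}"
      using act_lift[OF s, of f] permutes_inv_inv[OF \<sigma>] by simp
  qed
  then have "invariant {1..n} ?U" by (rule invariant_Int[OF invariant_cycles])
  moreover have "W = lift \<mu> ` ?U" using assms(2) unfolding specht_hook by blast
  ultimately show ?thesis using that[of ?U] by blast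
qed

lemma uniserial_specht_hook_iff:
  "uniserial \<mu> (specht \<mu> :: (tabloid \<Rightarrow> 'a) set) \<longleftrightarrow>
    uniserial_on {1..n} (cycles {1..n} r :: (nat set \<Rightarrow> 'a) set)"
proof
  assume uni: "uniserial \<mu> (specht \<mu> :: (tabloid \<Rightarrow> 'a) set)"
  have mono: "U \<subseteq> W" if UW: "lift \<mu> ` U \<subseteq> lift \<mu> ` W"
    "U \<subseteq> cycles {1..n} r" "W \<subseteq> cycles {1..n} r" for U W :: "(nat set \<Rightarrow> 'a) set"
  proof
    fix f assume f: "f \<in> U"
    then obtain g where g: "g \<in> W" "lift \<mu> f = lift \<mu> g" using UW(1) by blast
    have "f \<in> uniform {1..n} r" "g \<in> uniform {1..n} r" using f g(1) UW(2,3) unfolding cycles_def by blast+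
    then show "f \<in> W" using lift_hook_inj g by blast
  qed
  show "uniserial_on {1..n} (cycles {1..n} r :: (nat set \<Rightarrow> 'a) set)"
    unfolding uniserial_on_def
  proof (intro allI impI)
    fix U W :: "(nat set \<Rightarrow> 'a) set"
    assume *: "invariant {1..n} U \<and> U \<subseteq> cycles {1..n} r \<and> invariant {1..n} W \<and> W \<subseteq> cycles {1..n} r"
    have "submodule \<mu> (lift \<mu> ` U)" "submodule \<mu> (lift \<mu> ` W)"
      using * by (intro submodule_lift; simp)+
    moreover have "lift \<mu> ` U \<subseteq> specht \<mu>" "lift \<mu> ` W \<subseteq> specht \<mu>"
      unfolding specht_hook using * by (intro image_mono; simp)+
    ultimately have "lift \<mu> ` U \<subseteq> lift \<mu> ` W \<or> lift \<mu> ` W \<subseteq> lift \<mu> ` U"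
      using uni unfolding uniserial_def by (simp only: simp_thms)
    then show "U \<subseteq> W \<or> W \<subseteq> U" using mono * by blast
  qed
next
  assume uni: "uniserial_on {1..n} (cycles {1..n} r :: (nat set \<Rightarrow> 'a) set)"
  show "uniserial \<mu> (specht \<mu> :: (tabloid \<Rightarrow> 'a) set)"
    unfolding uniserial_def
  proof (intro allI impI)
    fix U W :: "(tabloid \<Rightarrow> 'a) set"
    assume *: "submodule \<mu> U \<and> U \<subseteq> specht \<mu> \<and> submodule \<mu> W \<and> W \<subseteq> specht \<mu>"
    obtain U' where U': "invariant {1..n} U'" "U' \<subseteq> cycles {1..n} r" "U = lift \<mu> ` U'"
      using submodule_specht_hookE[of U] * by blast
    obtain W' where W': "invariant {1..n} W'" "W' \<subseteq> cycles {1..n} r" "W = lift \<mu> ` W'"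
      using submodule_specht_hookE[of W] * by blast
    have "U' \<subseteq> W' \<or> W' \<subseteq> U'" using uni U' W' unfolding uniserial_on_def by blast
    then show "U \<subseteq> W \<or> W \<subseteq> U" unfolding U'(3) W'(3) by blast
  qed
qed

end

end

theorem theorem7p5:
  fixes n r :: nat
  assumes "CHAR('a::field) = 2"
    and "0 < n"
    and "r < n - r"
  shows "uniserial (hook n r) (specht (hook n r) :: (tabloid \<Rightarrow> 'a) set) \<longleftrightarrow>
           r = 0 \<or>
           r = 1 \<or>
           (r = 2 \<and> (n mod 4 = 1 \<or> n mod 4 = 2)) \<or>
           (r = 3 \<and> n mod 4 = 3)"
proof -
  have "uniserial (hook n r) (specht (hook n r) :: (tabloid \<Rightarrow> 'a) set) \<longleftrightarrow>
      uniserial_on {1..n} (cycles {1..n} r :: (nat set \<Rightarrow> 'a) set)"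
    by (rule uniserial_specht_hook_iff[OF assms(3,1)])
  then show ?thesis
    using uniserial_on_cycles_iff[OF assms(1), of "{1..n}" r] assms(3) by simp
qed

end
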